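(* Let $N\ge 1$ be an integer and $p>1$ a real number. 1) Suppose that $N>p$. Let $h:\mathbb{R}^N\to[0,\infty)$ be a nonnegative continuous function for which there exist constants $a>0$ and $\gamma>-p$ such that $h(x)=a|x|^\gamma$ for all $x$ with $|x|$ sufficiently large. Let $q$ be a real number with $$p-1<q\le \frac{(N+\gamma)(p-1)}{N-p}.$$ If $u\in W^{1,p}_{\rm loc}(\mathbb{R}^N)\cap C(\mathbb{R}^N)$ is a nonnegative weak solution of $$-\operatorname{div}\left(|\nabla u|^{p-2}\nabla u\right)\ge h(x)\,u^q\quad\text{in }\mathbb{R}^N,$$ then $u\equiv 0$. 2) Suppose that $N\le p$. If $u\in W^{1,p}_{\rm loc}(\mathbb{R}^N)\cap C(\mathbb{R}^N)$ is bounded below and is a weak solution of $$-\operatorname{div}\left(|\nabla u|^{p-2}\nabla u\right)\ge 0\quad\text{in }\mathbb{R}^N,$$ then $u$ is constant.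
   Context: A function $u\in W^{1,p}_{\rm loc}(\mathbb{R}^N)$ is a weak solution of $-\operatorname{div}(|\nabla u|^{p-2}\nabla u)\ge f$ in $\mathbb{R}^N$ if $$\int_{\mathbb{R}^N}|\nabla u|^{p-2}\nabla u\cdot\nabla\varphi\,dx\ \ge\ \int_{\mathbb{R}^N}f\varphi\,dx$$ for all $\varphi\in C_c^\infty(\mathbb{R}^N)$ with $\varphi\ge 0$. *)

theory Defs
  imports "HOL-Analysis.Analysis"
begin

primrec C_k :: "nat \<Rightarrow> ('a::euclidean_space \<Rightarrow> real) \<Rightarrow> bool" where
  "C_k 0 f \<longleftrightarrow> continuous_on UNIV f"
| "C_k (Suc k) f \<longleftrightarrow>
     f differentiable_on UNIV \<and> (\<forall>b\<in>Basis. C_k k (\<lambda>x. frechet_derivative f (at x) b))"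

definition smooth :: "('a::euclidean_space \<Rightarrow> real) \<Rightarrow> bool" where
  "smooth f \<longleftrightarrow> (\<forall>k. C_k k f)"

definition test_function :: "('a::euclidean_space \<Rightarrow> real) \<Rightarrow> bool" where
  "test_function \<phi> \<longleftrightarrow> smooth \<phi> \<and> compact (closure {x. \<phi> x \<noteq> 0})"

text \<open>The classical gradient; meaningful where \<open>f\<close> is differentiable.\<close>

definition grad :: "('a::euclidean_space \<Rightarrow> real) \<Rightarrow> 'a \<Rightarrow> 'a" where
  "grad f x = (\<Sum>b\<in>Basis. frechet_derivative f (at x) b *\<^sub>R b)"

definition locally_integrable :: "('a::euclidean_space \<Rightarrow> 'b::euclidean_space) \<Rightarrow> bool" where
  "locally_integrable f \<longleftrightarrow> (\<forall>K. compact K \<longrightarrow> set_integrable lebesgue K f)"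

definition Lp_loc :: "real \<Rightarrow> ('a::euclidean_space \<Rightarrow> 'b::euclidean_space) \<Rightarrow> bool" where
  "Lp_loc p f \<longleftrightarrow> f \<in> borel_measurable lebesgue \<and>
     (\<forall>K. compact K \<longrightarrow> set_integrable lebesgue K (\<lambda>x. norm (f x) powr p))"

definition has_weak_gradient ::
    "('a::euclidean_space \<Rightarrow> real) \<Rightarrow> ('a \<Rightarrow> 'a) \<Rightarrow> bool" where
  "has_weak_gradient u G \<longleftrightarrow> locally_integrable u \<and> locally_integrable G \<and>
     (\<forall>\<phi>. test_function \<phi> \<longrightarrow> (\<forall>b\<in>Basis.
        (LINT x|lebesgue. u x * (grad \<phi> x \<bullet> b)) = - (LINT x|lebesgue. (G x \<bullet> b) * \<phi> x)))"

text \<open>Weak gradients are unique only up to null sets, so this picks an arbitrary representative;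
  it is unspecified if \<open>u\<close> has no weak gradient.\<close>

definition weak_grad :: "('a::euclidean_space \<Rightarrow> real) \<Rightarrow> 'a \<Rightarrow> 'a" where
  "weak_grad u = (SOME G. has_weak_gradient u G)"

definition W1p_loc :: "real \<Rightarrow> ('a::euclidean_space \<Rightarrow> real) \<Rightarrow> bool" where
  "W1p_loc p u \<longleftrightarrow> Lp_loc p u \<and> (\<exists>G. has_weak_gradient u G \<and> Lp_loc p G)"

text \<open>The flux \<open>|v|\<^bsup>p-2\<^esup> v\<close> is \<open>0\<close> at \<open>v = 0\<close> for every \<open>p\<close>, which for \<open>p > 1\<close> is its
  continuous extension (this matters for \<open>1 < p < 2\<close>).\<close>

definition p_flux :: "real \<Rightarrow> 'a::euclidean_space \<Rightarrow> 'a" where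
  "p_flux p v = (norm v powr (p - 2)) *\<^sub>R v"

text \<open>\<open>u\<close> is a weak solution of \<open>- div (|\<nabla>u|\<^bsup>p-2\<^esup> \<nabla>u) \<ge> f\<close> in the whole space.
  The left integrand is integrable for \<open>u\<close> in \<open>W\<^bsup>1,p\<^esup>\<^sub>l\<^sub>o\<^sub>c\<close>, \<open>p > 1\<close>; the right one is for locally
  integrable, in particular for continuous, \<open>f\<close>.\<close>

definition weak_supersolution ::
    "real \<Rightarrow> ('a::euclidean_space \<Rightarrow> real) \<Rightarrow> ('a \<Rightarrow> real) \<Rightarrow> bool" where
  "weak_supersolution p f u \<longleftrightarrow> W1p_loc p u \<and>
     (\<forall>\<phi>. test_function \<phi> \<and> (\<forall>x. 0 \<le> \<phi> x) \<longrightarrow>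
        (LINT x|lebesgue. p_flux p (weak_grad u x) \<bullet> grad \<phi> x) \<ge> (LINT x|lebesgue. f x * \<phi> x))"

end

theory Submission
  imports Defs
begin

text \<open>
  The proof is the nonlinear capacity (test function) method. Write \<open>v = u + \<tau>\<close> with a shift \<open>\<tau>\<close> that
  makes \<open>v\<close> bounded below by a positive constant, and let \<open>\<eta>\<close> be a smooth cutoff. Testing
  \<open>- div (|\<nabla>u|\<^bsup>p-2\<^esup> \<nabla>u) \<ge> f\<close> with \<open>\<eta> v\<^bsup>-d\<^esup>\<close>, \<open>d \<ge> 0\<close>, gives the one inequality that is extracted
  from the equation (\<open>energy_inequality\<close>):
  \<open>\<integral> f \<eta> v\<^bsup>-d\<^esup> + d \<integral> |\<nabla>u|\<^bsup>p\<^esup> \<eta> v\<^bsup>-d-1\<^esup> \<le> \<integral> v\<^bsup>-d\<^esup> |\<nabla>u|\<^bsup>p-1\<^esup> |\<nabla>\<eta>|\<close>.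

  Take for \<open>\<eta>\<close> a high power of a cutoff between the balls of radius \<open>R\<close> and \<open>2R\<close>. The right-hand side
  then lives on an annulus and \<open>|\<nabla>\<eta>|\<close> is of order \<open>1/R\<close>.

  In dimension \<open>N \<le> p\<close> choose \<open>d = p - 1\<close> and drop the term with \<open>f\<close>. Hoelder's inequality turns the estimate into
  \<open>X(R) \<le> K (annulus part of X(R))\<^bsup>(p-1)/p\<^esup>\<close> for \<open>X(R) = \<integral> |\<nabla>u|\<^bsup>p\<^esup> v\<^bsup>-p\<^esup> \<eta>\<close>, where \<open>K\<close> does not depend
  on \<open>R\<close> because the annulus has volume of order \<open>R\<^bsup>N\<^esup>\<close> and \<open>N \<le> p\<close>. Such a bound with an exponent
  below one first makes the total integral finite; then the annulus parts tend to zero, so the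
  integral is zero (\<open>self_improving_vanish\<close>). This covers the borderline \<open>N = p\<close>
  as well. Hence \<open>\<nabla>u = 0\<close> and \<open>u\<close> is constant.

  In dimension \<open>N > p\<close> let \<open>f = h u\<^bsup>q\<^esup>\<close>. The inequality with a small \<open>d > 0\<close> bounds the weighted energy
  \<open>\<integral> |\<nabla>u|\<^bsup>p\<^esup> v\<^bsup>-d-1\<^esup> \<eta>\<close> by a moment of \<open>v\<close> on the annulus. The inequality with \<open>d = 0\<close> bounds
  \<open>\<integral> f \<eta>\<close> by that energy and a second moment (\<open>mass_estimate\<close>). Both moments have exponents
  below \<open>q\<close>, so after letting \<open>\<tau> \<rightarrow> 0\<close> Hoelder's inequality bounds them by the part of \<open>\<integral> f \<eta>\<close> on the
  annulus. The powers of \<open>R\<close> add up to a nonpositive exponent exactly when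
  \<open>q \<le> (N + \<gamma>) (p - 1) / (N - p)\<close>, and \<open>\<integral> f \<eta> \<le> K (annulus part)\<^bsup>(p-1)/q\<^esup>\<close> results, critical exponent
  included. As above, \<open>f = 0\<close>, so \<open>u\<close> vanishes outside a ball. Then the
  energy bound with \<open>\<tau> \<rightarrow> 0\<close> has right-hand side zero, which gives \<open>\<nabla>u = 0\<close>, so \<open>u\<close> is constant and equal to zero.

  The test functions must be smooth, whereas \<open>u\<close> is only a continuous Sobolev function. So
  \<open>u\<close> is replaced by its mollifications \<open>\<rho> * u\<close> inside \<open>\<eta> v\<^bsup>-d\<^esup>\<close>. These converge pointwise, their
  gradients are the mollifications of \<open>\<nabla>u\<close>, and the passage to the limit only needs
  \<open>\<integral> |\<nabla>u|\<^bsup>p-1\<^esup> |\<rho> * \<nabla>u - \<nabla>u| \<rightarrow> 0\<close> on balls (\<open>mollification_Lp\<close>), which follows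
  from the continuity of translations in the mean.
\<close>

section \<open>Smooth functions and their closure properties\<close>

text \<open>Derivatives are computed by exhibiting them, so smoothness proofs go through this introduction rule
  instead of \<^const>\<open>frechet_derivative\<close>.\<close>

lemma C_k_SucI:
  assumes "\<And>x. (f has_derivative f' x) (at x)"
    and "\<And>b. b \<in> Basis \<Longrightarrow> C_k k (\<lambda>x. f' x b)"
  shows "C_k (Suc k) f"
proof -
  have "frechet_derivative f (at x) = f' x" for x
    using frechet_derivative_at[OF assms(1)] by simp
  moreover have "f differentiable_on UNIV"
    using assms(1) by (auto simp: differentiable_on_def differentiable_def)
  ultimately show ?thesis using assms(2) by simp
qed

lemma C_k_SucD:
  assumes "C_k (Suc k) f"
  shows "(f has_derivative frechet_derivative f (at x)) (at x)"
    and "b \<in> Basis \<Longrightarrow> C_k k (\<lambda>x. frechet_derivative f (at x) b)"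
  using assms frechet_derivative_works by (auto simp: differentiable_on_def)

lemma C_k_Suc_imp: "C_k (Suc k) f \<Longrightarrow> C_k k f"
proof (induction k arbitrary: f)
  case 0
  then show ?case by (auto intro: differentiable_imp_continuous_on)
next
  case (Suc k)
  then show ?case by (metis C_k.simps(2))
qed

lemma C_k_const [simp]: "C_k k (\<lambda>x. c)"
proof (induction k arbitrary: c)
  case (Suc k)
  show ?case by (rule C_k_SucI[where f' = "\<lambda>x h. 0"]) (auto simp: Suc)
qed auto

lemma C_k_add: "C_k k f \<Longrightarrow> C_k k g \<Longrightarrow> C_k k (\<lambda>x. f x + g x)"
proof (induction k arbitrary: f g)
  case 0
  then show ?case by (auto intro: continuous_on_add)
next
  case (Suc k)
  show ?case
    by (rule C_k_SucI[OF has_derivative_add[OF C_k_SucD(1)[OF Suc.prems(1)] C_k_SucD(1)[OF Suc.prems(2)]]])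
       (intro Suc.IH C_k_SucD(2)[OF Suc.prems(1)] C_k_SucD(2)[OF Suc.prems(2)]; assumption)
qed

lemma C_k_mult: "C_k k f \<Longrightarrow> C_k k g \<Longrightarrow> C_k k (\<lambda>x. f x * g x)"
proof (induction k arbitrary: f g)
  case 0
  then show ?case by (auto intro: continuous_on_mult)
next
  case (Suc k)
  show ?case
    by (rule C_k_SucI[OF has_derivative_mult[OF C_k_SucD(1)[OF Suc.prems(1)] C_k_SucD(1)[OF Suc.prems(2)]]])
       (intro C_k_add Suc.IH C_k_SucD(2)[OF Suc.prems(1)] C_k_SucD(2)[OF Suc.prems(2)]
         C_k_Suc_imp[OF Suc.prems(1)] C_k_Suc_imp[OF Suc.prems(2)]; assumption)
qed

lemma C_k_power: "C_k k f \<Longrightarrow> C_k k (\<lambda>x. f x ^ n)"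
  by (induction n) (auto intro: C_k_mult)

lemma C_k_sum: "finite I \<Longrightarrow> (\<And>i. i \<in> I \<Longrightarrow> C_k k (f i)) \<Longrightarrow> C_k k (\<lambda>x. \<Sum>i\<in>I. f i x)"
  by (induction I rule: finite_induct) (auto intro: C_k_add)

lemma C_k_affine:
  "C_k k f \<Longrightarrow> C_k k (\<lambda>x. f (a + c *\<^sub>R x))"
proof (induction k arbitrary: f)
  case 0
  then show ?case by (auto intro!: continuous_intros continuous_on_compose2[of UNIV f])
next
  case (Suc k)
  have d: "((\<lambda>x. a + c *\<^sub>R x) has_derivative (\<lambda>h. c *\<^sub>R h)) (at x)" for x
    by (auto intro!: derivative_eq_intros)
  have lin: "linear (frechet_derivative f (at x))" for x
    using C_k_SucD(1)[OF Suc.prems] has_derivative_linear by blast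
  show ?case
  proof (rule C_k_SucI[OF has_derivative_compose[OF d C_k_SucD(1)[OF Suc.prems]]])
    fix b :: 'a assume b: "b \<in> Basis"
    show "C_k k (\<lambda>x. frechet_derivative f (at (a + c *\<^sub>R x)) (c *\<^sub>R b))"
      using C_k_mult[OF C_k_const[of k c] Suc.IH[OF C_k_SucD(2)[OF Suc.prems b]]]
      by (simp add: linear_scale[OF lin])
  qed
qed

text \<open>The exponent is generalised in the induction, since differentiation lowers it by one.\<close>

lemma C_k_powr:
  assumes "C_k k f" "\<And>x. f x > 0"
  shows "C_k k (\<lambda>x. f x powr c)"
  using assms
proof (induction k arbitrary: f c)
  case 0
  then show ?case by (auto intro!: continuous_intros simp: less_imp_neq[symmetric])
next
  case (Suc k)
  have d: "((\<lambda>x. f x powr c) has_derivative (\<lambda>h. c * f x powr (c - 1) * frechet_derivative f (at x) h)) (at x)" for x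
    using Suc.prems(2)[of x]
    by (auto intro!: derivative_eq_intros C_k_SucD(1)[OF Suc.prems(1)] simp: powr_diff field_simps)
  show ?case
    by (rule C_k_SucI[OF d]) (intro C_k_mult C_k_const Suc.IH C_k_Suc_imp[OF Suc.prems(1)] C_k_SucD(2)[OF Suc.prems(1)] Suc.prems(2); assumption)
qed

text \<open>\<open>flat_exp 0\<close> is the classical smooth function \<open>e\<^bsup>-1/x\<^esup>\<close> that is flat at \<open>0\<close>. The extra factors \<open>x\<^bsup>-j\<^esup>\<close>
  make the family closed under differentiation.\<close>

definition flat_exp :: "nat \<Rightarrow> real \<Rightarrow> real" where
  "flat_exp j x = (if x > 0 then exp (- inverse x) * inverse x ^ j else 0)"


lemma flat_exp_tendsto_0: "(flat_exp j \<longlongrightarrow> 0) (at 0)"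
proof (rule filterlim_split_at)
  show "(flat_exp j \<longlongrightarrow> 0) (at_left 0)"
    by (rule tendsto_eventually) (auto simp: eventually_at_filter flat_exp_def)
  have "((\<lambda>x::real. inverse x ^ j / exp (inverse x)) \<longlongrightarrow> 0) (at_right 0)"
    by (rule filterlim_compose[OF tendsto_power_div_exp_0 filterlim_inverse_at_top_right])
  then show "(flat_exp j \<longlongrightarrow> 0) (at_right 0)"
    by (rule tendsto_cong[THEN iffD1, rotated])
       (auto simp: eventually_at_filter flat_exp_def field_simps exp_minus)
qed

lemma flat_exp_has_derivative:
  "(flat_exp j has_real_derivative flat_exp (j + 2) x - real j * flat_exp (j + 1) x) (at x)"
proof (cases x "0::real" rule: linorder_cases)
  case greater
  have "((\<lambda>x. exp (- inverse x) * inverse x ^ j) has_real_derivative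
      exp (- inverse x) * (inverse x * inverse x) * inverse x ^ j
      - exp (- inverse x) * (real j * inverse x ^ (j - 1) * (inverse x * inverse x))) (at x)"
    using greater by (auto intro!: derivative_eq_intros)
  also have "real j * inverse x ^ (j - 1) * (inverse x * inverse x) = real j * inverse x ^ (j + 1)"
    by (cases j) (auto simp: mult_ac)
  finally have "((\<lambda>x. exp (- inverse x) * inverse x ^ j) has_real_derivative
      flat_exp (j + 2) x - real j * flat_exp (j + 1) x) (at x)"
    using greater by (simp add: flat_exp_def mult_ac)
  moreover have "\<forall>\<^sub>F y in nhds x. exp (- inverse y) * inverse y ^ j = flat_exp j y"
    using eventually_nhds_in_open[of "{0<..}" x] greater by (auto elim!: eventually_mono simp: flat_exp_def)
  ultimately show ?thesis
    using DERIV_cong_ev[OF refl _ refl] by metis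
next
  case less
  have "\<forall>\<^sub>F y in nhds x. 0 = flat_exp j y"
    using eventually_nhds_in_open[of "{..<0}" x] less by (auto elim!: eventually_mono simp: flat_exp_def)
  then show ?thesis
    using DERIV_cong_ev[OF refl _ refl, of "\<lambda>_. 0" "flat_exp j" x 0] less by (simp add: flat_exp_def)
next
  case equal
  have "((\<lambda>h. flat_exp (Suc j) h) \<longlongrightarrow> 0) (at 0)" by (rule flat_exp_tendsto_0)
  then have "((\<lambda>h. (flat_exp j (0 + h) - flat_exp j 0) / h) \<longlongrightarrow> 0) (at 0)"
    by (rule tendsto_cong[THEN iffD1, rotated]) (auto simp: eventually_at_filter flat_exp_def divide_inverse mult_ac)
  moreover have "flat_exp (j + 2) x - real j * flat_exp (j + 1) x = 0"
    using equal by (simp add: flat_exp_def)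
  ultimately show ?thesis
    unfolding DERIV_def equal by simp
qed

lemma flat_exp_nonneg [simp]: "flat_exp j x \<ge> 0"
  by (simp add: flat_exp_def)

lemma flat_exp_pos_iff: "flat_exp j x > 0 \<longleftrightarrow> x > 0"
  by (simp add: flat_exp_def)

text \<open>Each derivative is a combination of two members of the family with larger index; the induction
  therefore runs over all \<open>j\<close> simultaneously.\<close>

lemma C_k_flat_exp: "C_k k f \<Longrightarrow> C_k k (\<lambda>x. flat_exp j (f x))"
proof (induction k arbitrary: f j)
  case 0
  have "continuous_on UNIV (flat_exp j)"
    by (intro continuous_at_imp_continuous_on ballI DERIV_isCont[OF flat_exp_has_derivative])
  then show ?case using 0 by (auto intro: continuous_on_compose2)
next
  case (Suc k)
  have d: "((\<lambda>x. flat_exp j (f x)) has_derivative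
      (\<lambda>h. frechet_derivative f (at x) h * (flat_exp (j + 2) (f x) + (- real j) * flat_exp (j + 1) (f x)))) (at x)" for x
    using DERIV_compose_FDERIV[OF flat_exp_has_derivative C_k_SucD(1)[OF Suc.prems]] by simp
  show ?case
    by (rule C_k_SucI[OF d])
       (intro C_k_mult C_k_const C_k_add Suc.IH C_k_Suc_imp[OF Suc.prems] C_k_SucD(2)[OF Suc.prems]; assumption)
qed

lemma C_k_inner_component: "C_k k (\<lambda>x. x \<bullet> a)"
proof (cases k)
  case (Suc n)
  show ?thesis unfolding Suc
    by (rule C_k_SucI[where f' = "\<lambda>x h. h \<bullet> a"]) (auto intro!: derivative_eq_intros)
qed (auto intro!: continuous_intros)

lemma smooth_norm_sq: "smooth (\<lambda>x. (norm x)\<^sup>2)"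
  unfolding smooth_def power2_norm_eq_inner 
  by (subst euclidean_inner) (auto intro!: C_k_sum C_k_mult C_k_inner_component)

section \<open>Test functions and gradients\<close>

lemma test_functionI:
  assumes "smooth f" "bounded {x. f x \<noteq> 0}"
  shows "test_function f"
  using assms by (simp add: test_function_def)

lemma test_function_bounded: "test_function f \<Longrightarrow> \<exists>R>0. \<forall>x. norm x > R \<longrightarrow> f x = 0"
proof -
  assume "test_function f"
  then have "bounded {x. f x \<noteq> 0}"
    by (auto simp: test_function_def)
  then obtain R where "R > 0" "\<forall>x\<in>{x. f x \<noteq> 0}. norm x \<le> R" using bounded_pos by blast
  then show ?thesis by force
qed

lemma smooth_has_derivative: "smooth f \<Longrightarrow> (f has_derivative (\<lambda>h. grad f x \<bullet> h)) (at x)"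
proof -
  assume "smooth f"
  then have "C_k (Suc 0) f" by (auto simp: smooth_def)
  from C_k_SucD(1)[OF this, of x] have d: "(f has_derivative frechet_derivative f (at x)) (at x)" .
  then have lin: "linear (frechet_derivative f (at x))" using has_derivative_linear by blast
  have "frechet_derivative f (at x) h = grad f x \<bullet> h" for h
  proof -
    have "frechet_derivative f (at x) h = frechet_derivative f (at x) (\<Sum>b\<in>Basis. (h \<bullet> b) *\<^sub>R b)"
      by (simp add: euclidean_representation)
    also have "\<dots> = grad f x \<bullet> h"
      by (simp add: linear_sum[OF lin] linear_scale[OF lin] grad_def inner_sum_left inner_sum_right inner_commute mult.commute)
    finally show ?thesis .
  qed
  then show ?thesis using d by (metis (no_types, lifting) ext)
qed

lemma grad_unique:
  assumes "(f has_derivative (\<lambda>h. v \<bullet> h)) (at x)"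
  shows "grad f x = v"
  using frechet_derivative_at[OF assms, symmetric]
  by (simp add: grad_def euclidean_representation)

lemma continuous_on_grad:
  assumes "smooth f" shows "continuous_on S (grad f)"
proof -
  have "C_k (Suc 0) f" using assms by (auto simp: smooth_def)
  then have "\<forall>b\<in>Basis. continuous_on UNIV (\<lambda>x. frechet_derivative f (at x) b)" by auto
  then show ?thesis unfolding grad_def
    by (intro continuous_intros) (auto intro: continuous_on_subset)
qed

lemma smooth_continuous: "smooth f \<Longrightarrow> continuous_on S f"
  using smooth_def C_k.simps(1) continuous_on_subset by blast

lemma grad_locally_constant:
  fixes f :: "'a::euclidean_space \<Rightarrow> real"
  assumes "open S" "x \<in> S" "\<And>y. y \<in> S \<Longrightarrow> f y = c"
  shows "grad f x = 0"
proof (rule grad_unique)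
  have "((\<lambda>_. c) has_derivative (\<lambda>h. 0 \<bullet> h)) (at x)" by simp
  then show "(f has_derivative (\<lambda>h. 0 \<bullet> h)) (at x)"
    by (rule has_derivative_transform_within_open[OF _ assms(1,2)]) (simp add: assms(3))
qed

lemma grad_outside:
  fixes f :: "'a::euclidean_space \<Rightarrow> real"
  assumes "\<And>x. norm x > R \<Longrightarrow> f x = c" "norm x > R"
  shows "grad f x = 0"
  using assms
  by (intro grad_locally_constant[of "{x. norm x > R}"] open_Collect_less continuous_intros) auto

lemma grad_inside:
  fixes f :: "'a::euclidean_space \<Rightarrow> real"
  assumes "\<And>x. norm x < R \<Longrightarrow> f x = c" "norm x < R"
  shows "grad f x = 0"
  using assms
  by (intro grad_locally_constant[of "{x. norm x < R}"] open_Collect_less continuous_intros) auto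

section \<open>Cutoffs and mollifiers\<close>

text \<open>The usual quotient with a denominator that never vanishes; the power \<open>-1\<close> makes it an instance of
  \<open>C_k_powr\<close>.\<close>

definition cutoff :: "'a::euclidean_space \<Rightarrow> real" where
  "cutoff x = flat_exp 0 (4 - (norm x)\<^sup>2) * (flat_exp 0 (4 - (norm x)\<^sup>2) + flat_exp 0 ((norm x)\<^sup>2 - 1)) powr - 1"

lemma cutoff_denom_pos: "flat_exp 0 (4 - t) + flat_exp 0 (t - 1) > 0"
proof (cases "t < 4")
  case True then show ?thesis using flat_exp_pos_iff[of 0 "4 - t"] flat_exp_nonneg[of 0 "t - 1"] by linarith
next
  case False then show ?thesis using flat_exp_pos_iff[of 0 "t-1"] flat_exp_nonneg[of 0 "4-t"] by linarith
qed

lemma smooth_cutoff: "smooth (cutoff :: 'a::euclidean_space \<Rightarrow> real)"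
proof -
  have "C_k k (cutoff :: 'a \<Rightarrow> real)" for k
  proof -
    have 0: "C_k k (\<lambda>x::'a. (norm x)\<^sup>2)" using smooth_norm_sq[where 'a='a] by (simp add: smooth_def)
    have 1: "C_k k (\<lambda>x::'a. 4 - (norm x)\<^sup>2)"
      using C_k_add[OF C_k_const[of k 4] C_k_mult[OF C_k_const[of k "-1"] 0]] by simp
    have 2: "C_k k (\<lambda>x::'a. (norm x)\<^sup>2 - 1)" 
      using C_k_add[OF 0 C_k_const[of k "-1"]] by simp
    show ?thesis unfolding cutoff_def[abs_def]
      by (intro C_k_mult C_k_powr C_k_add C_k_flat_exp 1 2 cutoff_denom_pos)
  qed
  then show ?thesis by (simp add: smooth_def)
qed

lemma cutoff_bounds: "0 \<le> cutoff x" "cutoff x \<le> 1"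
proof -
  show "0 \<le> cutoff x" by (simp add: cutoff_def)
  have "flat_exp 0 (4 - (norm x)\<^sup>2) \<le> flat_exp 0 (4 - (norm x)\<^sup>2) + flat_exp 0 ((norm x)\<^sup>2 - 1)" by simp
  then show "cutoff x \<le> 1" using cutoff_denom_pos[of "(norm x)\<^sup>2"]
    by (simp add: cutoff_def powr_minus divide_inverse[symmetric])
qed

lemma cutoff_eq_1: "norm x \<le> 1 \<Longrightarrow> cutoff x = 1"
proof -
  assume "norm x \<le> 1"
  then have "(norm x)\<^sup>2 \<le> 1" by (simp add: power_le_one)
  then have "flat_exp 0 ((norm x)\<^sup>2 - 1) = 0" "flat_exp 0 (4 - (norm x)\<^sup>2) > 0" by (auto simp: flat_exp_def)
  then show ?thesis by (simp add: cutoff_def powr_minus)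
qed

lemma cutoff_eq_0: "norm x \<ge> 2 \<Longrightarrow> cutoff x = 0"
proof -
  assume "norm x \<ge> 2"
  then have "(norm x)\<^sup>2 \<ge> 2\<^sup>2" by (intro power_mono) auto
  then show ?thesis by (simp add: cutoff_def flat_exp_def)
qed

definition mollifier :: "real \<Rightarrow> ('a::euclidean_space \<Rightarrow> real) \<Rightarrow> bool" where
  "mollifier e \<rho> \<longleftrightarrow> test_function \<rho> \<and> (\<forall>x. \<rho> x \<ge> 0) \<and> (\<forall>x. norm x \<ge> e \<longrightarrow> \<rho> x = 0) \<and>
    integrable lborel \<rho> \<and> (LINT x|lborel. \<rho> x) = 1"

text \<open>The bump \<open>flat_exp 0 (e\<^sup>2 - |x|\<^sup>2)\<close>, divided by its integral.\<close>

lemma mollifier_exists: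
  assumes "e > 0"
  shows "\<exists>\<rho> :: 'a::euclidean_space \<Rightarrow> real. mollifier e \<rho>"
proof -
  define b :: "'a \<Rightarrow> real" where "b x = flat_exp 0 (e\<^sup>2 - (norm x)\<^sup>2)" for x
  have Cb: "C_k k b" for k
  proof -
    have 0: "C_k k (\<lambda>x::'a. (norm x)\<^sup>2)" using smooth_norm_sq[where 'a='a] by (simp add: smooth_def)
    show ?thesis unfolding b_def
      using C_k_add[OF C_k_const[of k "e\<^sup>2"] C_k_mult[OF C_k_const[of k "-1"] 0]]
      by (intro C_k_flat_exp) simp
  qed
  have b0: "b x \<ge> 0" for x by (simp add: b_def)
  have bz: "b x = 0" if "norm x \<ge> e" for x
  proof -
    have "(norm x)\<^sup>2 \<ge> e\<^sup>2" using that assms by (intro power_mono) auto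
    then show ?thesis by (simp add: b_def flat_exp_def)
  qed
  have contb: "continuous_on S b" for S using Cb[of 0] by (auto intro: continuous_on_subset)
  have "integrable lborel (\<lambda>x. indicator (cball 0 e) x *\<^sub>R b x)"
    by (rule borel_integrable_compact) (auto intro: contb)
  also have "(\<lambda>x. indicator (cball 0 e) x *\<^sub>R b x) = b"
    using bz by (auto simp: indicator_def fun_eq_iff)
  finally have intb: "integrable lborel b" .
  have "(LINT x|lborel. b x) > 0"
  proof -
    have "(LINT x|lborel. b x) \<noteq> 0"
    proof
      assume "(LINT x|lborel. b x) = 0"
      then have "AE x in lborel. b x = 0"
        using integral_nonneg_eq_0_iff_AE[OF intb] b0 by auto
      then have "AE x in lborel. x \<notin> ball (0::'a) e"
      proof (rule eventually_mono)
        fix x :: 'a assume "b x = 0"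
        then have "\<not> e\<^sup>2 - (norm x)\<^sup>2 > 0" using flat_exp_pos_iff[of 0 "e\<^sup>2 - (norm x)\<^sup>2"] unfolding b_def by simp
        then show "x \<notin> ball (0::'a) e" using assms by (auto simp: not_less power_mono_iff power_strict_mono)
      qed
      then have "emeasure lborel (ball (0::'a) e) = 0"
        by (subst (asm) AE_iff_measurable[OF _ refl]) (auto simp: ball_def)
      then have "ball (0::'a) e \<in> null_sets lborel" by (simp add: null_sets_def)
      then have "negligible (ball (0::'a) e)"
        unfolding negligible_iff_null_sets by (rule null_sets_completionI)
      then show False using assms open_not_negligible[of "ball (0::'a) e"] by auto
    qed
    then show ?thesis using integral_nonneg_AE[of b lborel] b0 by (auto simp: less_le)
  qed
  then obtain c where c: "c > 0" "(LINT x|lborel. b x) = c" by blast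
  have "test_function (\<lambda>x. (1 / c) * b x)"
  proof (rule test_functionI)
      show "smooth (\<lambda>x. (1 / c) * b x)" unfolding smooth_def by (intro allI C_k_mult C_k_const Cb)
      have "{x. 1 / c * b x \<noteq> 0} \<subseteq> ball 0 e" using bz by (auto simp: not_less[symmetric]) (meson bz not_less)
      then show "bounded {x. 1 / c * b x \<noteq> 0}" using bounded_subset bounded_ball by blast
  qed
  then have "mollifier e (\<lambda>x. (1 / c) * b x)"
    using c b0 bz intb by (auto simp: mollifier_def)
  then show ?thesis by blast
qed

section \<open>Convolution with a test function\<close>

definition conv :: "('a::euclidean_space \<Rightarrow> real) \<Rightarrow> ('a \<Rightarrow> 'b::euclidean_space) \<Rightarrow> 'a \<Rightarrow> 'b" where
  "conv \<rho> g x = (LINT y|lborel. \<rho> (x - y) *\<^sub>R g y)"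

text \<open>Local integrability in terms of Borel functions and \<^const>\<open>lborel\<close>, where Fubini's theorem is
  available. Balls around the origin exhaust all compact sets.\<close>

definition loc_int :: "('a::euclidean_space \<Rightarrow> 'b::euclidean_space) \<Rightarrow> bool" where
  "loc_int f \<longleftrightarrow> (\<forall>R. set_integrable lborel (cball 0 R) f)"

lemma loc_int_continuous: "continuous_on UNIV f \<Longrightarrow> loc_int f"
  unfolding loc_int_def set_integrable_def
  by (auto intro!: borel_integrable_compact intro: continuous_on_subset)

lemma integrable_bounded_support_mult:
  fixes g :: "'a::euclidean_space \<Rightarrow> 'b::euclidean_space" and f :: "'a \<Rightarrow> real"
  assumes g: "loc_int g" "g \<in> borel_measurable borel"
    and f: "f \<in> borel_measurable borel" "\<And>x. \<bar>f x\<bar> \<le> C" "\<And>x. norm x > R \<Longrightarrow> f x = 0"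
  shows "integrable lborel (\<lambda>x. f x *\<^sub>R g x)"
proof -
  have "integrable lborel (\<lambda>x. C *\<^sub>R (indicator (cball 0 R) x *\<^sub>R g x))"
    using g unfolding loc_int_def set_integrable_def by (intro integrable_scaleR_right) auto
  then show ?thesis
  proof (rule Bochner_Integration.integrable_bound)
    show "(\<lambda>x. f x *\<^sub>R g x) \<in> borel_measurable lborel" using g f by simp
    show "AE x in lborel. norm (f x *\<^sub>R g x) \<le> norm (C *\<^sub>R (indicator (cball 0 R) x *\<^sub>R g x))"
    proof (intro AE_I2)
      fix x
      show "norm (f x *\<^sub>R g x) \<le> norm (C *\<^sub>R (indicator (cball 0 R) x *\<^sub>R g x))"
        using f(2)[of x] f(3)[of x] by (cases "norm x \<le> R") (auto simp: indicator_def intro!: mult_right_mono)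
    qed
  qed
qed

lemma continuous_bounded_support:
  fixes f :: "'a::euclidean_space \<Rightarrow> 'b::real_normed_vector"
  assumes "continuous_on UNIV f" "\<And>x. norm x > R \<Longrightarrow> f x = 0"
  obtains C where "C > 0" "\<And>x. norm (f x) \<le> C"
proof -
  have "compact (f ` cball 0 R)"
    using assms(1) by (intro compact_continuous_image) (auto intro: continuous_on_subset)
  then obtain C where C: "C > 0" "\<And>x. x \<in> cball 0 R \<Longrightarrow> norm (f x) \<le> C"
    using compact_imp_bounded bounded_pos by (metis imageI)
  have "norm (f x) \<le> C" for x
    using C(1) C(2)[of x] assms(2)[of x] by (cases "norm x \<le> R") auto
  with C(1) show ?thesis using that by blast
qed

lemma integrable_cont_support_mult:
  fixes g :: "'a::euclidean_space \<Rightarrow> 'b::euclidean_space" and f :: "'a \<Rightarrow> real"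
  assumes g: "loc_int g" "g \<in> borel_measurable borel"
    and f: "continuous_on UNIV f" "\<And>x. norm x > R \<Longrightarrow> f x = 0"
  shows "integrable lborel (\<lambda>x. f x *\<^sub>R g x)"
proof -
  obtain C where "\<And>x. \<bar>f x\<bar> \<le> C" using continuous_bounded_support[OF f] by (metis real_norm_def)
  then show ?thesis
    using integrable_bounded_support_mult[OF g borel_measurable_continuous_onI[OF f(1)]] f(2) by blast
qed

lemma integrable_conv:
  fixes g :: "'a::euclidean_space \<Rightarrow> 'b::euclidean_space" and f :: "'a \<Rightarrow> real"
  assumes g: "loc_int g" "g \<in> borel_measurable borel"
    and f: "continuous_on UNIV f" "\<And>x. norm x > R \<Longrightarrow> f x = 0"
  shows "integrable lborel (\<lambda>y. f (x - y) *\<^sub>R g y)"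
proof (rule integrable_cont_support_mult[OF g])
  show "continuous_on UNIV (\<lambda>y. f (x - y))"
    by (rule continuous_on_compose2[OF f(1)]) (auto intro!: continuous_intros)
  fix y :: 'a assume "norm y > R + norm x"
  then have "norm (x - y) > R" using norm_triangle_ineq2[of y x] by (simp add: norm_minus_commute)
  then show "f (x - y) = 0" by (rule f(2))
qed

text \<open>Near \<open>x0\<close> only the values of \<open>u\<close> on one fixed box matter, because \<open>\<rho>\<close> has bounded support. On that
  box one can differentiate under the integral sign.\<close>

lemma conv_has_derivative:
  fixes u :: "'a::euclidean_space \<Rightarrow> real"
  assumes rho: "test_function \<rho>" and u: "continuous_on UNIV u"
  shows "\<exists>D. (conv \<rho> u has_derivative D) (at x0) \<and>
    (\<forall>b. D b = conv (\<lambda>z. grad \<rho> z \<bullet> b) u x0)"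
proof -
  from rho have sm: "smooth \<rho>" by (simp add: test_function_def)
  have cr: "continuous_on S \<rho>" and cg: "continuous_on S (grad \<rho>)" for S
    using sm by (auto intro: smooth_continuous continuous_on_grad)
  obtain R where R: "\<And>x. norm x > R \<Longrightarrow> \<rho> x = 0"
    using test_function_bounded[OF rho] by blast
  have R': "norm x > R \<Longrightarrow> grad \<rho> x = 0" for x
    using grad_outside[of R \<rho> 0 x] R by blast
  obtain c where c: "cball x0 (R + 1) \<subseteq> cbox (-c) c"
    using bounded_subset_cbox_symmetric[OF bounded_cball] by blast
  define U where "U = ball x0 1"
  have far: "norm (x - y) > R" if "x \<in> U" "y \<notin> cbox (-c) c" for x y
  proof -
    have "dist x0 y > R + 1" using that c by (auto simp: subset_iff not_le)
    moreover have "dist x0 x < 1" using that by (simp add: U_def)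
    ultimately show ?thesis using dist_triangle[of x0 y x] by (simp add: dist_norm)
  qed
  have conv_eq: "(LINT y|lborel. f (x - y) *\<^sub>R u y) = integral (cbox (-c) c) (\<lambda>y. f (x - y) * u y)"
    if f: "continuous_on UNIV f" "\<And>x. norm x > R \<Longrightarrow> f x = 0" and x: "x \<in> U" for f :: "'a \<Rightarrow> real" and x
  proof -
    have "(LINT y|lborel. f (x - y) *\<^sub>R u y) = (LINT y:cbox (-c) c|lborel. f (x - y) * u y)"
      unfolding set_lebesgue_integral_def
      by (intro Bochner_Integration.integral_cong refl) (use far[OF x] f(2) in \<open>auto simp: indicator_def\<close>)
    also have "\<dots> = integral (cbox (-c) c) (\<lambda>y. f (x - y) * u y)"
    proof (rule set_borel_integral_eq_integral)
      show "set_integrable lborel (cbox (- c) c) (\<lambda>y. f (x - y) * u y)"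
        unfolding set_integrable_def
        by (rule borel_integrable_compact)
          (auto intro!: continuous_intros continuous_on_compose2[OF f(1)] continuous_on_subset[OF u])
    qed
    finally show ?thesis .
  qed
  define fx where "fx x y = u y *\<^sub>R blinfun_inner_right (grad \<rho> (x - y))" for x y
  have cfx: "continuous_on S (\<lambda>(x, y). fx x y)" for S
    unfolding fx_def split_def
    by (intro continuous_intros bounded_linear.continuous_on[OF bounded_linear_blinfun_inner_right]
       continuous_on_compose2[OF cg[of UNIV]] continuous_on_compose2[OF u]) auto
  have fxy: "continuous_on S (fx x)" for S x
    unfolding fx_def
    by (intro continuous_intros bounded_linear.continuous_on[OF bounded_linear_blinfun_inner_right]
       continuous_on_compose2[OF cg[of UNIV]] continuous_on_subset[OF u]) auto
  have atU: "at x0 within U = at x0"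
    by (rule at_within_open) (auto simp: U_def)
  have L: "((\<lambda>x. integral (cbox (-c) c) (\<lambda>y. \<rho> (x - y) * u y)) has_derivative integral (cbox (-c) c) (fx x0)) (at x0 within U)"
  proof (rule leibniz_rule)
    fix x t assume "x \<in> U"
    have "((\<lambda>x. \<rho> (x - t)) has_derivative (\<lambda>h. grad \<rho> (x - t) \<bullet> h)) (at x within U)"
      by (rule has_derivative_compose[OF _ smooth_has_derivative[OF sm]]) (auto intro!: derivative_eq_intros)
    then show "((\<lambda>x. \<rho> (x - t) * u t) has_derivative blinfun_apply (fx x t)) (at x within U)"
      by (auto intro!: derivative_eq_intros simp: fx_def blinfun.bilinear_simps mult.commute)
  next
    fix x
    show "(\<lambda>y. \<rho> (x - y) * u y) integrable_on cbox (- c) c"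
      by (intro integrable_continuous continuous_intros continuous_on_compose2[OF cr[of UNIV]] continuous_on_subset[OF u]) auto
  qed (auto simp: U_def cfx)
  have "((\<lambda>x. integral (cbox (-c) c) (\<lambda>y. \<rho> (x - y) * u y)) has_derivative integral (cbox (-c) c) (fx x0)) (at x0)"
    using L by (simp only: atU)
  then have "(conv \<rho> u has_derivative integral (cbox (-c) c) (fx x0)) (at x0)"
  proof (rule has_derivative_transform_within_open)
    show "open U" "x0 \<in> U" by (auto simp: U_def)
    show "integral (cbox (-c) c) (\<lambda>y. \<rho> (x - y) * u y) = conv \<rho> u x" if "x \<in> U" for x
      unfolding conv_def by (rule conv_eq[symmetric]) (use cr R that in auto)
  qed
  moreover have "blinfun_apply (integral (cbox (-c) c) (fx x0)) b = conv (\<lambda>z. grad \<rho> z \<bullet> b) u x0" for b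
  proof -
    have "blinfun_apply (integral (cbox (-c) c) (fx x0)) b = integral (cbox (-c) c) (\<lambda>y. fx x0 y b)"
      by (rule blinfun_apply_integral) (intro integrable_continuous fxy)
    also have "\<dots> = integral (cbox (-c) c) (\<lambda>y. (grad \<rho> (x0 - y) \<bullet> b) * u y)"
      by (simp add: fx_def blinfun.bilinear_simps mult.commute)
    also have "\<dots> = conv (\<lambda>z. grad \<rho> z \<bullet> b) u x0"
      unfolding conv_def
      by (rule conv_eq[symmetric]) (auto intro!: continuous_intros cg simp: R' U_def)
    finally show ?thesis .
  qed
  ultimately show ?thesis by blast
qed

lemma test_function_partial:
  assumes "test_function \<rho>" "b \<in> Basis"
  shows "test_function (\<lambda>z. grad \<rho> z \<bullet> b)"
proof (rule test_functionI)
  have sm: "smooth \<rho>" using assms by (simp add: test_function_def)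
  have eq: "frechet_derivative \<rho> (at x) b = grad \<rho> x \<bullet> b" for x
    using frechet_derivative_at[OF smooth_has_derivative[OF sm]] by metis
  show "smooth (\<lambda>z. grad \<rho> z \<bullet> b)"
    unfolding smooth_def
  proof
    fix k
    have "C_k (Suc k) \<rho>" using sm by (simp only: smooth_def)
    then show "C_k k (\<lambda>z. grad \<rho> z \<bullet> b)" using C_k_SucD(2)[of k \<rho>, OF _ assms(2)] unfolding eq by blast
  qed
  obtain R where R: "\<And>x. norm x > R \<Longrightarrow> \<rho> x = 0"
    using test_function_bounded[OF assms(1)] by blast
  have "{x. grad \<rho> x \<bullet> b \<noteq> 0} \<subseteq> cball 0 R"
    using grad_outside[of R \<rho> 0] R by (force simp: not_le[symmetric])
  then show "bounded {x. grad \<rho> x \<bullet> b \<noteq> 0}" using bounded_subset bounded_cball by blast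
qed

text \<open>Each derivative falls on \<open>\<rho>\<close> and leaves a convolution with another test function, so continuity of
  \<open>u\<close> suffices.\<close>

lemma smooth_conv:
  fixes u :: "'a::euclidean_space \<Rightarrow> real"
  assumes rho: "test_function \<rho>" and u: "continuous_on UNIV u"
  shows "smooth (conv \<rho> u)"
proof -
  have "C_k k (conv \<rho> u)" for k
    using rho
  proof (induction k arbitrary: \<rho>)
    case 0
    have "isCont (conv \<rho> u) x" for x
      using conv_has_derivative[OF 0 u] has_derivative_continuous by blast
    then show ?case by (simp add: continuous_at_imp_continuous_on)
  next
    case (Suc k)
    obtain D where D: "\<And>x. (conv \<rho> u has_derivative D x) (at x)"
      "\<And>x b. D x b = conv (\<lambda>z. grad \<rho> z \<bullet> b) u x"
      using conv_has_derivative[OF Suc.prems u] by metis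
    show ?case
      by (rule C_k_SucI[OF D(1)]) (simp add: D(2) Suc.IH test_function_partial[OF Suc.prems])
  qed
  then show ?thesis by (simp add: smooth_def)
qed

lemma grad_conv:
  fixes u :: "'a::euclidean_space \<Rightarrow> real"
  assumes "test_function \<rho>" "continuous_on UNIV u"
  shows "grad (conv \<rho> u) x \<bullet> b = conv (\<lambda>z. grad \<rho> z \<bullet> b) u x"
proof -
  obtain D where D: "(conv \<rho> u has_derivative D) (at x)"
      "\<And>b. D b = conv (\<lambda>z. grad \<rho> z \<bullet> b) u x"
    using conv_has_derivative[OF assms] by metis
  have "D = (\<lambda>h. grad (conv \<rho> u) x \<bullet> h)"
    using has_derivative_unique[OF D(1) smooth_has_derivative[OF smooth_conv[OF assms]]] .
  then show ?thesis using D(2) by metis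
qed

text \<open>The integral identity of \<^const>\<open>has_weak_gradient\<close> for \<^const>\<open>lborel\<close>.\<close>

definition weak_deriv :: "('a::euclidean_space \<Rightarrow> real) \<Rightarrow> ('a \<Rightarrow> 'a) \<Rightarrow> bool" where
  "weak_deriv u g \<longleftrightarrow> (\<forall>\<phi>. test_function \<phi> \<longrightarrow> (\<forall>b\<in>Basis.
        (LINT x|lborel. u x * (grad \<phi> x \<bullet> b)) = - (LINT x|lborel. (g x \<bullet> b) * \<phi> x)))"

lemma test_function_reflect:
  fixes x :: "'a::euclidean_space"
  assumes "test_function \<rho>"
  shows "test_function (\<lambda>y. \<rho> (x - y))" "grad (\<lambda>y. \<rho> (x - y)) y = - grad \<rho> (x - y)"
proof -
  have sm: "smooth \<rho>" using assms by (simp add: test_function_def)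
  show "test_function (\<lambda>y. \<rho> (x - y))"
  proof (rule test_functionI)
    show "smooth (\<lambda>y. \<rho> (x - y))"
      using sm C_k_affine[of _ \<rho> x "-1"] by (simp add: smooth_def)
    obtain R where R: "\<And>x. norm x > R \<Longrightarrow> \<rho> x = 0"
      using test_function_bounded[OF assms(1)] by blast
    have "{y. \<rho> (x - y) \<noteq> 0} \<subseteq> cball x R"
      using R by (force simp: not_le[symmetric] dist_norm)
    then show "bounded {y. \<rho> (x - y) \<noteq> 0}" using bounded_subset bounded_cball by blast
  qed
  have "((\<lambda>y. x - y) has_derivative (\<lambda>h. - h)) (at y)"
    by (auto intro!: derivative_eq_intros)
  from has_derivative_compose[OF this smooth_has_derivative[OF sm]]
  show "grad (\<lambda>y. \<rho> (x - y)) y = - grad \<rho> (x - y)"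
    by (intro grad_unique) simp
qed

text \<open>The derivative falls on \<open>\<rho> (x - \<cdot>)\<close>, which is itself a test function; the definition of the weak
  derivative moves it to \<open>u\<close>.\<close>

lemma grad_conv_weak:
  fixes u :: "'a::euclidean_space \<Rightarrow> real"
  assumes rho: "test_function \<rho>" and u: "continuous_on UNIV u"
    and g: "loc_int g" "g \<in> borel_measurable borel" "weak_deriv u g"
  shows "grad (conv \<rho> u) x = conv \<rho> g x"
proof (rule euclidean_eqI)
  fix b :: 'a assume b: "b \<in> Basis"
  have "grad (conv \<rho> u) x \<bullet> b = (LINT y|lborel. (grad \<rho> (x - y) \<bullet> b) * u y)"
    using grad_conv[OF rho u] by (simp add: conv_def)
  also have "\<dots> = - (LINT y|lborel. u y * (grad (\<lambda>y. \<rho> (x - y)) y \<bullet> b))"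
    by (simp add: test_function_reflect(2)[OF rho] mult.commute flip: integral_minus)
  also have "\<dots> = (LINT y|lborel. (g y \<bullet> b) * \<rho> (x - y))"
    using g(3) test_function_reflect(1)[OF rho] b unfolding weak_deriv_def by fastforce
  also have "\<dots> = (LINT y|lborel. (\<rho> (x - y) *\<^sub>R g y) \<bullet> b)"
    by (simp add: mult.commute)
  also have "\<dots> = conv \<rho> g x \<bullet> b"
    unfolding conv_def
  proof (rule integral_inner_left)
    obtain R where R: "\<And>x. norm x > R \<Longrightarrow> \<rho> x = 0"
      using test_function_bounded[OF rho] by blast
    show "integrable lborel (\<lambda>y. \<rho> (x - y) *\<^sub>R g y)"
      using rho R by (intro integrable_conv[OF g(1,2)]) (auto simp: test_function_def smooth_continuous)
  qed
  finally show "grad (conv \<rho> u) x \<bullet> b = conv \<rho> g x \<bullet> b" .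
qed

section \<open>Continuity of translations in the mean\<close>

lemma nn_integral_translate:
  fixes z :: "'a::euclidean_space"
  assumes "f \<in> borel_measurable borel"
  shows "(\<integral>\<^sup>+x. f (x - z) \<partial>lborel) = (\<integral>\<^sup>+x. f x \<partial>lborel)"
proof -
  have "(\<integral>\<^sup>+x. f x \<partial>lborel) = (\<integral>\<^sup>+x. f x \<partial>distr lborel borel ((+) (- z)))"
    by (simp add: lborel_distr_plus)
  also have "\<dots> = (\<integral>\<^sup>+x. f (x - z) \<partial>lborel)"
    using assms by (subst nn_integral_distr) auto
  finally show ?thesis by simp
qed

lemma nn_integral_reflect:
  fixes t :: "'a::euclidean_space"
  assumes "f \<in> borel_measurable borel"
  shows "(\<integral>\<^sup>+x. f (t - x) \<partial>lborel) = (\<integral>\<^sup>+x. f x \<partial>lborel)"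
proof -
  have "lborel = distr lborel borel (\<lambda>x. t - x)"
    using lborel_affine[of "-1" t] by (simp add: density_1)
  then have "(\<integral>\<^sup>+x. f x \<partial>lborel) = (\<integral>\<^sup>+x. f x \<partial>distr lborel borel (\<lambda>x. t - x))"
    by simp
  also have "\<dots> = (\<integral>\<^sup>+x. f (t - x) \<partial>lborel)"
    using assms by (simp add: nn_integral_distr)
  finally show ?thesis by simp
qed

text \<open>Enclose \<open>A\<close> between a compact set \<open>K\<close> and an open set \<open>U\<close> with \<open>U - K\<close> of small measure. For a shift
  shorter than the distance of \<open>K\<close> to the complement of \<open>U\<close>, the shifted and the original indicator
  can differ at \<open>x\<close> only if \<open>x\<close> or \<open>x - z\<close> lies in \<open>U - K\<close>.\<close>

lemma translation_continuous_indicator: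
  fixes A :: "'a::euclidean_space set"
  assumes A: "A \<in> sets borel" "emeasure lborel A < \<infinity>" and e: "e > (0::real)"
  shows "\<exists>d>0. \<forall>z. norm z < d \<longrightarrow>
     (\<integral>\<^sup>+x. ennreal \<bar>indicator A (x - z) - indicator A x\<bar> \<partial>lborel) \<le> ennreal e"
proof -
  have AL: "A \<in> sets lebesgue" using A(1) by simp
  have fin: "emeasure lebesgue A < \<infinity>" using A by simp
  obtain U where U: "open U" "A \<subseteq> U" "emeasure lebesgue (U - A) < ennreal (e/6)"
    using sets_lebesgue_outer_open[OF AL, of "e/6"] e by (metis divide_pos_pos zero_less_numeral)
  obtain T where T: "closed T" "T \<subseteq> A" "emeasure lebesgue (A - T) < ennreal (e/6)"
    using sets_lebesgue_inner_closed[OF AL, of "e/6"] e by (metis divide_pos_pos zero_less_numeral)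
  have TB: "T \<in> sets borel" using T by simp
  have "(\<lambda>n. emeasure lborel (T - cball 0 (real n))) \<longlonglongrightarrow> emeasure lborel (\<Inter>n. T - cball 0 (real n))"
  proof (rule Lim_emeasure_decseq)
    show "range (\<lambda>n. T - cball 0 (real n)) \<subseteq> sets lborel" using TB by auto
    show "decseq (\<lambda>n. T - cball 0 (real n))" by (force simp: decseq_def)
    fix i
    have "emeasure lborel (T - cball 0 (real i)) \<le> emeasure lborel A"
      using T A by (intro emeasure_mono) auto
    then show "emeasure lborel (T - cball 0 (real i)) \<noteq> \<infinity>" using A(2) by (auto simp: top_unique)
  qed
  moreover have "(\<Inter>n. T - cball 0 (real n)) = {}"
    using real_arch_simple by (auto simp: set_eq_iff not_less) 
  ultimately have "(\<lambda>n. emeasure lborel (T - cball 0 (real n))) \<longlonglongrightarrow> 0"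
    by (simp only: emeasure_empty)
  then have "\<forall>\<^sub>F n in sequentially. emeasure lborel (T - cball 0 (real n)) < ennreal (e/6)"
    using e by (intro order_tendstoD) (auto simp: )
  then obtain n where n: "emeasure lborel (T - cball 0 (real n)) < ennreal (e/6)"
    by (auto simp: eventually_sequentially)
  define K where "K = T \<inter> cball 0 (real n)"
  have K: "compact K" "K \<subseteq> A" using T by (auto simp: K_def)
  have KB: "K \<in> sets borel" "U \<in> sets borel" using K U by (auto intro: borel_compact)
  have UK: "emeasure lborel (U - K) \<le> ennreal (e/2)"
  proof -
    have "emeasure lborel (U - K) \<le> emeasure lborel ((U - A) \<union> (A - T) \<union> (T - cball 0 (real n)))"
      using A TB U by (intro emeasure_mono) (auto simp: K_def)
    also have "\<dots> \<le> emeasure lborel (U - A) + emeasure lborel (A - T) + emeasure lborel (T - cball 0 (real n))"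
      using A TB U by (intro order_trans[OF emeasure_subadditive] add_mono order_refl) auto
    also have "\<dots> \<le> ennreal (e/6) + ennreal (e/6) + ennreal (e/6)"
      using U T n A TB by (intro add_mono) (auto simp: less_imp_le)
    also have "\<dots> = ennreal (e/2)" using e by (simp flip: ennreal_plus)
    finally show ?thesis .
  qed
  obtain d where d: "d > 0" "\<And>x y. x \<in> K \<Longrightarrow> y \<notin> U \<Longrightarrow> d \<le> dist x y"
  proof -
    have "K \<inter> - U = {}" using K U by blast
    then have "\<exists>d>0. \<forall>x\<in>K. \<forall>y\<in>- U. d \<le> dist x y"
      using separate_compact_closed[of K "- U"] K U by (simp add: closed_def)
    then show ?thesis using that by auto
  qed
  have "(\<integral>\<^sup>+x. ennreal \<bar>indicator A (x - z) - indicator A x\<bar> \<partial>lborel) \<le> ennreal e" if z: "norm z < d" for z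
  proof -
    have pw: "ennreal \<bar>indicator A (x - z) - indicator A x\<bar> \<le> indicator (U - K) (x - z) + indicator (U - K) x" for x
    proof -
      have "x - z \<in> K \<Longrightarrow> x \<in> U" "x \<in> K \<Longrightarrow> x - z \<in> U"
        using d(2)[of "x - z" x] d(2)[of x "x - z"] z by (auto simp: dist_norm)
      then show ?thesis using K(2) U(2) by (auto simp: indicator_def)
    qed
    have "(\<integral>\<^sup>+x. ennreal \<bar>indicator A (x - z) - indicator A x\<bar> \<partial>lborel)
        \<le> (\<integral>\<^sup>+x. indicator (U - K) (x - z) + indicator (U - K) x \<partial>lborel)"
      by (intro nn_integral_mono pw)
    also have "\<dots> = (\<integral>\<^sup>+x. indicator (U - K) (x - z) \<partial>lborel) + (\<integral>\<^sup>+x. indicator (U - K) x \<partial>lborel)"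
      using KB by (intro nn_integral_add) auto
    also have "\<dots> = emeasure lborel (U - K) + emeasure lborel (U - K)"
      using KB by (subst nn_integral_translate) auto
    also have "\<dots> \<le> ennreal (e/2) + ennreal (e/2)" by (intro add_mono UK)
    also have "\<dots> = ennreal e" using e by (simp flip: ennreal_plus)
    finally show ?thesis .
  qed
  with d(1) show ?thesis by blast
qed

text \<open>The property passes from indicators to sums and to dominated limits.\<close>

lemma translation_continuous_L1:
  fixes f :: "'a::euclidean_space \<Rightarrow> 'b::euclidean_space"
  assumes "integrable lborel f" and "e > (0::real)"
  shows "\<exists>d>0. \<forall>z. norm z < d \<longrightarrow> (\<integral>\<^sup>+x. ennreal (norm (f (x - z) - f x)) \<partial>lborel) \<le> ennreal e"
  using assms
proof (induction f arbitrary: e rule: integrable_induct)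
  case (base A c)
  have A: "A \<in> sets borel" "emeasure lborel A < \<infinity>" using base by auto
  have "0 < e / (norm c + 1)" using base by (auto intro!: divide_pos_pos add_nonneg_pos)
  then obtain d where d: "d > 0" "\<And>z. norm z < d \<Longrightarrow>
     (\<integral>\<^sup>+x. ennreal \<bar>indicator A (x - z) - indicator A x\<bar> \<partial>lborel) \<le> ennreal (e / (norm c + 1))"
    using translation_continuous_indicator[OF A] by blast
  show ?case
  proof (intro exI conjI allI impI)
    fix z :: 'a assume z: "norm z < d"
    have "(\<integral>\<^sup>+x. ennreal (norm (indicator A (x - z) *\<^sub>R c - indicator A x *\<^sub>R c)) \<partial>lborel)
       = (\<integral>\<^sup>+x. ennreal (norm c) * ennreal \<bar>indicator A (x - z) - indicator A x\<bar> \<partial>lborel)"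
      by (simp add: scaleR_diff_left[symmetric] ennreal_mult' mult.commute)
    also have "\<dots> = ennreal (norm c) * (\<integral>\<^sup>+x. ennreal \<bar>indicator A (x - z) - indicator A x\<bar> \<partial>lborel)"
      using A by (intro nn_integral_cmult) simp
    also have "\<dots> \<le> ennreal (norm c) * ennreal (e / (norm c + 1))"
      by (intro mult_left_mono d z) auto
    also have "\<dots> = ennreal (norm c * (e / (norm c + 1)))" using base by (intro ennreal_mult[symmetric]) auto
    also have "\<dots> \<le> ennreal e"
    proof (rule ennreal_leI)
      have "norm c / (norm c + 1) \<le> 1" by (auto simp: divide_le_eq_1 add_nonneg_pos)
      then have "e * (norm c / (norm c + 1)) \<le> e * 1" using base by (intro mult_left_mono) auto
      then show "norm c * (e / (norm c + 1)) \<le> e" by (simp add: mult.commute)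
    qed
    finally show "(\<integral>\<^sup>+x. ennreal (norm (indicator A (x - z) *\<^sub>R c - indicator A x *\<^sub>R c)) \<partial>lborel) \<le> ennreal e" .
  qed (rule d)
next
  case (add f g)
  obtain d1 where d1: "d1 > 0" "\<And>z. norm z < d1 \<Longrightarrow> (\<integral>\<^sup>+x. ennreal (norm (f (x - z) - f x)) \<partial>lborel) \<le> ennreal (e/2)"
    using add.IH(1)[of "e/2"] add.prems by auto
  obtain d2 where d2: "d2 > 0" "\<And>z. norm z < d2 \<Longrightarrow> (\<integral>\<^sup>+x. ennreal (norm (g (x - z) - g x)) \<partial>lborel) \<le> ennreal (e/2)"
    using add.IH(2)[of "e/2"] add.prems by auto
  have [measurable]: "f \<in> borel_measurable borel" "g \<in> borel_measurable borel"
    using add.hyps by auto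
  show ?case
  proof (intro exI conjI allI impI)
    show "min d1 d2 > 0" using d1 d2 by simp
    fix z :: 'a assume z: "norm z < min d1 d2"
    have "(\<integral>\<^sup>+x. ennreal (norm (f (x - z) + g (x - z) - (f x + g x))) \<partial>lborel)
       \<le> (\<integral>\<^sup>+x. ennreal (norm (f (x - z) - f x)) + ennreal (norm (g (x - z) - g x)) \<partial>lborel)"
      by (intro nn_integral_mono) (auto simp flip: ennreal_plus intro!: ennreal_leI norm_diff_triangle_ineq)
    also have "\<dots> = (\<integral>\<^sup>+x. ennreal (norm (f (x - z) - f x)) \<partial>lborel) + (\<integral>\<^sup>+x. ennreal (norm (g (x - z) - g x)) \<partial>lborel)"
      by (intro nn_integral_add) auto
    also have "\<dots> \<le> ennreal (e/2) + ennreal (e/2)" using z by (intro add_mono d1 d2) auto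
    also have "\<dots> = ennreal e" using add.prems by (simp flip: ennreal_plus)
    finally show "(\<integral>\<^sup>+x. ennreal (norm (f (x - z) + g (x - z) - (f x + g x))) \<partial>lborel) \<le> ennreal e" .
  qed
next
  case (lim f s)
  have [measurable]: "f \<in> borel_measurable borel" "\<And>i. s i \<in> borel_measurable borel"
    using lim.hyps by auto
  have "(\<lambda>i. \<integral>\<^sup>+x. ennreal (norm (s i x - f x)) \<partial>lborel) \<longlonglongrightarrow> (\<integral>\<^sup>+x. 0 \<partial>(lborel :: 'a measure))"
  proof (rule nn_integral_dominated_convergence[where w = "\<lambda>x. ennreal (3 * norm (f x))"])
    show "AE x in lborel. ennreal (norm (s i x - f x)) \<le> ennreal (3 * norm (f x))" for i
    proof (intro AE_I2 ennreal_leI)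
      fix x
      show "norm (s i x - f x) \<le> 3 * norm (f x)"
        using lim.hyps(3)[of x i] norm_triangle_ineq4[of "s i x" "f x"] by simp
    qed
    have "integrable lborel (\<lambda>x. 3 * norm (f x))" using lim.hyps by simp
    then show "(\<integral>\<^sup>+x. ennreal (3 * norm (f x)) \<partial>lborel) < \<infinity>"
      unfolding integrable_iff_bounded by simp
    show "AE x in lborel. (\<lambda>i. ennreal (norm (s i x - f x))) \<longlonglongrightarrow> 0"
    proof (intro AE_I2)
      fix x
      have "(\<lambda>i. norm (s i x - f x)) \<longlonglongrightarrow> 0"
        using lim.hyps(2)[of x] by (simp add: LIM_zero tendsto_norm_zero)
      then show "(\<lambda>i. ennreal (norm (s i x - f x))) \<longlonglongrightarrow> 0"
        using tendsto_ennrealI by fastforce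
    qed
  qed auto
  then have "\<forall>\<^sub>F i in sequentially. (\<integral>\<^sup>+x. ennreal (norm (s i x - f x)) \<partial>lborel) < ennreal (e/3)"
    using lim.prems by (intro order_tendstoD) auto
  then obtain i where i: "(\<integral>\<^sup>+x. ennreal (norm (s i x - f x)) \<partial>lborel) < ennreal (e/3)"
    by (auto simp: eventually_sequentially)
  obtain d where d: "d > 0" "\<And>z. norm z < d \<Longrightarrow> (\<integral>\<^sup>+x. ennreal (norm (s i (x - z) - s i x)) \<partial>lborel) \<le> ennreal (e/3)"
    using lim.IH[of "e/3" i] lim.prems by auto
  show ?case
  proof (intro exI conjI allI impI)
    fix z :: 'a assume z: "norm z < d"
    have pw: "norm (f (x - z) - f x) \<le> norm (s i (x - z) - f (x - z)) + (norm (s i (x - z) - s i x) + norm (s i x - f x))" for x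
    proof -
      have "f (x - z) - f x = - (s i (x - z) - f (x - z)) + ((s i (x - z) - s i x) + (s i x - f x))" by simp
      then show ?thesis by (metis norm_minus_cancel norm_triangle_mono norm_triangle_ineq order_refl)
    qed
    have "(\<integral>\<^sup>+x. ennreal (norm (f (x - z) - f x)) \<partial>lborel)
       \<le> (\<integral>\<^sup>+x. ennreal (norm (s i (x - z) - f (x - z))) + (ennreal (norm (s i (x - z) - s i x)) + ennreal (norm (s i x - f x))) \<partial>lborel)"
      using pw by (intro nn_integral_mono) (auto simp flip: ennreal_plus intro!: ennreal_leI)
    also have "\<dots> = (\<integral>\<^sup>+x. ennreal (norm (s i (x - z) - f (x - z))) \<partial>lborel)
      + ((\<integral>\<^sup>+x. ennreal (norm (s i (x - z) - s i x)) \<partial>lborel) + (\<integral>\<^sup>+x. ennreal (norm (s i x - f x)) \<partial>lborel))"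
      by (simp add: nn_integral_add)
    also have "(\<integral>\<^sup>+x. ennreal (norm (s i (x - z) - f (x - z))) \<partial>lborel) = (\<integral>\<^sup>+x. ennreal (norm (s i x - f x)) \<partial>lborel)"
      by (rule nn_integral_translate) simp
    also have "(\<integral>\<^sup>+x. ennreal (norm (s i x - f x)) \<partial>lborel)
      + ((\<integral>\<^sup>+x. ennreal (norm (s i (x - z) - s i x)) \<partial>lborel) + (\<integral>\<^sup>+x. ennreal (norm (s i x - f x)) \<partial>lborel))
       \<le> ennreal (e/3) + (ennreal (e/3) + ennreal (e/3))"
      using i by (intro add_mono d z) auto
    also have "\<dots> = ennreal e" using lim.prems by (simp flip: ennreal_plus)
    finally show "(\<integral>\<^sup>+x. ennreal (norm (f (x - z) - f x)) \<partial>lborel) \<le> ennreal e" .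
  qed (rule d)
qed

section \<open>Convergence of mollifications\<close>

text \<open>As \<open>\<rho>\<close> has total mass one, \<open>\<rho> * g - g\<close> is an average of translation differences of \<open>g\<close>.\<close>

lemma conv_diff_le:
  fixes g :: "'a::euclidean_space \<Rightarrow> 'b::euclidean_space"
  assumes rho: "mollifier e \<rho>" and g: "loc_int g" "g \<in> borel_measurable borel"
  shows "ennreal (norm (conv \<rho> g x - g x)) \<le> (\<integral>\<^sup>+z. ennreal (\<rho> z * norm (g (x - z) - g x)) \<partial>lborel)"
proof -
  have tf: "test_function \<rho>" and r0: "\<And>x. \<rho> x \<ge> 0" and rz: "\<And>x. norm x > e \<Longrightarrow> \<rho> x = 0"
    and ri: "integrable lborel \<rho>" "(LINT x|lborel. \<rho> x) = 1"
    using rho by (auto simp: mollifier_def)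
  have cr: "continuous_on UNIV \<rho>" using tf by (simp add: test_function_def smooth_continuous)
  have [measurable]: "\<rho> \<in> borel_measurable borel" "g \<in> borel_measurable borel"
    using g cr by (auto intro: borel_measurable_continuous_onI)
  have nn1: "(\<integral>\<^sup>+y. ennreal (\<rho> (x - y)) \<partial>lborel) = 1"
  proof -
    have "(\<integral>\<^sup>+y. ennreal (\<rho> (x - y)) \<partial>lborel) = (\<integral>\<^sup>+y. ennreal (\<rho> y) \<partial>lborel)"
      by (rule nn_integral_reflect) simp
    also have "\<dots> = 1" using ri r0 by (subst nn_integral_eq_integral) auto
    finally show ?thesis .
  qed
  have i1: "integrable lborel (\<lambda>y. \<rho> (x - y))"
    using nn1 r0 by (intro integrableI_bounded) auto
  have L1: "(LINT y|lborel. \<rho> (x - y)) = 1"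
    using nn1 r0 by (simp add: integral_eq_nn_integral)
  have i2: "integrable lborel (\<lambda>y. \<rho> (x - y) *\<^sub>R g y)"
    by (rule integrable_conv[OF g cr rz])
  have "conv \<rho> g x - g x = (LINT y|lborel. \<rho> (x - y) *\<^sub>R g y) - (LINT y|lborel. \<rho> (x - y) *\<^sub>R g x)"
    using L1 i1 by (simp add: conv_def)
  also have "\<dots> = (LINT y|lborel. \<rho> (x - y) *\<^sub>R (g y - g x))"
    using i1 i2 by (subst Bochner_Integration.integral_diff[symmetric]) (auto simp: scaleR_diff_right)
  finally have "ennreal (norm (conv \<rho> g x - g x)) \<le> (\<integral>\<^sup>+y. ennreal (norm (\<rho> (x - y) *\<^sub>R (g y - g x))) \<partial>lborel)"
    using i1 i2 integral_norm_bound_ennreal[of lborel "\<lambda>y. \<rho> (x - y) *\<^sub>R (g y - g x)"]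
    by (simp only:) (auto simp: scaleR_diff_right)
  also have "\<dots> = (\<integral>\<^sup>+y. (\<lambda>z. ennreal (\<rho> z * norm (g (x - z) - g x))) (x - y) \<partial>lborel)"
    using r0 by simp
  also have "\<dots> = (\<integral>\<^sup>+z. ennreal (\<rho> z * norm (g (x - z) - g x)) \<partial>lborel)"
    by (rule nn_integral_reflect) simp
  finally show ?thesis .
qed

text \<open>Tonelli's theorem: a bound for the weighted translation difference that is uniform in small shifts
  is inherited by the average over the shifts.\<close>

lemma conv_weighted_diff_le:
  fixes g :: "'a::euclidean_space \<Rightarrow> 'b::euclidean_space" and W :: "'a \<Rightarrow> ennreal"
  assumes rho: "mollifier e \<rho>" and g: "loc_int g" "g \<in> borel_measurable borel"
    and W: "W \<in> borel_measurable borel"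
    and est: "\<And>z. norm z < e \<Longrightarrow> (\<integral>\<^sup>+x. W x * ennreal (norm (g (x - z) - g x)) \<partial>lborel) \<le> C"
  shows "(\<integral>\<^sup>+x. W x * ennreal (norm (conv \<rho> g x - g x)) \<partial>lborel) \<le> C"
proof -
  have tf: "test_function \<rho>" and r0: "\<And>x. \<rho> x \<ge> 0" and rz: "\<And>x. norm x \<ge> e \<Longrightarrow> \<rho> x = 0"
    and ri: "integrable lborel \<rho>" "(LINT x|lborel. \<rho> x) = 1"
    using rho by (auto simp: mollifier_def)
  have cr: "continuous_on UNIV \<rho>" using tf by (simp add: test_function_def smooth_continuous)
  have [measurable]: "\<rho> \<in> borel_measurable borel" "g \<in> borel_measurable borel" "W \<in> borel_measurable borel"
    using g cr W by (auto intro: borel_measurable_continuous_onI)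
  have "(\<integral>\<^sup>+x. W x * ennreal (norm (conv \<rho> g x - g x)) \<partial>lborel)
      \<le> (\<integral>\<^sup>+x. W x * (\<integral>\<^sup>+z. ennreal (\<rho> z * norm (g (x - z) - g x)) \<partial>lborel) \<partial>lborel)"
    by (intro nn_integral_mono mult_left_mono conv_diff_le[OF rho g]) auto
  also have "\<dots> = (\<integral>\<^sup>+x. (\<integral>\<^sup>+z. ennreal (\<rho> z) * (W x * ennreal (norm (g (x - z) - g x))) \<partial>lborel) \<partial>lborel)"
    using r0 by (simp add: nn_integral_cmult[symmetric] ennreal_mult' mult_ac)
  also have "\<dots> = (\<integral>\<^sup>+z. (\<integral>\<^sup>+x. ennreal (\<rho> z) * (W x * ennreal (norm (g (x - z) - g x))) \<partial>lborel) \<partial>lborel)"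
    by (rule lborel_pair.Fubini') simp
  also have "\<dots> = (\<integral>\<^sup>+z. ennreal (\<rho> z) * (\<integral>\<^sup>+x. W x * ennreal (norm (g (x - z) - g x)) \<partial>lborel) \<partial>lborel)"
    by (simp add: nn_integral_cmult)
  also have "\<dots> \<le> (\<integral>\<^sup>+z. ennreal (\<rho> z) * C \<partial>lborel)"
  proof (intro nn_integral_mono)
    fix z
    show "ennreal (\<rho> z) * (\<integral>\<^sup>+x. W x * ennreal (norm (g (x - z) - g x)) \<partial>lborel) \<le> ennreal (\<rho> z) * C"
      using est[of z] rz[of z] by (cases "norm z < e") (auto intro!: mult_left_mono)
  qed
  also have "\<dots> = (\<integral>\<^sup>+z. ennreal (\<rho> z) \<partial>lborel) * C" by (simp add: nn_integral_multc)
  also have "(\<integral>\<^sup>+z. ennreal (\<rho> z) \<partial>lborel) = 1"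
    using ri r0 by (subst nn_integral_eq_integral) auto
  finally show ?thesis by simp
qed

lemma mollifier_mono: "mollifier e \<rho> \<Longrightarrow> e \<le> d \<Longrightarrow> mollifier d \<rho>"
  by (auto simp: mollifier_def)

lemma translation_bounded_weight:
  fixes g :: "'a::euclidean_space \<Rightarrow> 'b::euclidean_space" and W :: "'a \<Rightarrow> ennreal"
  assumes g: "loc_int g" "g \<in> borel_measurable borel"
    and W: "W \<in> borel_measurable borel" "\<And>x. W x \<le> ennreal M" "\<And>x. norm x > R \<Longrightarrow> W x = 0"
    and M: "M \<ge> 0" and e: "e > (0::real)"
  shows "\<exists>d>0. d \<le> 1 \<and> (\<forall>z. norm z < d \<longrightarrow> (\<integral>\<^sup>+x. W x * ennreal (norm (g (x - z) - g x)) \<partial>lborel) \<le> ennreal e)"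
proof -
  define f where "f x = indicat_real (cball 0 (R + 1)) x *\<^sub>R g x" for x
  have f: "integrable lborel f" using g by (auto simp: loc_int_def set_integrable_def f_def[abs_def])
  have [measurable]: "g \<in> borel_measurable borel" "f \<in> borel_measurable borel" using g f by auto
  have "e / (M + 1) > 0" using e M by simp
  then obtain d where d: "d > 0" "\<And>z. norm z < d \<Longrightarrow> (\<integral>\<^sup>+x. ennreal (norm (f (x - z) - f x)) \<partial>lborel) \<le> ennreal (e / (M + 1))"
    using translation_continuous_L1[OF f] by blast
  have "(\<integral>\<^sup>+x. W x * ennreal (norm (g (x - z) - g x)) \<partial>lborel) \<le> ennreal e" if z: "norm z < min d 1" for z
  proof -
    have "(\<integral>\<^sup>+x. W x * ennreal (norm (g (x - z) - g x)) \<partial>lborel) \<le>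
        (\<integral>\<^sup>+x. ennreal M * ennreal (norm (f (x - z) - f x)) \<partial>lborel)"
    proof (intro nn_integral_mono)
      fix x
      show "W x * ennreal (norm (g (x - z) - g x)) \<le> ennreal M * ennreal (norm (f (x - z) - f x))"
      proof (cases "norm x \<le> R")
        case True
        then have "norm (x - z) \<le> R + 1" using z norm_triangle_ineq4[of x z] by simp
        then have "f (x - z) - f x = g (x - z) - g x" using True by (simp add: f_def)
        then show ?thesis using W(2) by (auto intro: mult_right_mono)
      qed (simp add: W)
    qed
    also have "\<dots> = ennreal M * (\<integral>\<^sup>+x. ennreal (norm (f (x - z) - f x)) \<partial>lborel)"
      by (intro nn_integral_cmult) simp
    also have "\<dots> \<le> ennreal M * ennreal (e / (M + 1))" using z by (intro mult_left_mono d) auto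
    also have "\<dots> = ennreal (M * (e / (M + 1)))" using e M by (intro ennreal_mult[symmetric]) auto
    also have "\<dots> \<le> ennreal e" using e M by (intro ennreal_leI) (simp add: field_simps)
    finally show ?thesis .
  qed
  then show ?thesis using d(1) by (intro exI[of _ "min d 1"]) auto
qed

text \<open>This is the fundamental lemma of the calculus of variations in quantitative form; it yields
  uniqueness of weak derivatives.\<close>

lemma mollification_L1:
  fixes g :: "'a::euclidean_space \<Rightarrow> 'b::euclidean_space"
  assumes g: "loc_int g" "g \<in> borel_measurable borel" and e: "e > (0::real)"
  shows "\<exists>d>0. \<forall>\<rho>. mollifier d \<rho> \<longrightarrow>
     (\<integral>\<^sup>+x. indicator (cball 0 R) x * ennreal (norm (conv \<rho> g x - g x)) \<partial>lborel) \<le> ennreal e"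
proof -
  have "\<exists>d>0. d \<le> 1 \<and> (\<forall>z. norm z < d \<longrightarrow> (\<integral>\<^sup>+x. indicator (cball 0 R) x * ennreal (norm (g (x - z) - g x)) \<partial>lborel) \<le> ennreal e)"
    by (rule translation_bounded_weight[where M = 1 and R = R])
       (use g e in \<open>auto simp: indicator_def\<close>)
  then obtain d where d: "d > 0" "\<And>z. norm z < d \<Longrightarrow> (\<integral>\<^sup>+x. indicator (cball 0 R) x * ennreal (norm (g (x - z) - g x)) \<partial>lborel) \<le> ennreal e"
    by blast
  show ?thesis
    by (intro exI[of _ d] conjI d(1) allI impI conv_weighted_diff_le g d(2) borel_measurable_indicator) auto
qed

text \<open>Young's inequality with a small factor in front of one term. The constant is not the sharp one: it is
  enough to compare \<open>a\<close> with a multiple of \<open>b\<close>.\<close>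

lemma powr_mult_le_eps:
  fixes a b l p :: real
  assumes "p > 1" "l > 0" "a \<ge> 0" "b \<ge> 0"
  shows "a powr (p - 1) * b \<le> l * b powr p + l powr (- 1 / (p - 1)) * a powr p"
proof (cases "a \<le> l powr (1 / (p - 1)) * b")
  case True
  then have "a powr (p - 1) \<le> (l powr (1 / (p - 1)) * b) powr (p - 1)"
    using assms by (intro powr_mono2) auto
  also have "\<dots> = l * b powr (p - 1)"
    using assms by (simp add: powr_mult powr_powr)
  finally have "a powr (p - 1) * b \<le> l * (b powr (p - 1) * b)"
    using assms by (simp add: mult_right_mono mult.assoc[symmetric])
  also have "b powr (p - 1) * b = b powr p"
    using assms by (cases "b = 0") (auto simp: powr_diff)
  finally show ?thesis using assms by (smt (verit) mult_nonneg_nonneg powr_ge_zero)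
next
  case False
  then have "l powr (- 1 / (p - 1)) * (l powr (1 / (p - 1)) * b) \<le> l powr (- 1 / (p - 1)) * a"
    by (intro mult_left_mono) auto
  moreover have "l powr (- 1 / (p - 1)) * (l powr (1 / (p - 1)) * b) = b"
    using assms(2) by (simp add: mult.assoc[symmetric] powr_add[symmetric])
  ultimately have "b \<le> l powr (- 1 / (p - 1)) * a" by metis
  then have "a powr (p - 1) * b \<le> a powr (p - 1) * (l powr (- 1 / (p - 1)) * a)"
    by (intro mult_left_mono) auto
  also have "\<dots> = l powr (- 1 / (p - 1)) * (a powr (p - 1) * a)" by simp
  also have "a powr (p - 1) * a = a powr p"
    using assms by (cases "a = 0") (auto simp: powr_diff)
  finally show ?thesis using assms by (smt (verit) mult_nonneg_nonneg powr_ge_zero)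
qed

lemma loc_int_nn_integral_finite:
  fixes f :: "'a::euclidean_space \<Rightarrow> real"
  assumes "loc_int f" "\<And>x. f x \<ge> 0"
  shows "(\<integral>\<^sup>+x. indicator (cball 0 R) x * ennreal (f x) \<partial>lborel) < \<infinity>"
proof -
  have "integrable lborel (\<lambda>x. indicator (cball 0 R) x *\<^sub>R f x)"
    using assms by (auto simp: loc_int_def set_integrable_def)
  then have "(\<integral>\<^sup>+x. ennreal (norm (indicator (cball 0 R) x *\<^sub>R f x)) \<partial>lborel) < \<infinity>"
    unfolding integrable_iff_bounded by simp
  also have "(\<lambda>x. ennreal (norm (indicator (cball 0 R) x *\<^sub>R f x))) = (\<lambda>x. indicator (cball 0 R) x * ennreal (f x))"
    using assms(2) by (auto simp: indicator_def fun_eq_iff)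
  finally show ?thesis .
qed

text \<open>Dominated convergence as the level \<open>M\<close> runs through the integers.\<close>

lemma tail_small:
  fixes g :: "'a::euclidean_space \<Rightarrow> 'b::euclidean_space"
  assumes g: "g \<in> borel_measurable borel" "loc_int (\<lambda>x. norm (g x) powr p)" and e: "e > (0::real)"
  shows "\<exists>M>0. (\<integral>\<^sup>+x. indicator {x. norm x \<le> R \<and> norm (g x) > M} x * ennreal (norm (g x) powr p) \<partial>lborel) \<le> ennreal e"
proof -
  have [measurable]: "g \<in> borel_measurable borel" by fact
  have "(\<lambda>n. \<integral>\<^sup>+x. indicator {x. norm x \<le> R \<and> norm (g x) > real (Suc n)} x * ennreal (norm (g x) powr p) \<partial>lborel)
      \<longlonglongrightarrow> (\<integral>\<^sup>+x. 0 \<partial>(lborel :: 'a measure))"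
  proof (rule nn_integral_dominated_convergence[where w = "\<lambda>x. indicator (cball 0 R) x * ennreal (norm (g x) powr p)"])
    show "(\<integral>\<^sup>+x. indicator (cball 0 R) x * ennreal (norm (g x) powr p) \<partial>lborel) < \<infinity>"
      by (rule loc_int_nn_integral_finite[OF g(2)]) simp
    show "AE x in lborel. (\<lambda>n. indicator {x. norm x \<le> R \<and> norm (g x) > real (Suc n)} x * ennreal (norm (g x) powr p)) \<longlonglongrightarrow> 0"
    proof (intro AE_I2 tendsto_eventually)
      fix x
      obtain m where m: "norm (g x) \<le> real m" using real_arch_simple by blast
      show "\<forall>\<^sub>F n in sequentially. indicator {x. norm x \<le> R \<and> norm (g x) > real (Suc n)} x * ennreal (norm (g x) powr p) = 0"
        using eventually_ge_at_top[of m] by eventually_elim (use m in \<open>auto simp: indicator_def\<close>)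
    qed
  qed (auto simp: indicator_def)
  then have "\<forall>\<^sub>F n in sequentially. (\<integral>\<^sup>+x. indicator {x. norm x \<le> R \<and> norm (g x) > real (Suc n)} x * ennreal (norm (g x) powr p) \<partial>lborel) < ennreal e"
    using e by (intro order_tendstoD) auto
  then obtain n where "(\<integral>\<^sup>+x. indicator {x. norm x \<le> R \<and> norm (g x) > real (Suc n)} x * ennreal (norm (g x) powr p) \<partial>lborel) < ennreal e"
    by (auto simp: eventually_sequentially)
  then show ?thesis by (intro exI[of _ "real (Suc n)"]) auto
qed

text \<open>The weight \<open>|g|\<^bsup>p-1\<^esup>\<close> is dual to \<open>g\<close> in the sense of exponents but unbounded. Where \<open>|g| \<le> M\<close> the weight is bounded and the
  continuity of translations applies. The set where \<open>|g| > M\<close> is absorbed by \<open>powr_mult_le_eps\<close>: a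
  small multiple of \<open>\<integral> |g(x - z)|\<^bsup>p\<^esup>\<close> plus a large multiple of the tail \<open>\<integral> |g|\<^bsup>p\<^esup>\<close> over \<open>|g| > M\<close>, which is
  small for large \<open>M\<close>. So the factor \<open>l\<close> is fixed first, then \<open>M\<close>, then the shift.\<close>

lemma mollification_Lp:
  fixes g :: "'a::euclidean_space \<Rightarrow> 'b::euclidean_space"
  assumes p: "p > 1" and g: "loc_int g" "g \<in> borel_measurable borel" "loc_int (\<lambda>x. norm (g x) powr p)"
    and e: "e > (0::real)"
  shows "\<exists>d>0. \<forall>\<rho>. mollifier d \<rho> \<longrightarrow>
     (\<integral>\<^sup>+x. (indicator (cball 0 R) x * ennreal (norm (g x) powr (p - 1))) * ennreal (norm (conv \<rho> g x - g x)) \<partial>lborel) \<le> ennreal e"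
proof -
  have [measurable]: "g \<in> borel_measurable borel" by fact
  let ?K = "cball (0::'a) R" and ?P = "\<lambda>x. ennreal (norm (g x) powr p)"
  have "(\<integral>\<^sup>+x. indicator (cball 0 (R + 1)) x * ?P x \<partial>lborel) < \<infinity>"
    by (rule loc_int_nn_integral_finite[OF g(3)]) simp
  then obtain I where I: "I \<ge> 0" "(\<integral>\<^sup>+x. indicator (cball 0 (R + 1)) x * ?P x \<partial>lborel) = ennreal I"
    by (cases "\<integral>\<^sup>+x. indicator (cball 0 (R + 1)) x * ?P x \<partial>lborel") auto
  define l where "l = e / (3 * (I + 1))"
  have l: "l > 0" "l * I \<le> e / 3" using I e by (auto simp: l_def field_simps)
  define C where "C = l powr (- 1 / (p - 1)) + 1"
  have C: "C > 0" by (auto simp: C_def add_nonneg_pos)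
  obtain M where M: "M > 0" "(\<integral>\<^sup>+x. indicator {x. norm x \<le> R \<and> norm (g x) > M} x * ?P x \<partial>lborel) \<le> ennreal (e / (3 * C))"
    using tail_small[OF g(2,3), of "e / (3 * C)" R] e C by auto
  define W where "W x = indicator {x. norm x \<le> R \<and> norm (g x) \<le> M} x * ennreal (norm (g x) powr (p - 1))" for x
  have [measurable]: "W \<in> borel_measurable borel" unfolding W_def by measurable
  have "\<exists>d>0. d \<le> 1 \<and> (\<forall>z. norm z < d \<longrightarrow> (\<integral>\<^sup>+x. W x * ennreal (norm (g (x - z) - g x)) \<partial>lborel) \<le> ennreal (e / 3))"
  proof (rule translation_bounded_weight[OF g(1,2), where M = "M powr (p - 1)" and R = R])
    show "W x \<le> ennreal (M powr (p - 1))" for x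
      using p by (auto simp: W_def indicator_def intro!: ennreal_leI powr_mono2)
  qed (use e in \<open>auto simp: W_def\<close>)
  then obtain d where d: "d > 0" "d \<le> 1" "\<And>z. norm z < d \<Longrightarrow> (\<integral>\<^sup>+x. W x * ennreal (norm (g (x - z) - g x)) \<partial>lborel) \<le> ennreal (e / 3)"
    by blast
  have "(\<integral>\<^sup>+x. (indicator ?K x * ennreal (norm (g x) powr (p - 1))) * ennreal (norm (g (x - z) - g x)) \<partial>lborel) \<le> ennreal e"
    if z: "norm z < d" for z
  proof -
    define H where "H x = indicator (cball 0 (R + 1)) x * ?P x" for x
    define T where "T x = indicator {x. norm x \<le> R \<and> norm (g x) > M} x * ?P x" for x
    have [measurable]: "H \<in> borel_measurable borel" "T \<in> borel_measurable borel"
      using g(2) by (auto simp: H_def[abs_def] T_def[abs_def] intro!: borel_measurable_times_ennreal borel_measurable_indicator)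
    have "(\<integral>\<^sup>+x. (indicator ?K x * ennreal (norm (g x) powr (p - 1))) * ennreal (norm (g (x - z) - g x)) \<partial>lborel)
       \<le> (\<integral>\<^sup>+x. W x * ennreal (norm (g (x - z) - g x)) + (ennreal l * H (x - z) + ennreal C * T x) \<partial>lborel)"
    proof (intro nn_integral_mono)
      fix x
      show "(indicator ?K x * ennreal (norm (g x) powr (p - 1))) * ennreal (norm (g (x - z) - g x))
         \<le> W x * ennreal (norm (g (x - z) - g x)) + (ennreal l * H (x - z) + ennreal C * T x)"
      proof (cases "norm x \<le> R \<and> norm (g x) > M")
        case False
        then show ?thesis by (auto simp: W_def indicator_def)
      next
        case True
        then have "norm (x - z) \<le> R + 1" using z d norm_triangle_ineq4[of x z] by simp
        then have HT: "H (x - z) = ennreal (norm (g (x - z)) powr p)" "T x = ?P x"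
          using True by (auto simp: H_def T_def)
        have "norm (g x) powr (p - 1) * norm (g (x - z) - g x)
            \<le> norm (g x) powr (p - 1) * norm (g (x - z)) + norm (g x) powr (p - 1) * norm (g x)"
          using mult_left_mono[OF norm_triangle_ineq4[of "g (x - z)" "g x"], of "norm (g x) powr (p - 1)"]
          by (simp add: algebra_simps)
        also have "norm (g x) powr (p - 1) * norm (g x) = norm (g x) powr p"
          by (cases "g x = 0") (auto simp: powr_diff)
        also have "norm (g x) powr (p - 1) * norm (g (x - z)) + norm (g x) powr p
           \<le> l * norm (g (x - z)) powr p + C * norm (g x) powr p"
          using powr_mult_le_eps[OF p l(1), of "norm (g x)" "norm (g (x - z))"] by (simp add: C_def algebra_simps)
        finally have "ennreal (norm (g x) powr (p - 1) * norm (g (x - z) - g x))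
           \<le> ennreal (l * norm (g (x - z)) powr p + C * norm (g x) powr p)" by (rule ennreal_leI)
        also have "\<dots> = ennreal l * H (x - z) + ennreal C * T x"
          using l C by (simp add: HT ennreal_mult ennreal_plus)
        finally show ?thesis using True by (simp add: ennreal_mult W_def)
      qed
    qed
    also have "\<dots> = (\<integral>\<^sup>+x. W x * ennreal (norm (g (x - z) - g x)) \<partial>lborel)
        + (ennreal l * (\<integral>\<^sup>+x. H (x - z) \<partial>lborel) + ennreal C * (\<integral>\<^sup>+x. T x \<partial>lborel))"
      by (simp add: nn_integral_add nn_integral_cmult)
    also have "(\<integral>\<^sup>+x. H (x - z) \<partial>lborel) = (\<integral>\<^sup>+x. H x \<partial>lborel)"
      by (rule nn_integral_translate) simp
    also have "(\<integral>\<^sup>+x. H x \<partial>lborel) = ennreal I" using I by (simp add: H_def)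
    also have "(\<integral>\<^sup>+x. W x * ennreal (norm (g (x - z) - g x)) \<partial>lborel)
        + (ennreal l * ennreal I + ennreal C * (\<integral>\<^sup>+x. T x \<partial>lborel))
       \<le> ennreal (e / 3) + (ennreal (e / 3) + ennreal C * ennreal (e / (3 * C)))"
      using l I M(2) by (intro add_mono d z mult_left_mono) (auto simp: T_def ennreal_mult[symmetric] intro: ennreal_leI)
    also have "\<dots> = ennreal e"
      using C e by (simp add: ennreal_mult[symmetric] flip: ennreal_plus)
    finally show ?thesis .
  qed
  then show ?thesis
    by (intro exI[of _ d] conjI d(1) allI impI conv_weighted_diff_le g(1,2)
          borel_measurable_times_ennreal borel_measurable_indicator) auto
qed

text \<open>Both candidates have the same mollifications, namely the gradient of \<open>\<rho> * u\<close>.\<close>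

lemma weak_deriv_unique:
  fixes u :: "'a::euclidean_space \<Rightarrow> real"
  assumes u: "continuous_on UNIV u"
    and g: "loc_int g" "g \<in> borel_measurable borel" "weak_deriv u g"
    and h: "loc_int h" "h \<in> borel_measurable borel" "weak_deriv u h"
  shows "AE x in lborel. g x = h x"
proof -
  define k where "k x = g x - h x" for x
  have k: "loc_int k" "k \<in> borel_measurable borel"
    using g h by (auto simp: k_def[abs_def] loc_int_def intro: set_integral_diff)
  have "AE x in lborel. norm x \<le> real n \<longrightarrow> k x = 0" for n
  proof -
    let ?I = "\<integral>\<^sup>+x. indicator (cball 0 (real n)) x * ennreal (norm (k x)) \<partial>lborel"
    have eps: "?I \<le> ennreal e" if e: "e > 0" for e
    proof -
      obtain d where d: "d > 0" "\<And>\<rho>. mollifier d \<rho> \<Longrightarrow>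
          (\<integral>\<^sup>+x. indicator (cball 0 (real n)) x * ennreal (norm (conv \<rho> k x - k x)) \<partial>lborel) \<le> ennreal e"
        using mollification_L1[OF k e] by blast
      obtain \<rho> :: "'a \<Rightarrow> real" where rho: "mollifier d \<rho>" using mollifier_exists[OF d(1)] by blast
      then have tf: "test_function \<rho>" and rz: "\<And>x. norm x > d \<Longrightarrow> \<rho> x = 0" by (auto simp: mollifier_def)
      have cr: "continuous_on UNIV \<rho>" using tf by (simp add: test_function_def smooth_continuous)
      have "conv \<rho> k x = conv \<rho> g x - conv \<rho> h x" for x
        unfolding conv_def k_def scaleR_diff_right
        by (intro Bochner_Integration.integral_diff integrable_conv[OF _ _ cr rz] g h)
      also have "conv \<rho> g x - conv \<rho> h x = 0" for x
        using grad_conv_weak[OF tf u g] grad_conv_weak[OF tf u h] by simp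
      finally have "conv \<rho> k x = 0" for x .
      then show ?thesis using d(2)[OF rho] by simp
    qed
    have "?I \<le> 0"
    proof (rule ennreal_le_epsilon)
      fix e :: real assume "0 < e"
      from eps[OF this] show "?I \<le> 0 + ennreal e" by (simp only: add_0)
    qed
    then have "?I = 0" by simp
    then have "AE x in lborel. indicator (cball 0 (real n)) x * ennreal (norm (k x)) = 0"
      using k by (subst (asm) nn_integral_0_iff_AE)
        (auto intro!: borel_measurable_times_ennreal borel_measurable_indicator)
    then show ?thesis by eventually_elim (auto simp: indicator_def split: if_splits)
  qed
  then have "AE x in lborel. \<forall>n. norm x \<le> real n \<longrightarrow> k x = 0" unfolding AE_all_countable by blast
  then show ?thesis
  proof (rule eventually_mono)
    fix x assume "\<forall>n. norm x \<le> real n \<longrightarrow> k x = 0"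
    moreover obtain n where "norm x \<le> real n" using real_arch_simple by blast
    ultimately show "g x = h x" by (auto simp: k_def)
  qed
qed

section \<open>From Lebesgue to Borel measurable weak gradients\<close>

lemma borel_version:
  fixes G :: "'a::euclidean_space \<Rightarrow> 'b::euclidean_space"
  assumes "G \<in> borel_measurable lebesgue"
  obtains g where "g \<in> borel_measurable borel" "AE x in lborel. G x = g x"
proof -
  have "\<exists>h\<in>borel_measurable lborel. AE x in lborel. G x \<bullet> b = h x" for b
    using assms by (intro completion_ex_borel_measurable_real) auto
  then obtain h where h: "\<And>b. h b \<in> borel_measurable lborel" "\<And>b. AE x in lborel. G x \<bullet> b = h b x"
    by metis
  show ?thesis
  proof
    show "(\<lambda>x. \<Sum>b\<in>Basis. h b x *\<^sub>R b) \<in> borel_measurable borel" using h(1) by simp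
    have "AE x in lborel. \<forall>b\<in>Basis. G x \<bullet> b = h b x"
      using h(2) by (intro AE_finite_allI) auto
    then show "AE x in lborel. G x = (\<Sum>b\<in>Basis. h b x *\<^sub>R b)"
      by (rule eventually_mono) (metis (no_types, lifting) euclidean_representation sum.cong)
  qed
qed

lemma locally_integrable_measurable:
  fixes G :: "'a::euclidean_space \<Rightarrow> 'b::euclidean_space"
  assumes "locally_integrable G"
  shows "G \<in> borel_measurable lebesgue"
proof (rule borel_measurable_LIMSEQ_metric)
  fix n
  have "set_integrable lebesgue (cball 0 (real n)) G"
    using assms unfolding locally_integrable_def by simp
  then show "(\<lambda>x. indicator (cball 0 (real n)) x *\<^sub>R G x) \<in> borel_measurable lebesgue"
    by (auto simp: set_integrable_def)
next
  fix x :: 'a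
  obtain m where m: "norm x \<le> real m" using real_arch_simple by blast
  show "(\<lambda>n. indicator (cball 0 (real n)) x *\<^sub>R G x) \<longlonglongrightarrow> G x"
    by (rule tendsto_eventually, rule eventually_mono[OF eventually_ge_at_top[of m]])
       (use m in \<open>auto simp: indicator_def\<close>)
qed

lemma lebesgue_transfer:
  fixes F :: "'a::euclidean_space \<Rightarrow> 'b::euclidean_space \<Rightarrow> 'c::euclidean_space"
  assumes G: "G \<in> borel_measurable lebesgue" and g: "g \<in> borel_measurable borel"
    and ae: "AE x in lborel. G x = g x"
    and F: "(\<lambda>(x, y). F x y) \<in> borel_measurable borel"
  shows "integral\<^sup>L lebesgue (\<lambda>x. F x (G x)) = integral\<^sup>L lborel (\<lambda>x. F x (g x))"
    and "integrable lebesgue (\<lambda>x. F x (G x)) \<longleftrightarrow> integrable lborel (\<lambda>x. F x (g x))"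
proof -
  have F': "(\<lambda>(x, y). F x y) \<in> borel_measurable (borel \<Otimes>\<^sub>M borel)"
    using F by (simp add: borel_prod)
  have i: "(\<lambda>x::'a. x) \<in> lebesgue \<rightarrow>\<^sub>M borel" by (simp add: measurable_completion)
  have 1: "(\<lambda>x. F x (G x)) \<in> borel_measurable lebesgue"
    using measurable_compose[OF measurable_Pair[OF i G] F'] by simp
  have 2: "(\<lambda>x. F x (g x)) \<in> borel_measurable lborel"
    using measurable_compose[OF measurable_Pair[OF measurable_ident g] F'] by simp
  have 3: "AE x in lebesgue. F x (G x) = F x (g x)"
    using AE_completion[OF ae] by (rule eventually_mono) simp
  have 4: "(\<lambda>x. F x (g x)) \<in> borel_measurable lebesgue" using 2 by (rule measurable_completion)
  show "integral\<^sup>L lebesgue (\<lambda>x. F x (G x)) = integral\<^sup>L lborel (\<lambda>x. F x (g x))"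
    using integral_cong_AE[OF 1 4 3] integral_completion[OF 2] by simp
  show "integrable lebesgue (\<lambda>x. F x (G x)) \<longleftrightarrow> integrable lborel (\<lambda>x. F x (g x))"
    using integrable_cong_AE[OF 1 4 3] integrable_completion[OF 2] by simp
qed

lemma p_flux_measurable: "p_flux p \<in> borel_measurable borel"
  unfolding p_flux_def[abs_def] by measurable

lemma norm_p_flux: "norm (p_flux p v) = norm v powr (p - 1)"
  by (cases "v = 0") (auto simp: p_flux_def powr_diff power2_eq_square field_simps)

lemma p_flux_inner: "p_flux p v \<bullet> v = norm v powr p"
  by (cases "v = 0") (auto simp: p_flux_def powr_diff power2_norm_eq_inner[symmetric] power2_eq_square field_simps)

lemma weak_gradient_borel:
  fixes u :: "'a::euclidean_space \<Rightarrow> real"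
  assumes u: "continuous_on UNIV u" and G: "has_weak_gradient u G"
  obtains g where "g \<in> borel_measurable borel" "AE x in lborel. G x = g x" "loc_int g" "weak_deriv u g"
    "G \<in> borel_measurable lebesgue"
proof -
  have Gm: "G \<in> borel_measurable lebesgue"
    using G by (auto simp: has_weak_gradient_def intro: locally_integrable_measurable)
  then obtain g where g: "g \<in> borel_measurable borel" "AE x in lborel. G x = g x"
    by (rule borel_version)
  have [measurable]: "u \<in> borel_measurable borel" using u by (rule borel_measurable_continuous_onI)
  have "loc_int g"
    unfolding loc_int_def set_integrable_def
  proof
    fix R :: real
    have "integrable lebesgue (\<lambda>x. indicator (cball 0 R) x *\<^sub>R G x)"
      using G by (auto simp: has_weak_gradient_def locally_integrable_def set_integrable_def)
    then show "integrable lborel (\<lambda>x. indicator (cball 0 R) x *\<^sub>R g x)"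
      by (subst (asm) lebesgue_transfer(2)[OF Gm g, of "\<lambda>x y. indicator (cball 0 R) x *\<^sub>R y"])
         (auto simp: split_def simp flip: borel_prod intro!: borel_measurable_scaleR
            measurable_compose[OF measurable_fst borel_measurable_indicator])
  qed
  moreover have "weak_deriv u g"
    unfolding weak_deriv_def
  proof (intro allI impI ballI)
    fix \<phi> :: "'a \<Rightarrow> real" and b :: 'a assume tf: "test_function \<phi>" and b: "b \<in> Basis"
    then have sm: "smooth \<phi>" by (simp add: test_function_def)
    have [measurable]: "\<phi> \<in> borel_measurable borel" "grad \<phi> \<in> borel_measurable borel"
      using sm by (auto intro!: borel_measurable_continuous_onI smooth_continuous continuous_on_grad)
    have "(LINT x|lborel. u x * (grad \<phi> x \<bullet> b)) = (LINT x|lebesgue. u x * (grad \<phi> x \<bullet> b))"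
      by (rule integral_completion[symmetric]) simp
    also have "\<dots> = - (LINT x|lebesgue. (G x \<bullet> b) * \<phi> x)"
      using G tf b by (auto simp: has_weak_gradient_def)
    also have "(LINT x|lebesgue. (G x \<bullet> b) * \<phi> x) = (LINT x|lborel. (g x \<bullet> b) * \<phi> x)"
      by (rule lebesgue_transfer(1)[OF Gm g]) (simp add: split_def flip: borel_prod)
    finally show "(LINT x|lborel. u x * (grad \<phi> x \<bullet> b)) = - (LINT x|lborel. (g x \<bullet> b) * \<phi> x)" .
  qed
  ultimately show ?thesis using that g Gm by blast
qed

text \<open>\<^const>\<open>weak_grad\<close> is some weak gradient, while the integrability of the \<open>p\<close>-th power is stated for a
  possibly different one. Uniqueness identifies the two up to a null set, and a Borel
  representative inherits all properties.\<close>

lemma weak_supersolution_borel: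
  fixes u :: "'a::euclidean_space \<Rightarrow> real"
  assumes u: "continuous_on UNIV u" and f: "f \<in> borel_measurable borel"
    and ws: "weak_supersolution p f u"
  obtains g where "g \<in> borel_measurable borel" "loc_int g" "loc_int (\<lambda>x. norm (g x) powr p)" "weak_deriv u g"
    "\<forall>\<phi>. test_function \<phi> \<and> (\<forall>x. 0 \<le> \<phi> x) \<longrightarrow>
      (LINT x|lborel. f x * \<phi> x) \<le> (LINT x|lborel. p_flux p (g x) \<bullet> grad \<phi> x)"
proof -
  obtain G0 where G0: "has_weak_gradient u G0" "Lp_loc p G0"
    using ws by (auto simp: weak_supersolution_def W1p_loc_def)
  have G: "has_weak_gradient u (weak_grad u)"
    unfolding weak_grad_def by (rule someI[of _ G0]) (rule G0)
  obtain g where g: "g \<in> borel_measurable borel" "AE x in lborel. weak_grad u x = g x" "loc_int g" "weak_deriv u g"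
    and Gm: "weak_grad u \<in> borel_measurable lebesgue"
    using weak_gradient_borel[OF u G] by blast
  obtain g0 where g0: "g0 \<in> borel_measurable borel" "AE x in lborel. G0 x = g0 x" "loc_int g0" "weak_deriv u g0"
    and G0m: "G0 \<in> borel_measurable lebesgue"
    using weak_gradient_borel[OF u G0(1)] by blast
  have "AE x in lborel. g0 x = g x"
    by (rule weak_deriv_unique[OF u g0(3,1,4) g(3,1,4)])
  with g0(2) have ae0: "AE x in lborel. G0 x = g x" by eventually_elim simp
  note [measurable] = g(1) f p_flux_measurable
  have "loc_int (\<lambda>x. norm (g x) powr p)"
    unfolding loc_int_def set_integrable_def
  proof
    fix R :: real
    have "integrable lebesgue (\<lambda>x. indicator (cball 0 R) x *\<^sub>R norm (G0 x) powr p)"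
      using G0 by (auto simp: Lp_loc_def set_integrable_def)
    then show "integrable lborel (\<lambda>x. indicator (cball 0 R) x *\<^sub>R norm (g x) powr p)"
      by (subst (asm) lebesgue_transfer(2)[OF G0m g(1) ae0, of "\<lambda>x y. indicator (cball 0 R) x *\<^sub>R norm y powr p"])
         (auto simp: split_def simp flip: borel_prod intro!: borel_measurable_times
            measurable_compose[OF measurable_fst borel_measurable_indicator])
  qed
  moreover have "(LINT x|lborel. f x * \<phi> x) \<le> (LINT x|lborel. p_flux p (g x) \<bullet> grad \<phi> x)"
    if tf: "test_function \<phi>" and nn: "\<And>x. 0 \<le> \<phi> x" for \<phi>
  proof -
    have sm: "smooth \<phi>" using tf by (simp add: test_function_def)
    have [measurable]: "\<phi> \<in> borel_measurable borel" "grad \<phi> \<in> borel_measurable borel"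
      using sm by (auto intro!: borel_measurable_continuous_onI smooth_continuous continuous_on_grad)
    have "(LINT x|lborel. f x * \<phi> x) = (LINT x|lebesgue. f x * \<phi> x)"
      by (rule integral_completion[symmetric]) simp
    also have "\<dots> \<le> (LINT x|lebesgue. p_flux p (weak_grad u x) \<bullet> grad \<phi> x)"
      using ws tf nn by (auto simp: weak_supersolution_def)
    also have "\<dots> = (LINT x|lborel. p_flux p (g x) \<bullet> grad \<phi> x)"
      by (rule lebesgue_transfer(1)[OF Gm g(1,2)]) (simp add: split_def flip: borel_prod)
    finally show ?thesis .
  qed
  ultimately show ?thesis using that g by blast
qed

section \<open>The energy inequality\<close>

lemma conv_ge:
  fixes u :: "'a::euclidean_space \<Rightarrow> real"
  assumes rho: "mollifier e \<rho>" and u: "continuous_on UNIV u" and c: "\<And>x. c \<le> u x"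
  shows "c \<le> conv \<rho> u x"
proof -
  have tf: "test_function \<rho>" and r0: "\<And>x. \<rho> x \<ge> 0" and rz: "\<And>x. norm x > e \<Longrightarrow> \<rho> x = 0"
    using rho by (auto simp: mollifier_def)
  have cr: "continuous_on UNIV \<rho>" using tf by (simp add: test_function_def smooth_continuous)
  have um: "u \<in> borel_measurable borel" using u by (rule borel_measurable_continuous_onI)
  have kc: "conv \<rho> (\<lambda>_. c) x = c"
  proof -
    have "ennreal (norm (conv \<rho> (\<lambda>_. c) x - c)) \<le> 0"
      using conv_diff_le[OF rho, of "\<lambda>_. c" x] by (simp add: loc_int_continuous)
    then show ?thesis by simp
  qed
  have "conv \<rho> (\<lambda>_. c) x \<le> conv \<rho> u x"
    unfolding conv_def
    by (intro integral_mono integrable_conv[OF _ _ cr rz])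
       (auto simp: loc_int_continuous um u r0 c intro!: mult_left_mono)
  then show ?thesis by (simp add: kc)
qed

lemma conv_tendsto:
  fixes u :: "'a::euclidean_space \<Rightarrow> real"
  assumes rho: "\<And>n. mollifier (1 / real (Suc n)) (\<rho> n)" and u: "continuous_on UNIV u"
  shows "(\<lambda>n. conv (\<rho> n) u x) \<longlonglongrightarrow> u x"
proof (rule LIMSEQ_I)
  fix r :: real assume r: "r > 0"
  have um: "u \<in> borel_measurable borel" using u by (rule borel_measurable_continuous_onI)
  have "isCont u x" using u by (simp add: continuous_on_eq_continuous_at)
  then obtain s where s: "s > 0" "\<And>y. dist y x < s \<Longrightarrow> dist (u y) (u x) < r / 2"
    using r unfolding continuous_at_eps_delta by (metis half_gt_zero)
  obtain N where N: "1 / real (Suc N) < s" using s(1) nat_approx_posE by blast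
  show "\<exists>no. \<forall>n\<ge>no. norm (conv (\<rho> n) u x - u x) < r"
  proof (intro exI allI impI)
    fix n assume n: "n \<ge> N"
    have "1 / real (Suc n) \<le> 1 / real (Suc N)" using n by (simp add: frac_le)
    then have ns: "1 / real (Suc n) < s" using N by simp
    have ri: "integrable lborel (\<rho> n)" "(LINT x|lborel. \<rho> n x) = 1" and r0: "\<And>x. \<rho> n x \<ge> 0"
      and rz: "\<And>x. norm x \<ge> 1 / real (Suc n) \<Longrightarrow> \<rho> n x = 0"
      using rho[of n] by (auto simp: mollifier_def)
    have "ennreal (norm (conv (\<rho> n) u x - u x)) \<le> (\<integral>\<^sup>+z. ennreal (\<rho> n z * norm (u (x - z) - u x)) \<partial>lborel)"
      by (rule conv_diff_le[OF rho loc_int_continuous[OF u] um])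
    also have "\<dots> \<le> (\<integral>\<^sup>+z. ennreal (\<rho> n z * (r / 2)) \<partial>lborel)"
    proof (intro nn_integral_mono ennreal_leI)
      fix z
      show "\<rho> n z * norm (u (x - z) - u x) \<le> \<rho> n z * (r / 2)"
      proof (cases "norm z < 1 / real (Suc n)")
        case True
        then have "norm (u (x - z) - u x) < r / 2" using s(2)[of "x - z"] ns by (simp add: dist_norm)
        then show ?thesis using r0 by (intro mult_left_mono) auto
      qed (use rz[of z] in simp)
    qed
    also have "\<dots> = ennreal (LINT z|lborel. \<rho> n z * (r / 2))"
      using ri r0 r by (intro nn_integral_eq_integral) auto
    also have "(LINT z|lborel. \<rho> n z * (r / 2)) = r / 2" using ri by simp
    finally show "norm (conv (\<rho> n) u x - u x) < r" using r by simp
  qed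
qed

text \<open>The form of dominated convergence used below: a fixed integrable function times uniformly bounded,
  pointwise convergent factors.\<close>

lemma integral_tendsto_bounded_multiplier:
  fixes h :: "'a \<Rightarrow> real"
  assumes h: "integrable M h" and c: "\<And>n. c n \<in> borel_measurable M" "\<And>n x. \<bar>c n x\<bar> \<le> C"
    and lim: "\<And>x. (\<lambda>n. c n x) \<longlonglongrightarrow> c' x"
  shows "integrable M (\<lambda>x. c' x * h x)" "(\<lambda>n. LINT x|M. c n x * h x) \<longlonglongrightarrow> (LINT x|M. c' x * h x)"
    "integrable M (\<lambda>x. c n x * h x)"
proof -
  have [measurable]: "c' \<in> borel_measurable M" by (rule borel_measurable_LIMSEQ_real[OF lim c(1)])
  have [measurable]: "h \<in> borel_measurable M" "\<And>n. c n \<in> borel_measurable M" using h c by auto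
  have w: "integrable M (\<lambda>x. C * \<bar>h x\<bar>)" using h by simp
  have l: "AE x in M. (\<lambda>n. c n x * h x) \<longlonglongrightarrow> c' x * h x" by (intro AE_I2 tendsto_mult lim tendsto_const)
  have b: "AE x in M. norm (c n x * h x) \<le> C * \<bar>h x\<bar>" for n
    by (intro AE_I2) (auto simp: abs_mult intro!: mult_right_mono c)
  show "integrable M (\<lambda>x. c' x * h x)" "(\<lambda>n. LINT x|M. c n x * h x) \<longlonglongrightarrow> (LINT x|M. c' x * h x)"
    "integrable M (\<lambda>x. c n x * h x)"
    subgoal by (rule Bochner_Integration.integrable_dominated_convergence[OF _ _ w l b]; measurable)
    subgoal by (rule Bochner_Integration.integral_dominated_convergence[OF _ _ w l b]; measurable)
    subgoal using b[of n] by (intro Bochner_Integration.integrable_bound[OF w]) (measurable, auto)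
    done
qed

lemma loc_int_lower_power:
  fixes g :: "'a::euclidean_space \<Rightarrow> 'b::euclidean_space"
  assumes p: "p > 1" and g: "g \<in> borel_measurable borel" "loc_int (\<lambda>x. norm (g x) powr p)"
  shows "loc_int (\<lambda>x. norm (g x) powr (p - 1))"
  unfolding loc_int_def set_integrable_def
proof
  fix R :: real
  have "integrable lborel (\<lambda>x. indicat_real (cball 0 R) x *\<^sub>R 1 + indicat_real (cball 0 R) x *\<^sub>R norm (g x) powr p)"
    using g(2) loc_int_continuous[of "\<lambda>_. 1::real"] unfolding loc_int_def set_integrable_def
    by (intro Bochner_Integration.integrable_add) auto
  then show "integrable lborel (\<lambda>x. indicat_real (cball 0 R) x *\<^sub>R norm (g x) powr (p - 1))"
  proof (rule Bochner_Integration.integrable_bound)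
    show "AE x in lborel. norm (indicat_real (cball 0 R) x *\<^sub>R norm (g x) powr (p - 1))
      \<le> norm (indicat_real (cball 0 R) x *\<^sub>R 1 + indicat_real (cball 0 R) x *\<^sub>R norm (g x) powr p)"
    proof (intro AE_I2)
      fix x
      have "norm (g x) powr (p - 1) \<le> 1 + norm (g x) powr p"
      proof (cases "norm (g x) \<le> 1")
        case True
        then have "norm (g x) powr (p - 1) \<le> 1 powr (p - 1)" using p by (intro powr_mono2) auto
        then show ?thesis by (simp add: add_increasing2)
      next
        case False
        then have "norm (g x) powr (p - 1) \<le> norm (g x) powr p" by (intro powr_mono) auto
        then show ?thesis by simp
      qed
      then show "norm (indicat_real (cball 0 R) x *\<^sub>R norm (g x) powr (p - 1))
      \<le> norm (indicat_real (cball 0 R) x *\<^sub>R 1 + indicat_real (cball 0 R) x *\<^sub>R norm (g x) powr p)"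
        by (auto simp: indicator_def)
    qed
    have "(\<lambda>x. norm (g x) powr (p - 1)) \<in> borel_measurable borel" using g(1) by measurable
    then show "(\<lambda>x. indicat_real (cball 0 R) x *\<^sub>R norm (g x) powr (p - 1)) \<in> borel_measurable lborel"
      by (intro borel_measurable_scaleR borel_measurable_indicator) auto
  qed
qed

lemma integrable_cont_weight:
  fixes f :: "'a::euclidean_space \<Rightarrow> real"
  assumes g: "loc_int g" "g \<in> borel_measurable borel"
    and f: "continuous_on UNIV f" "\<And>x. norm x > R \<Longrightarrow> f x = 0"
  shows "integrable lborel (\<lambda>x. f x * (g x :: real))"
  using integrable_cont_support_mult[OF g f] by simp

text \<open>Insert the smooth test function \<open>\<phi> = \<eta> V\<^bsup>-d\<^esup>\<close> with \<open>V = \<rho> * u + \<tau> \<ge> \<delta>\<close>. Its gradient contains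
  \<open>\<rho> * g\<close>, which is split as \<open>g + (\<rho> * g - g)\<close>: the first part produces \<open>|g|\<^bsup>p\<^esup>\<close>, the second tends to
  zero after multiplication with the flux by \<open>mollification_Lp\<close>. In all other terms \<open>V\<close> enters only
  through negative powers, which are bounded by powers of \<open>\<delta>\<close>.\<close>

lemma energy_inequality:
  fixes u f \<eta> :: "'a::euclidean_space \<Rightarrow> real" and g :: "'a \<Rightarrow> 'a"
  assumes p: "p > 1" and u: "continuous_on UNIV u" and f: "continuous_on UNIV f"
    and g: "g \<in> borel_measurable borel" "loc_int g" "loc_int (\<lambda>x. norm (g x) powr p)" "weak_deriv u g"
    and weak: "\<And>\<phi>. test_function \<phi> \<Longrightarrow> (\<And>x. 0 \<le> \<phi> x) \<Longrightarrow>
      (LINT x|lborel. f x * \<phi> x) \<le> (LINT x|lborel. p_flux p (g x) \<bullet> grad \<phi> x)"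
    and low: "\<delta> > 0" "\<And>x. \<delta> \<le> u x + \<tau>" and d: "d \<ge> 0"
    and eta: "test_function \<eta>" "\<And>x. 0 \<le> \<eta> x"
  shows "(LINT x|lborel. f x * \<eta> x * (u x + \<tau>) powr (- d))
       + d * (LINT x|lborel. norm (g x) powr p * \<eta> x * (u x + \<tau>) powr (- d - 1))
    \<le> (LINT x|lborel. (u x + \<tau>) powr (- d) * norm (g x) powr (p - 1) * norm (grad \<eta> x))"
proof -
  have sm: "smooth \<eta>" using eta by (simp add: test_function_def)
  have ce: "continuous_on S \<eta>" and cge: "continuous_on S (grad \<eta>)" for S
    using sm by (auto intro: smooth_continuous continuous_on_grad)
  obtain R where R: "\<And>x. norm x > R \<Longrightarrow> \<eta> x = 0" using test_function_bounded[OF eta(1)] by blast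
  have R': "norm x > R \<Longrightarrow> grad \<eta> x = 0" for x using grad_outside[of R \<eta> 0 x] R by blast
  obtain Ce where Ce: "Ce > 0" "\<And>x. \<bar>\<eta> x\<bar> \<le> Ce"
    using continuous_bounded_support[OF ce R] by (metis real_norm_def)
  note [measurable] = g(1) p_flux_measurable
  have [measurable]: "u \<in> borel_measurable borel" "f \<in> borel_measurable borel" "\<eta> \<in> borel_measurable borel" "grad \<eta> \<in> borel_measurable borel"
    using u f ce cge by (auto intro: borel_measurable_continuous_onI)

  \<comment> \<open>The radius must be small for the convergence of the mollified \<open>u\<close> and, in addition, so small
    that the weighted gradient error is at most \<open>1 / (n + 1)\<close>.\<close>
  have "\<exists>r. mollifier (1 / real (Suc n)) r \<and>
     (\<integral>\<^sup>+x. (indicator (cball 0 R) x * ennreal (norm (g x) powr (p - 1))) * ennreal (norm (conv r g x - g x)) \<partial>lborel) \<le> ennreal (1 / real (Suc n))" for n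
  proof -
    obtain s where s: "s > 0" "\<And>\<rho>. mollifier s \<rho> \<Longrightarrow>
     (\<integral>\<^sup>+x. (indicator (cball 0 R) x * ennreal (norm (g x) powr (p - 1))) * ennreal (norm (conv \<rho> g x - g x)) \<partial>lborel) \<le> ennreal (1 / real (Suc n))"
      using mollification_Lp[OF p g(2,1,3), of "1 / real (Suc n)" R] by auto
    obtain r :: "'a \<Rightarrow> real" where "mollifier (min s (1 / real (Suc n))) r"
      using mollifier_exists[of "min s (1 / real (Suc n))"] s(1) by auto
    then have "mollifier s r" "mollifier (1 / real (Suc n)) r"
      by (rule mollifier_mono, simp)+
    then show ?thesis using s(2) by blast
  qed
  then have "\<exists>\<rho>. \<forall>n. mollifier (1 / real (Suc n)) (\<rho> n) \<and>
     (\<integral>\<^sup>+x. (indicator (cball 0 R) x * ennreal (norm (g x) powr (p - 1))) * ennreal (norm (conv (\<rho> n) g x - g x)) \<partial>lborel) \<le> ennreal (1 / real (Suc n))"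
    by (intro choice allI)
  then obtain \<rho> where rho: "\<And>n. mollifier (1 / real (Suc n)) (\<rho> n)"
    and rhoG: "\<And>n. (\<integral>\<^sup>+x. (indicator (cball 0 R) x * ennreal (norm (g x) powr (p - 1))) * ennreal (norm (conv (\<rho> n) g x - g x)) \<partial>lborel) \<le> ennreal (1 / real (Suc n))"
    by blast
  define V where "V n x = conv (\<rho> n) u x + \<tau>" for n x
  define G where "G n = conv (\<rho> n) g" for n
  have tfr: "test_function (\<rho> n)" for n using rho by (auto simp: mollifier_def)
  have smU: "smooth (conv (\<rho> n) u)" for n by (rule smooth_conv[OF tfr u])
  have gU: "grad (conv (\<rho> n) u) = G n" for n unfolding G_def using grad_conv_weak[OF tfr u g(2,1,4)] by blast
  have Vlow: "V n x \<ge> \<delta>" for n x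
    using conv_ge[OF rho u, of "\<delta> - \<tau>" n x] low(2) by (simp add: V_def algebra_simps)
  have Vlim: "(\<lambda>n. V n x) \<longlonglongrightarrow> u x + \<tau>" for x
    unfolding V_def by (intro tendsto_add tendsto_const conv_tendsto rho u)
  have CV: "C_k k (V n)" for k n unfolding V_def using smU by (intro C_k_add C_k_const) (simp add: smooth_def)
  have cV: "continuous_on UNIV (V n)" for n using CV[of 0 n] by simp
  have cG: "continuous_on UNIV (G n)" for n using continuous_on_grad[OF smU] by (simp add: gU)
  have dV: "(V n has_derivative (\<lambda>h. G n x \<bullet> h)) (at x)" for n x
    unfolding V_def using smooth_has_derivative[OF smU[of n], of x] by (auto intro!: derivative_eq_intros simp: gU)
  have Vpos: "V n x > 0" for n x using Vlow[of n x] low(1) by linarith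
  have upos: "u x + \<tau> > 0" for x using low(1) low(2)[of x] by linarith
  have [measurable]: "V n \<in> borel_measurable borel" "G n \<in> borel_measurable borel" for n
    using cV cG by (auto intro: borel_measurable_continuous_onI)
  have Vpb: "\<bar>V n x powr - c\<bar> \<le> \<delta> powr - c" if "c \<ge> 0" for n x c
    using that Vlow[of n x] low(1) by (auto intro: powr_mono2')
  have Vpl: "(\<lambda>n. V n x powr c) \<longlonglongrightarrow> (u x + \<tau>) powr c" for x c
    using upos[of x] by (intro tendsto_powr Vlim tendsto_const) auto

  define \<phi> where "\<phi> n x = \<eta> x * V n x powr - d" for n x
  have tphi: "test_function (\<phi> n)" for n
  proof (rule test_functionI)
    show "smooth (\<phi> n)" unfolding smooth_def \<phi>_def
      using sm by (intro allI C_k_mult C_k_powr CV Vpos) (simp add: smooth_def)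
    have "{x. \<phi> n x \<noteq> 0} \<subseteq> cball 0 R" using R by (force simp: \<phi>_def not_le[symmetric])
    then show "bounded {x. \<phi> n x \<noteq> 0}" using bounded_subset bounded_cball by blast
  qed
  have phi0: "\<phi> n x \<ge> 0" for n x using eta by (simp add: \<phi>_def)
  have gphi: "grad (\<phi> n) x = V n x powr - d *\<^sub>R grad \<eta> x - (d * \<eta> x * V n x powr (- d - 1)) *\<^sub>R G n x" for n x
  proof (rule grad_unique)
    have "((\<lambda>x. V n x powr - d) has_derivative (\<lambda>h. - d * V n x powr (- d - 1) * (G n x \<bullet> h))) (at x)"
      using Vpos[of n x] by (auto intro!: derivative_eq_intros dV simp: powr_diff field_simps)
    from has_derivative_mult[OF smooth_has_derivative[OF sm] this]
    show "(\<phi> n has_derivative (\<bullet>) (V n x powr - d *\<^sub>R grad \<eta> x - (d * \<eta> x * V n x powr (- d - 1)) *\<^sub>R G n x)) (at x)"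
      unfolding \<phi>_def by (rule has_derivative_eq_rhs) (auto simp: fun_eq_iff inner_diff_left algebra_simps)
  qed

  have lp1: "loc_int (\<lambda>x. norm (g x) powr (p - 1))" by (rule loc_int_lower_power[OF p g(1,3)])
  have i1: "integrable lborel (\<lambda>x. \<eta> x * f x)"
    by (intro integrable_cont_weight loc_int_continuous f ce R) auto
  have i2: "integrable lborel (\<lambda>x. \<eta> x * norm (g x) powr p)"
    by (intro integrable_cont_weight g ce R) auto
  have i3: "integrable lborel (\<lambda>x. norm (grad \<eta> x) * norm (g x) powr (p - 1))"
    by (rule integrable_cont_weight[where R = R])
       (use lp1 cge R' g(1) in \<open>auto intro!: continuous_intros\<close>)
  have i4: "integrable lborel (\<lambda>x. p_flux p (g x) \<bullet> grad \<eta> x)"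
    using i3
  proof (rule Bochner_Integration.integrable_bound)
    show "AE x in lborel. norm (p_flux p (g x) \<bullet> grad \<eta> x) \<le> norm (norm (grad \<eta> x) * norm (g x) powr (p - 1))"
      using Cauchy_Schwarz_ineq2[of "p_flux p (g _)" "grad \<eta> _"]
      by (intro AE_I2) (simp add: norm_p_flux abs_mult mult.commute)
  qed measurable

  \<comment> \<open>\<open>A\<close>: the source term, \<open>B\<close>: the term with \<open>\<nabla>\<eta>\<close>, \<open>D\<close>: the energy term, \<open>E\<close>: the mollification error.\<close>
  define A where "A n = (LINT x|lborel. V n x powr - d * (\<eta> x * f x))" for n
  define B where "B n = (LINT x|lborel. V n x powr - d * (p_flux p (g x) \<bullet> grad \<eta> x))" for n
  define D where "D n = (LINT x|lborel. V n x powr - (d + 1) * (\<eta> x * norm (g x) powr p))" for n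
  define E where "E n = (LINT x|lborel. V n x powr - (d + 1) * \<eta> x * (p_flux p (g x) \<bullet> (G n x - g x)))" for n
  have mV: "(\<lambda>x. V n x powr c) \<in> borel_measurable lborel" for n c by measurable
  note lims = integral_tendsto_bounded_multiplier[where c = "\<lambda>n x. V n x powr - d" and c' = "\<lambda>x. (u x + \<tau>) powr - d", OF _ mV Vpb[OF d] Vpl]
  have d1: "d + 1 \<ge> 0" using d by simp
  note lims1 = integral_tendsto_bounded_multiplier[where c = "\<lambda>n x. V n x powr - (d + 1)" and c' = "\<lambda>x. (u x + \<tau>) powr - (d + 1)", OF _ mV Vpb[OF d1] Vpl]
  have Al: "A \<longlonglongrightarrow> (LINT x|lborel. (u x + \<tau>) powr - d * (\<eta> x * f x))"
    unfolding A_def[abs_def] by (rule lims(2)[OF i1])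
  have Bl: "B \<longlonglongrightarrow> (LINT x|lborel. (u x + \<tau>) powr - d * (p_flux p (g x) \<bullet> grad \<eta> x))"
    unfolding B_def[abs_def] by (rule lims(2)[OF i4])
  have Dl: "D \<longlonglongrightarrow> (LINT x|lborel. (u x + \<tau>) powr - (d + 1) * (\<eta> x * norm (g x) powr p))"
    unfolding D_def[abs_def] by (rule lims1(2)[OF i2])
  define C where "C = \<delta> powr - (d + 1) * Ce"
  have C0: "C \<ge> 0" using Ce by (simp add: C_def)
  have Eb: "integrable lborel (\<lambda>x. V n x powr - (d + 1) * \<eta> x * (p_flux p (g x) \<bullet> (G n x - g x))) \<and>
       \<bar>E n\<bar> \<le> C * (1 / real (Suc n))" for n
  proof -
    let ?e = "\<lambda>x. V n x powr - (d + 1) * \<eta> x * (p_flux p (g x) \<bullet> (G n x - g x))"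
    let ?w = "\<lambda>x. (indicator (cball 0 R) x * ennreal (norm (g x) powr (p - 1))) * ennreal (norm (G n x - g x))"
    have pw: "ennreal (norm (?e x)) \<le> ennreal C * ?w x" for x
    proof (cases "norm x \<le> R")
      case True
      have "norm (?e x) = \<bar>V n x powr - (d + 1)\<bar> * \<bar>\<eta> x\<bar> * \<bar>p_flux p (g x) \<bullet> (G n x - g x)\<bar>"
        by (simp add: abs_mult)
      also have "\<dots> \<le> (\<delta> powr - (d + 1) * Ce) * (norm (p_flux p (g x)) * norm (G n x - g x))"
        using Ce by (intro mult_mono Vpb d1 Cauchy_Schwarz_ineq2) auto
      finally have "ennreal (norm (?e x)) \<le> ennreal (C * (norm (g x) powr (p - 1) * norm (G n x - g x)))"
        by (intro ennreal_leI) (simp add: norm_p_flux C_def)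
      then show ?thesis using True C0 by (simp add: ennreal_mult)
    qed (simp add: R)
    have [measurable]: "?w \<in> borel_measurable borel"
      by (intro borel_measurable_times_ennreal borel_measurable_indicator) auto
    have "(\<integral>\<^sup>+x. ennreal (norm (?e x)) \<partial>lborel) \<le> (\<integral>\<^sup>+x. ennreal C * ?w x \<partial>lborel)"
      by (intro nn_integral_mono pw)
    also have "\<dots> = ennreal C * (\<integral>\<^sup>+x. ?w x \<partial>lborel)" by (rule nn_integral_cmult) simp
    also have "\<dots> \<le> ennreal C * ennreal (1 / real (Suc n))"
      unfolding G_def by (intro mult_left_mono rhoG) auto
    also have "\<dots> = ennreal (C * (1 / real (Suc n)))" using C0 by (intro ennreal_mult[symmetric]) auto
    finally have b: "(\<integral>\<^sup>+x. ennreal (norm (?e x)) \<partial>lborel) \<le> ennreal (C * (1 / real (Suc n)))" .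
    have i: "integrable lborel ?e"
      using b by (intro integrableI_bounded) (auto simp: le_less_trans[OF _ ennreal_less_top])
    have "ennreal (norm (E n)) \<le> ennreal (C * (1 / real (Suc n)))"
      unfolding E_def using order_trans[OF integral_norm_bound_ennreal[OF i] b] .
    then have "norm (E n) \<le> C * (1 / real (Suc n))" using C0 by (subst (asm) ennreal_le_iff) auto
    with i show ?thesis by simp
  qed
  have El: "E \<longlonglongrightarrow> 0"
  proof (rule Lim_null_comparison)
    show "\<forall>\<^sub>F n in sequentially. norm (E n) \<le> C * (1 / real (Suc n))" using Eb by simp
    show "(\<lambda>n. C * (1 / real (Suc n))) \<longlonglongrightarrow> 0"
      using tendsto_mult_right_zero[OF LIMSEQ_inverse_real_of_nat, of C] by (simp add: inverse_eq_divide)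
  qed

  have ee: "- d - 1 = - 1 - d" by simp
  have main: "A n \<le> B n - d * (D n + E n)" for n
  proof -
    have "A n = (LINT x|lborel. f x * \<phi> n x)" by (simp add: A_def \<phi>_def mult_ac)
    also have "\<dots> \<le> (LINT x|lborel. p_flux p (g x) \<bullet> grad (\<phi> n) x)" by (rule weak[OF tphi phi0])
    also have "(\<lambda>x. p_flux p (g x) \<bullet> grad (\<phi> n) x) = (\<lambda>x. V n x powr - d * (p_flux p (g x) \<bullet> grad \<eta> x)
        - d * (V n x powr - (d + 1) * (\<eta> x * norm (g x) powr p)
          + V n x powr - (d + 1) * \<eta> x * (p_flux p (g x) \<bullet> (G n x - g x))))"
      by (auto simp: gphi fun_eq_iff inner_diff_right p_flux_inner ee algebra_simps)
    also have "integral\<^sup>L lborel \<dots> = B n - d * (D n + E n)"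
      unfolding B_def D_def E_def using lims(3)[OF i4, of n] lims1(3)[OF i2, of n] Eb[of n]
      by (simp add: Bochner_Integration.integral_diff Bochner_Integration.integral_add)
    finally show ?thesis .
  qed
  have "(LINT x|lborel. (u x + \<tau>) powr - d * (\<eta> x * f x)) \<le>
     (LINT x|lborel. (u x + \<tau>) powr - d * (p_flux p (g x) \<bullet> grad \<eta> x))
      - d * ((LINT x|lborel. (u x + \<tau>) powr - (d + 1) * (\<eta> x * norm (g x) powr p)) + 0)"
  proof (rule LIMSEQ_le[OF Al])
    show "(\<lambda>n. B n - d * (D n + E n)) \<longlonglongrightarrow>
      (LINT x|lborel. (u x + \<tau>) powr - d * (p_flux p (g x) \<bullet> grad \<eta> x))
      - d * ((LINT x|lborel. (u x + \<tau>) powr - (d + 1) * (\<eta> x * norm (g x) powr p)) + 0)"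
      by (intro tendsto_intros Bl Dl El)
    show "\<exists>N. \<forall>n\<ge>N. A n \<le> B n - d * (D n + E n)" using main by blast
  qed
  moreover have "(LINT x|lborel. (u x + \<tau>) powr - d * (p_flux p (g x) \<bullet> grad \<eta> x))
     \<le> (LINT x|lborel. (u x + \<tau>) powr - d * (norm (grad \<eta> x) * norm (g x) powr (p - 1)))"
  proof (intro integral_mono lims(1) i3 i4 mult_left_mono)
    fix x
    show "p_flux p (g x) \<bullet> grad \<eta> x \<le> norm (grad \<eta> x) * norm (g x) powr (p - 1)"
      using norm_cauchy_schwarz[of "p_flux p (g x)" "grad \<eta> x"] by (simp add: norm_p_flux mult.commute)
  qed simp
  ultimately show ?thesis by (simp add: mult_ac ee)
qed

section \<open>Cutoffs at scale R and self-improving integral bounds\<close>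

text \<open>The cutoff at scale \<open>R\<close>, raised to the power \<open>m\<close>: its gradient is then controlled by its power
  \<open>m - 1\<close>, so that for large \<open>m\<close> factors of the cutoff remain available for Hoelder's inequality.\<close>

definition cutpow :: "real \<Rightarrow> nat \<Rightarrow> 'a::euclidean_space \<Rightarrow> real" where
  "cutpow R m x = cutoff ((1 / R) *\<^sub>R x) ^ m"

definition annulus :: "real \<Rightarrow> 'a::euclidean_space set" where
  "annulus R = {x. R \<le> norm x \<and> norm x \<le> 2 * R}"

lemma compact_annulus: "compact (annulus R :: 'a::euclidean_space set)"
proof -
  have "annulus R = cball 0 (2 * R) - ball (0::'a) R" by (auto simp: annulus_def)
  then show ?thesis by (simp add: compact_diff)
qed

lemma annulus_sets [measurable]: "annulus R \<in> sets borel"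
  using compact_annulus by (rule borel_compact)

lemma annulus_measure_le:
  assumes "R > 0"
  shows "(LINT x|lborel. indicat_real (annulus R) (x::'a::euclidean_space)) \<le> unit_ball_vol (real DIM('a)) * 2 ^ DIM('a) * R powr DIM('a)"
proof -
  have i: "integrable lborel (indicat_real (cball (0::'a) r))" "integrable lborel (indicat_real (annulus R :: 'a set))" for r
    using borel_integrable_compact[of "cball (0::'a) r" "\<lambda>_. 1::real"] borel_integrable_compact[of "annulus R :: 'a set" "\<lambda>_. 1::real"] compact_annulus[of R]
    by auto
  have "(LINT x|lborel. indicat_real (annulus R) (x::'a)) \<le> (LINT x|lborel. indicat_real (cball 0 (2 * R)) (x::'a))"
    by (rule integral_mono[OF i(2,1)]) (auto simp: annulus_def indicator_def)
  also have "\<dots> = measure lborel (cball (0::'a) (2 * R))" by simp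
  also have "\<dots> = unit_ball_vol (real DIM('a)) * (2 * R) ^ DIM('a)" using assms by (simp add: content_cball)
  finally show ?thesis using assms by (simp add: power_mult_distrib powr_realpow mult_ac)
qed

lemma cutpow_bounds: "0 \<le> cutpow R m x" "cutpow R m x \<le> 1"
  by (auto simp: cutpow_def cutoff_bounds power_le_one)

lemma cutpow_eq_1: "R > 0 \<Longrightarrow> norm x \<le> R \<Longrightarrow> cutpow R m x = 1"
  by (simp add: cutpow_def cutoff_eq_1)

lemma cutpow_eq_0: "R > 0 \<Longrightarrow> m > 0 \<Longrightarrow> norm x \<ge> 2 * R \<Longrightarrow> cutpow R m x = 0"
  by (simp add: cutpow_def cutoff_eq_0 field_simps)

lemma smooth_cutpow: "smooth (cutpow R m :: 'a::euclidean_space \<Rightarrow> real)"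
  using C_k_power[OF C_k_affine[of _ "cutoff :: 'a \<Rightarrow> real" 0 "1 / R"]] smooth_cutoff[where 'a='a]
  by (simp add: smooth_def cutpow_def[abs_def])

lemma test_function_cutpow:
  assumes "R > 0" "m > 0" shows "test_function (cutpow R m :: 'a::euclidean_space \<Rightarrow> real)"
proof (rule test_functionI[OF smooth_cutpow])
  have "{x::'a. cutpow R m x \<noteq> 0} \<subseteq> cball 0 (2 * R)" using cutpow_eq_0[OF assms] by (force simp: not_le[symmetric])
  then show "bounded {x::'a. cutpow R m x \<noteq> 0}" using bounded_subset bounded_cball by blast
qed

lemma grad_cutpow_bound:
  assumes m: "m > 0"
  shows "\<exists>C>0. \<forall>R>0. \<forall>x::'a::euclidean_space.
    norm (grad (cutpow R m) x) \<le> C / R * (indicator (annulus R) x * cutpow R (m - 1) x)"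
proof -
  have z: "norm x > 2 \<Longrightarrow> grad cutoff x = 0" for x :: 'a
    by (rule grad_outside[of 2 _ 0]) (auto simp: cutoff_eq_0)
  obtain B where B: "B > 0" "\<And>x::'a. norm (grad cutoff x) \<le> B"
    using continuous_bounded_support[OF continuous_on_grad[OF smooth_cutoff] z] by blast
  show ?thesis
  proof (intro exI[of _ "real m * B"] conjI allI impI)
    show "real m * B > 0" using m B by simp
    fix R :: real and x :: 'a assume R: "R > 0"
    show "norm (grad (cutpow R m) x) \<le> real m * B / R * (indicator (annulus R) x * cutpow R (m - 1) x)"
    proof (cases "x \<in> annulus R")
      case False
      then consider "norm x < R" | "norm x > 2 * R" by (auto simp: annulus_def)
      then have "grad (cutpow R m) x = 0"
      proof cases
        case 1 then show ?thesis by (rule grad_inside[of R _ 1, rotated]) (simp add: cutpow_eq_1 R)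
      next
        case 2 then show ?thesis by (rule grad_outside[of "2 * R" _ 0, rotated]) (simp add: cutpow_eq_0 R m)
      qed
      then show ?thesis using False by simp
    next
      case True
      have "((\<lambda>x::'a. (1 / R) *\<^sub>R x) has_derivative (\<lambda>h. (1 / R) *\<^sub>R h)) (at x)"
        by (auto intro!: derivative_eq_intros)
      from has_derivative_power[OF has_derivative_compose[OF this smooth_has_derivative[OF smooth_cutoff]], of m]
      have "grad (cutpow R m) x = (real m * cutpow R (m - 1) x / R) *\<^sub>R grad cutoff ((1 / R) *\<^sub>R x)"
        unfolding cutpow_def[abs_def] by (intro grad_unique) (auto simp: mult_ac elim!: has_derivative_eq_rhs)
      then have "norm (grad (cutpow R m) x) = real m * cutpow R (m - 1) x / R * norm (grad cutoff ((1 / R) *\<^sub>R x))"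
        using R cutpow_bounds(1)[of R "m - 1" x] by simp
      also have "\<dots> \<le> real m * cutpow R (m - 1) x / R * B"
        using R cutpow_bounds(1)[of R "m - 1" x] by (intro mult_left_mono B) auto
      finally show ?thesis using True by (simp add: mult_ac)
    qed
  qed
qed

text \<open>Hoelder's inequality with the exponents \<open>1/a\<close> and \<open>1/(1-a)\<close>, in a form without roots: the weighted
  arithmetic-geometric mean inequality after normalising both integrals.\<close>

lemma integral_interpolation:
  fixes f g :: "'a \<Rightarrow> real"
  assumes f: "integrable M f" "\<And>x. f x \<ge> 0" and g: "integrable M g" "\<And>x. g x \<ge> 0"
    and a: "0 < a" "a < 1"
  shows "integrable M (\<lambda>x. f x powr a * g x powr (1 - a))"
    and "(LINT x|M. f x powr a * g x powr (1 - a)) \<le> (LINT x|M. f x) powr a * (LINT x|M. g x) powr (1 - a)"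
proof -
  have [measurable]: "f \<in> borel_measurable M" "g \<in> borel_measurable M" using f g by auto
  have young: "s powr a * t powr (1 - a) \<le> a * s + (1 - a) * t" if "s \<ge> 0" "t \<ge> 0" for s t :: real
    using Youngs_inequality_0[of a "1 - a" s t] a that by (cases "s = 0 \<or> t = 0") auto
  have "integrable M (\<lambda>x. a * f x + (1 - a) * g x)" using f g by simp
  then show i: "integrable M (\<lambda>x. f x powr a * g x powr (1 - a))"
    by (rule Bochner_Integration.integrable_bound)
       (use young f g a in \<open>auto intro!: AE_I2 simp: abs_of_nonneg\<close>)
  let ?F = "LINT x|M. f x" and ?G = "LINT x|M. g x"
  have F0: "?F \<ge> 0" "?G \<ge> 0" using f g by auto
  show "(LINT x|M. f x powr a * g x powr (1 - a)) \<le> ?F powr a * ?G powr (1 - a)"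
  proof (cases "?F = 0 \<or> ?G = 0")
    case True
    then have "AE x in M. f x = 0 \<or> g x = 0"
      using integral_nonneg_eq_0_iff_AE[OF f(1)] integral_nonneg_eq_0_iff_AE[OF g(1)] f(2) g(2)
      by (auto elim!: eventually_mono)
    then have "AE x in M. f x powr a * g x powr (1 - a) = 0" by (auto elim!: eventually_mono)
    then have "(LINT x|M. f x powr a * g x powr (1 - a)) = (LINT x|M. 0)"
      by (intro integral_cong_AE) auto
    then show ?thesis by simp
  next
    case False
    then have pos: "?F > 0" "?G > 0" using F0 by auto
    have "(LINT x|M. f x powr a * g x powr (1 - a))
        \<le> (LINT x|M. (?F powr a * ?G powr (1 - a)) * (a * (f x / ?F) + (1 - a) * (g x / ?G)))"
    proof (rule integral_mono[OF i])
      show "integrable M (\<lambda>x. (?F powr a * ?G powr (1 - a)) * (a * (f x / ?F) + (1 - a) * (g x / ?G)))"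
        using f g by simp
      fix x
      have "f x powr a * g x powr (1 - a) = (?F powr a * ?G powr (1 - a)) * ((f x / ?F) powr a * (g x / ?G) powr (1 - a))"
        using pos f(2)[of x] g(2)[of x] by (simp add: powr_divide)
      also have "\<dots> \<le> (?F powr a * ?G powr (1 - a)) * (a * (f x / ?F) + (1 - a) * (g x / ?G))"
        using pos f(2)[of x] g(2)[of x] by (intro mult_left_mono young) auto
      finally show "f x powr a * g x powr (1 - a) \<le> (?F powr a * ?G powr (1 - a)) * (a * (f x / ?F) + (1 - a) * (g x / ?G))" .
    qed
    also have "\<dots> = (?F powr a * ?G powr (1 - a)) * (a * (?F / ?F) + (1 - a) * (?G / ?G))"
      using f g by simp
    also have "\<dots> = ?F powr a * ?G powr (1 - a)" using pos by simp
    finally show ?thesis .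
  qed
qed

lemma powr_self_bound:
  fixes x K a :: real
  assumes "x \<ge> 0" "K \<ge> 0" "a < 1" "x \<le> K * x powr a"
  shows "x \<le> K powr (1 / (1 - a))"
proof (cases "x = 0")
  case False
  then have x: "x > 0" using assms by simp
  have "x powr (1 - a) = x / x powr a" using x by (simp add: powr_diff)
  also have "\<dots> \<le> K" using assms(4) x by (simp add: field_simps)
  finally have "(x powr (1 - a)) powr (1 / (1 - a)) \<le> K powr (1 / (1 - a))"
    using assms by (intro powr_mono2) auto
  then show ?thesis using x assms by (simp add: powr_powr)
qed simp

text \<open>Bounding the annulus part by the whole integral \<open>I R\<close> gives \<open>I R \<le> K (I R)\<^bsup>a\<^esup>\<close>, hence a bound on
  \<open>I R\<close> independent of \<open>R\<close>. So \<open>F\<close> has finite total integral, its annulus parts tend to zero, and the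
  hypothesis then forces the total integral to be zero.\<close>

lemma self_improving_vanish:
  fixes F :: "'a::euclidean_space \<Rightarrow> real"
  assumes F: "loc_int F" "F \<in> borel_measurable borel" "\<And>x. F x \<ge> 0"
    and a: "0 < a" "a < 1" and K: "K \<ge> 0" and m: "m > 0"
    and est: "\<And>R. R \<ge> Rmin \<Longrightarrow> R > 0 \<Longrightarrow> (LINT x|lborel. F x * cutpow R m x) \<le> K * (LINT x|lborel. indicator (annulus R) x * (F x * cutpow R m x)) powr a"
  shows "AE x in lborel. F x = 0"
proof -
  have cc: "continuous_on UNIV (cutpow R m :: 'a \<Rightarrow> real)" for R by (rule smooth_continuous[OF smooth_cutpow])
  have icut: "integrable lborel (\<lambda>x. F x * cutpow R m x)" if "R > 0" for R
  proof -
    have "integrable lborel (\<lambda>x. cutpow R m x * F x)"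
      by (rule integrable_cont_weight[OF F(1,2) cc, of "2 * R"]) (simp add: cutpow_eq_0[OF that m])
    then show ?thesis by (simp add: mult.commute)
  qed
  have iind: "integrable lborel (\<lambda>x. indicator (cball 0 R) x * F x)" for R
    using F(1) by (auto simp: loc_int_def set_integrable_def)
  define I where "I R = (LINT x|lborel. F x * cutpow R m x)" for R
  \<comment> \<open>The integrals \<open>J n\<close> over balls increase; their limit \<open>L\<close> is the total integral of \<open>F\<close>.\<close>
  define J where "J n = (LINT x|lborel. indicator (cball 0 (real n)) x * F x)" for n
  have inc: "incseq J" unfolding J_def
    by (intro incseq_SucI integral_mono iind) (use F(3) in \<open>auto simp: indicator_def\<close>)
  have JI: "J n \<le> I R" if "real n \<le> R" "R > 0" for n R
    unfolding J_def I_def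
  proof (intro integral_mono iind icut that)
    fix x :: 'a
    show "indicator (cball 0 (real n)) x * F x \<le> F x * cutpow R m x"
      using F(3)[of x] that cutpow_bounds(1)[of R m x] by (cases "norm x \<le> real n") (auto simp: cutpow_eq_1)
  qed
  have iA: "integrable lborel (\<lambda>x::'a. indicator (annulus R) x * (F x * cutpow R m x))" if "R > 0" for R
    using integrable_real_mult_indicator[OF _ icut[OF that], of "annulus R"] by (simp add: mult.commute)
  have IA: "(LINT x|lborel. indicator (annulus R) x * (F x * cutpow R m x)) \<le> I R" if "R > 0" for R
    unfolding I_def
  proof (rule integral_mono[OF iA[OF that] icut[OF that]])
    fix x :: 'a
    show "indicator (annulus R) x * (F x * cutpow R m x) \<le> F x * cutpow R m x"
      using F(3)[of x] cutpow_bounds(1)[of R m x] by (auto simp: indicator_def)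
  qed
  have A0: "(LINT x|lborel. indicator (annulus R) x * (F x * cutpow R m x)) \<ge> 0" for R
    by (intro integral_nonneg_AE AE_I2 mult_nonneg_nonneg F(3) cutpow_bounds(1)) simp
  have I0: "I R \<ge> 0" for R unfolding I_def
    by (intro integral_nonneg_AE AE_I2 mult_nonneg_nonneg F(3) cutpow_bounds(1))
  define K' where "K' = K powr (1 / (1 - a))"
  have Ib: "I R \<le> K'" if "R \<ge> Rmin" "R > 0" for R
  proof -
    have "I R \<le> K * (LINT x|lborel. indicator (annulus R) x * (F x * cutpow R m x)) powr a"
      using est[OF that] by (simp add: I_def)
    also have "\<dots> \<le> K * I R powr a"
      using IA[OF that(2)] A0 a K by (intro mult_left_mono powr_mono2) auto
    finally show ?thesis unfolding K'_def using powr_self_bound I0 K a by blast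
  qed
  have Jb: "J n \<le> K'" for n
  proof -
    define R where "R = max (real n) (max Rmin 1)"
    have R: "real n \<le> R" "Rmin \<le> R" "0 < R" by (auto simp: R_def less_max_iff_disj)
    show ?thesis using JI[OF R(1,3)] Ib[OF R(2,3)] by (rule order_trans)
  qed
  obtain L where L: "J \<longlonglongrightarrow> L"
    using incseq_convergent[OF inc, of K'] Jb by blast
  have AJ: "(LINT x|lborel. indicator (annulus (real (Suc n))) x * (F x * cutpow (real (Suc n)) m x)) \<le> J (2 * Suc n) - J n" for n
  proof -
    have "(LINT x|lborel. indicator (annulus (real (Suc n))) x * (F x * cutpow (real (Suc n)) m x))
       \<le> (LINT x|lborel. indicator (cball 0 (real (2 * Suc n))) x * F x - indicator (cball 0 (real n)) x * F x)"
    proof (rule integral_mono)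
      fix x :: 'a
      have "cutpow (real (Suc n)) m x * F x \<le> 1 * F x" using cutpow_bounds F(3) by (intro mult_right_mono) auto
      then show "indicator (annulus (real (Suc n))) x * (F x * cutpow (real (Suc n)) m x)
        \<le> indicator (cball 0 (real (2 * Suc n))) x * F x - indicator (cball 0 (real n)) x * F x"
        using F(3)[of x] by (auto simp: indicator_def annulus_def mult.commute)
    qed (intro Bochner_Integration.integrable_diff iind iA; simp)+
    also have "\<dots> = J (2 * Suc n) - J n" unfolding J_def by (intro Bochner_Integration.integral_diff iind)
    finally show ?thesis .
  qed
  have "(\<lambda>n. J (2 * Suc n)) \<longlonglongrightarrow> L"
    using LIMSEQ_subseq_LIMSEQ[OF L, of "\<lambda>n. 2 * Suc n"] by (simp add: strict_mono_def o_def)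
  then have "(\<lambda>n. J (2 * Suc n) - J n) \<longlonglongrightarrow> 0" using tendsto_diff[OF _ L, of "\<lambda>n. J (2 * Suc n)" L] by simp
  then have Al: "(\<lambda>n. LINT x|lborel. indicator (annulus (real (Suc n))) x * (F x * cutpow (real (Suc n)) m x)) \<longlonglongrightarrow> 0"
    by (rule Lim_null_comparison[rotated], intro always_eventually allI)
       (use A0 AJ in \<open>auto simp: abs_of_nonneg\<close>)
  have "L \<le> 0"
  proof -
    obtain n0 where n0: "Rmin \<le> real n0" using real_arch_simple by blast
    have "(\<lambda>n. K * (LINT x|lborel. indicator (annulus (real (Suc n))) x * (F x * cutpow (real (Suc n)) m x)) powr a) \<longlonglongrightarrow> K * 0 powr a"
      using a Al A0 by (intro tendsto_mult tendsto_const tendsto_powr') auto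
    moreover have "J n \<le> K * (LINT x|lborel. indicator (annulus (real (Suc n))) x * (F x * cutpow (real (Suc n)) m x)) powr a"
      if "n \<ge> n0" for n
      using JI[of n "real (Suc n)"] est[of "real (Suc n)"] n0 that by (simp add: I_def)
    ultimately have "L \<le> K * 0 powr a" using L by (intro LIMSEQ_le[OF L]) auto
    then show ?thesis by simp
  qed
  have "AE x in lborel. norm x \<le> real n \<longrightarrow> F x = 0" for n
  proof -
    have "J n \<le> L" using incseq_le[OF inc L] by simp
    moreover have "J n \<ge> 0" unfolding J_def
      by (intro integral_nonneg_AE AE_I2 mult_nonneg_nonneg F(3)) simp
    ultimately have "J n = 0" using \<open>L \<le> 0\<close> by simp
    then have "AE x in lborel. indicator (cball 0 (real n)) x * F x = 0"
      unfolding J_def using F(3) by (subst (asm) integral_nonneg_eq_0_iff_AE[OF iind]) auto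
    then show ?thesis by (rule eventually_mono) (auto simp: indicator_def split: if_splits)
  qed
  then have "AE x in lborel. \<forall>n. norm x \<le> real n \<longrightarrow> F x = 0" unfolding AE_all_countable by blast
  then show ?thesis by (rule eventually_mono) (meson real_arch_simple)
qed

text \<open>The mollifications of \<open>u\<close> have gradient zero, so they are constant, and they converge to \<open>u\<close>.\<close>

lemma vanishing_weak_derivative_constant:
  fixes u :: "'a::euclidean_space \<Rightarrow> real"
  assumes u: "continuous_on UNIV u"
    and g: "loc_int g" "g \<in> borel_measurable borel" "weak_deriv u g" and z: "AE x in lborel. g x = 0"
  shows "u x = u y"
proof -
  obtain \<rho> :: "nat \<Rightarrow> 'a \<Rightarrow> real" where rho: "\<And>n. mollifier (1 / real (Suc n)) (\<rho> n)"
  proof -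
    have "\<forall>n. \<exists>r :: 'a \<Rightarrow> real. mollifier (1 / real (Suc n)) r" by (intro allI mollifier_exists) simp
    from choice[OF this] show ?thesis using that by blast
  qed
  have "conv (\<rho> n) u x = conv (\<rho> n) u y" for n
  proof -
    have tf: "test_function (\<rho> n)" using rho by (auto simp: mollifier_def)
    have "conv (\<rho> n) g w = 0" for w
      unfolding conv_def using z by (intro integral_eq_zero_AE) (auto elim!: eventually_mono)
    then have "grad (conv (\<rho> n) u) w = 0" for w using grad_conv_weak[OF tf u g] by simp
    then have "(conv (\<rho> n) u has_derivative (\<lambda>h. 0)) (at w within UNIV)" for w
      using smooth_has_derivative[OF smooth_conv[OF tf u], of w] by simp
    then obtain c where "\<And>w. conv (\<rho> n) u w = c"
      using has_derivative_zero_constant[of UNIV "conv (\<rho> n) u"] by auto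
    then show ?thesis by simp
  qed
  then show ?thesis
    using conv_tendsto[OF rho u, of x] conv_tendsto[OF rho u, of y] LIMSEQ_unique by simp
qed

section \<open>Capacity estimates for supersolutions\<close>

lemma cutpow_power: "cutpow R m x = cutpow R 1 x ^ m"
  by (simp add: cutpow_def)

text \<open>A supersolution with a fixed Borel representative \<open>g\<close> of its weak gradient and a nonnegative source
  \<open>f\<close>.\<close>

locale p_supersolution =
  fixes p :: real and f u :: "'a::euclidean_space \<Rightarrow> real" and g :: "'a \<Rightarrow> 'a"
  assumes p_gt_1: "p > 1"
    and u_cont: "continuous_on UNIV u"
    and f_cont: "continuous_on UNIV f" and f_nonneg: "\<And>x. 0 \<le> f x"
    and g_borel: "g \<in> borel_measurable borel" and g_loc: "loc_int g"
    and g_power: "loc_int (\<lambda>x. norm (g x) powr p)" and g_weak: "weak_deriv u g"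
    and weak: "\<And>\<phi>. test_function \<phi> \<Longrightarrow> (\<And>x. 0 \<le> \<phi> x) \<Longrightarrow>
      (LINT x|lborel. f x * \<phi> x) \<le> (LINT x|lborel. p_flux p (g x) \<bullet> grad \<phi> x)"
begin

text \<open>The three integrals of the capacity method: the energy \<open>\<integral> |g|\<^bsup>p\<^esup> (u + \<tau>)\<^bsup>-d-1\<^esup> \<eta>\<close>, its part on the
  annulus that carries \<open>\<nabla>\<eta>\<close>, and the moment of order \<open>s\<close> of \<open>u + \<tau>\<close> on the annulus. The remaining
  cutoff power \<open>m - p\<close> in the moment is what Hoelder's inequality leaves of \<open>\<eta>\<close>.\<close>

definition weighted_energy :: "real \<Rightarrow> real \<Rightarrow> real \<Rightarrow> nat \<Rightarrow> real" where
  "weighted_energy \<tau> d R m = (LINT x|lborel. norm (g x) powr p * (u x + \<tau>) powr (- d - 1) * cutpow R m x)"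

definition annulus_energy :: "real \<Rightarrow> real \<Rightarrow> real \<Rightarrow> nat \<Rightarrow> real" where
  "annulus_energy \<tau> d R m = (LINT x|lborel. indicator (annulus R) x * (norm (g x) powr p * (u x + \<tau>) powr (- d - 1) * cutpow R m x))"

definition annulus_moment :: "real \<Rightarrow> real \<Rightarrow> real \<Rightarrow> nat \<Rightarrow> real" where
  "annulus_moment s \<tau> R m = (LINT x|lborel. indicator (annulus R) x * ((u x + \<tau>) powr s * cutpow R 1 x powr (real m - p)))"

lemma cont_cutpow: "continuous_on S (cutpow R m :: 'a \<Rightarrow> real)"
  by (rule smooth_continuous[OF smooth_cutpow])

lemma cont_cutpow_powr: "r > 0 \<Longrightarrow> continuous_on S (\<lambda>x::'a. cutpow R m x powr r)"
  by (rule continuous_on_powr') (auto intro: cont_cutpow continuous_intros cutpow_bounds)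

lemma weighted_energy_integrable:
  assumes "R > 0" "m > 0" "\<And>x. u x + \<tau> > 0"
  shows "integrable lborel (\<lambda>x. norm (g x) powr p * (u x + \<tau>) powr c * cutpow R m x)"
proof -
  have "integrable lborel (\<lambda>x. ((u x + \<tau>) powr c * cutpow R m x) * norm (g x) powr p)"
  proof (rule integrable_cont_weight[where R = "2 * R"])
    show "continuous_on UNIV (\<lambda>x. (u x + \<tau>) powr c * cutpow R m x)"
      using assms(3) by (intro continuous_intros u_cont cont_cutpow) (auto simp: less_imp_neq[symmetric])
    show "(\<lambda>x. norm (g x) powr p) \<in> borel_measurable borel" using g_borel by measurable
  qed (use g_power cutpow_eq_0[OF assms(1,2) less_imp_le] in auto)
  then show ?thesis by (simp add: mult_ac)
qed

lemma annulus_energy_integrable: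
  assumes "R > 0" "m > 0" "\<And>x. u x + \<tau> > 0"
  shows "integrable lborel (\<lambda>x. indicator (annulus R) x * (norm (g x) powr p * (u x + \<tau>) powr c * cutpow R m x))"
  using integrable_real_mult_indicator[OF _ weighted_energy_integrable[OF assms, of c], of "annulus R"] by (simp add: mult.commute)

lemma annulus_moment_integrable:
  assumes "real m > p" "continuous_on (annulus R) (\<lambda>x. (u x + \<tau>) powr s)"
  shows "integrable lborel (\<lambda>x. indicator (annulus R) x * ((u x + \<tau>) powr s * cutpow R 1 x powr (real m - p)))"
  using borel_integrable_compact[OF compact_annulus, of R "\<lambda>x. (u x + \<tau>) powr s * cutpow R 1 x powr (real m - p)"]
    assms by (simp add: continuous_on_mult cont_cutpow_powr)

lemma energies_nonneg: "weighted_energy \<tau> d R m \<ge> 0" "annulus_energy \<tau> d R m \<ge> 0" "annulus_moment s \<tau> R m \<ge> 0"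
  unfolding weighted_energy_def annulus_energy_def annulus_moment_def by (intro integral_nonneg_AE; auto simp: cutpow_bounds)+

lemma annulus_energy_le:
  assumes "R > 0" "m > 0" "\<And>x. u x + \<tau> > 0"
  shows "annulus_energy \<tau> d R m \<le> weighted_energy \<tau> d R m"
  unfolding weighted_energy_def annulus_energy_def
  by (intro integral_mono weighted_energy_integrable annulus_energy_integrable assms) (auto simp: indicator_def cutpow_bounds)

text \<open>Hoelder's inequality for the right-hand side of the energy inequality. The order of the moment is
  the unique one for which the powers of \<open>u + \<tau>\<close> match. The exponents \<open>d\<close> and \<open>e\<close> are independent,
  because the case \<open>e = 0 < d\<close> is the one that estimates the mass of \<open>f\<close>.\<close>

lemma flux_estimate:
  assumes R: "R > 0" and m: "real m > p" and v: "\<And>x. u x + \<tau> > 0" and C: "C \<ge> 0"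
    and hC: "\<And>x::'a. norm (grad (cutpow R m) x) \<le> C / R * (indicator (annulus R) x * cutpow R (m - 1) x)"
  shows "(LINT x|lborel. (u x + \<tau>) powr (- e) * norm (g x) powr (p - 1) * norm (grad (cutpow R m) x))
    \<le> C / R * (annulus_energy \<tau> d R m powr ((p - 1) / p) * annulus_moment ((d + 1) * (p - 1) - e * p) \<tau> R m powr (1 / p))"
proof -
  have m0: "m > 0" "m > 1" using m p_gt_1 by auto
  define s where "s = (d + 1) * (p - 1) - e * p"
  define a where "a = (p - 1) / p"
  have a: "0 < a" "a < 1" "1 - a = 1 / p" using p_gt_1 by (auto simp: a_def field_simps)
  define F where "F x = indicator (annulus R) x * (norm (g x) powr p * (u x + \<tau>) powr (- d - 1) * cutpow R m x)" for x
  define H where "H x = indicator (annulus R) x * ((u x + \<tau>) powr s * cutpow R 1 x powr (real m - p))" for x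
  have Fi: "integrable lborel F" unfolding F_def[abs_def] by (rule annulus_energy_integrable[OF R m0(1) v])
  have Hi: "integrable lborel H" unfolding H_def[abs_def]
    by (rule annulus_moment_integrable[OF m]) (use v in \<open>auto intro!: continuous_intros continuous_on_subset[OF u_cont] simp: less_imp_neq[symmetric]\<close>)
  have F0: "F x \<ge> 0" "H x \<ge> 0" for x by (auto simp: F_def H_def cutpow_bounds)
  \<comment> \<open>Where the cutoff vanishes both sides are zero; elsewhere the exponents of \<open>|g|\<close>, \<open>u + \<tau>\<close> and of
    the cutoff are compared.\<close>
  have pw: "(u x + \<tau>) powr (- e) * norm (g x) powr (p - 1) * norm (grad (cutpow R m) x)
     \<le> C / R * (F x powr a * H x powr (1 - a))" for x
  proof (cases "x \<in> annulus R \<and> cutpow R 1 x > 0")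
    case False
    then have "indicator (annulus R) x * cutpow R (m - 1) x = 0"
      using m0 cutpow_bounds(1)[of R 1 x] cutpow_power[of R "m - 1" x] by (auto simp: not_less indicator_def)
    then have "norm (grad (cutpow R m) x) \<le> 0" using hC[of x] by (simp only: mult_zero_right)
    then show ?thesis using C R by simp
  next
    case True
    define \<psi> where "\<psi> = cutpow R 1 x"
    define w where "w = u x + \<tau>"
    have psi: "\<psi> > 0" and w: "w > 0" using True v by (auto simp: \<psi>_def w_def)
    have cm: "cutpow R k x = \<psi> powr real k" for k using cutpow_power[of R k x] psi by (simp add: \<psi>_def powr_realpow)
    have "F x powr a = norm (g x) powr (p * a) * w powr ((- d - 1) * a) * \<psi> powr (real m * a)"
      using True psi w by (simp add: F_def cm powr_mult powr_powr flip: w_def)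
    moreover have "H x powr (1 - a) = w powr (s * (1 - a)) * \<psi> powr ((real m - p) * (1 - a))"
      using True psi w unfolding H_def w_def \<psi>_def by (simp add: powr_mult powr_powr)
    ultimately have "F x powr a * H x powr (1 - a) = norm (g x) powr (p * a)
        * w powr ((- d - 1) * a + s * (1 - a)) * \<psi> powr (real m * a + (real m - p) * (1 - a))"
      by (simp add: powr_add)
    also have "p * a = p - 1" using p_gt_1 by (simp add: a_def)
    also have "(- d - 1) * a + s * (1 - a) = - e"
      unfolding a(3) using p_gt_1 by (simp add: a_def s_def field_simps)
    also have "real m * a + (real m - p) * (1 - a) = real (m - 1)"
      unfolding a(3) using p_gt_1 m0 by (simp add: a_def field_simps of_nat_diff)
    finally have eq: "F x powr a * H x powr (1 - a) = norm (g x) powr (p - 1) * w powr (- e) * cutpow R (m - 1) x"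
      by (simp add: cm)
    have "w powr (- e) * norm (g x) powr (p - 1) * norm (grad (cutpow R m) x)
       \<le> w powr (- e) * norm (g x) powr (p - 1) * (C / R * (indicator (annulus R) x * cutpow R (m - 1) x))"
      by (intro mult_left_mono hC) auto
    also have "\<dots> = C / R * (F x powr a * H x powr (1 - a))" using True by (simp add: eq mult_ac)
    finally show ?thesis by (simp add: w_def)
  qed
  have "(LINT x|lborel. (u x + \<tau>) powr (- e) * norm (g x) powr (p - 1) * norm (grad (cutpow R m) x))
     \<le> (LINT x|lborel. C / R * (F x powr a * H x powr (1 - a)))"
  proof (rule integral_mono')
    show "integrable lborel (\<lambda>x. C / R * (F x powr a * H x powr (1 - a)))"
      using integral_interpolation(1)[OF Fi _ Hi _ a(1,2)] F0 by simp
    show "0 \<le> C / R * (F x powr a * H x powr (1 - a))" for x using C R by simp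
  qed (rule pw)
  also have "\<dots> = C / R * (LINT x|lborel. F x powr a * H x powr (1 - a))" by simp
  also have "\<dots> \<le> C / R * ((LINT x|lborel. F x) powr a * (LINT x|lborel. H x) powr (1 - a))"
    using C R by (intro mult_left_mono integral_interpolation(2)[OF Fi _ Hi _ a(1,2)] F0) auto
  also have "(LINT x|lborel. F x) = annulus_energy \<tau> d R m" by (simp add: F_def annulus_energy_def)
  also have "(LINT x|lborel. H x) = annulus_moment s \<tau> R m" by (simp add: H_def annulus_moment_def)
  finally show ?thesis unfolding a(3) by (simp add: a_def s_def)
qed

lemma energy_cutpow:
  assumes R: "R > 0" and m: "real m > p" and low: "\<delta> > 0" "\<And>x. \<delta> \<le> u x + \<tau>" and d: "d \<ge> 0"
  shows "(LINT x|lborel. f x * cutpow R m x * (u x + \<tau>) powr (- d)) + d * weighted_energy \<tau> d R m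
    \<le> (LINT x|lborel. (u x + \<tau>) powr (- d) * norm (g x) powr (p - 1) * norm (grad (cutpow R m) x))"
proof -
  have m0: "m > 0" using m p_gt_1 by auto
  show ?thesis
    using energy_inequality[OF p_gt_1 u_cont f_cont g_borel g_loc g_power g_weak weak low d test_function_cutpow[OF R m0] cutpow_bounds(1)]
    by (simp add: weighted_energy_def mult_ac)
qed

lemma gradient_estimate:
  assumes R: "R > 0" and m: "real m > p" and low: "\<delta> > 0" "\<And>x. \<delta> \<le> u x + \<tau>" and d: "d > 0" and C: "C \<ge> 0"
    and hC: "\<And>x::'a. norm (grad (cutpow R m) x) \<le> C / R * (indicator (annulus R) x * cutpow R (m - 1) x)"
  shows "weighted_energy \<tau> d R m \<le> C / (d * R) * (annulus_energy \<tau> d R m powr ((p - 1) / p) * annulus_moment (p - 1 - d) \<tau> R m powr (1 / p))"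
proof -
  have v: "u x + \<tau> > 0" for x using low(1) low(2)[of x] by linarith
  have "(LINT x|lborel. f x * cutpow R m x * (u x + \<tau>) powr (- d)) \<ge> 0"
    by (intro integral_nonneg_AE) (auto simp: f_nonneg cutpow_bounds)
  then have "d * weighted_energy \<tau> d R m \<le> C / R * (annulus_energy \<tau> d R m powr ((p - 1) / p) * annulus_moment ((d + 1) * (p - 1) - d * p) \<tau> R m powr (1 / p))"
    using energy_cutpow[OF R m low, of d] flux_estimate[OF R m v C hC, of d d] d by linarith
  also have "(d + 1) * (p - 1) - d * p = p - 1 - d" by (simp add: algebra_simps)
  finally show ?thesis using d R by (simp add: field_simps)
qed

text \<open>The energy on the annulus is at most the whole energy, which is then absorbed.\<close>

lemma gradient_estimate_closed:
  assumes R: "R > 0" and m: "real m > p" and low: "\<delta> > 0" "\<And>x. \<delta> \<le> u x + \<tau>" and d: "d > 0" and C: "C \<ge> 0"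
    and hC: "\<And>x::'a. norm (grad (cutpow R m) x) \<le> C / R * (indicator (annulus R) x * cutpow R (m - 1) x)"
  shows "weighted_energy \<tau> d R m \<le> (C / (d * R)) powr p * annulus_moment (p - 1 - d) \<tau> R m"
proof -
  have m0: "m > 0" using m p_gt_1 by auto
  have v: "u x + \<tau> > 0" for x using low(1) low(2)[of x] by linarith
  let ?K = "C / (d * R) * annulus_moment (p - 1 - d) \<tau> R m powr (1 / p)"
  have K0: "?K \<ge> 0" using C d R by simp
  have "weighted_energy \<tau> d R m \<le> C / (d * R) * (annulus_energy \<tau> d R m powr ((p - 1) / p) * annulus_moment (p - 1 - d) \<tau> R m powr (1 / p))"
    by (rule gradient_estimate[OF assms])
  also have "\<dots> \<le> C / (d * R) * (weighted_energy \<tau> d R m powr ((p - 1) / p) * annulus_moment (p - 1 - d) \<tau> R m powr (1 / p))"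
    using C d R p_gt_1 by (intro mult_left_mono mult_right_mono powr_mono2 annulus_energy_le[OF R m0 v] energies_nonneg) auto
  finally have "weighted_energy \<tau> d R m \<le> ?K * weighted_energy \<tau> d R m powr ((p - 1) / p)" by (simp add: mult_ac)
  then have "weighted_energy \<tau> d R m \<le> ?K powr (1 / (1 - (p - 1) / p))"
    by (rule powr_self_bound[OF energies_nonneg(1) K0, rotated]) (use p_gt_1 in \<open>simp add: field_simps\<close>)
  also have "1 / (1 - (p - 1) / p) = p" using p_gt_1 by (simp add: field_simps)
  also have "?K powr p = (C / (d * R)) powr p * annulus_moment (p - 1 - d) \<tau> R m"
    using C d R p_gt_1 energies_nonneg(3) by (subst powr_mult) (simp_all add: powr_powr)
  finally show ?thesis .
qed

lemma constant_if_gradient_vanishes: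
  assumes "AE x in lborel. g x = 0" shows "u x = u y"
  by (rule vanishing_weak_derivative_constant[OF u_cont g_loc g_borel g_weak assms])

text \<open>With \<open>d = p - 1\<close> the moment has order zero, so it is at most the volume of the annulus. The energy
  satisfies the hypothesis of \<open>self_improving_vanish\<close> since \<open>R\<^bsup>N/p\<^esup> / R\<close> stays bounded for \<open>N \<le> p\<close>.\<close>

theorem supersolution_constant:
  assumes dim: "real DIM('a) \<le> p" and bdd: "bdd_below (range u)"
  shows "u x = u y"
proof (rule constant_if_gradient_vanishes)
  obtain c where c: "\<And>x. c \<le> u x" using bdd by (auto simp: bdd_below_def)
  \<comment> \<open>The shift makes \<open>u + \<tau> \<ge> 1\<close>.\<close>
  define \<tau> where "\<tau> = 1 - c"
  have low: "1 \<le> u x + \<tau>" for x using c[of x] by (simp add: \<tau>_def)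
  have v: "u x + \<tau> > 0" for x using low[of x] by linarith
  define d where "d = p - 1"
  have d: "d > 0" using p_gt_1 by (simp add: d_def)
  obtain m :: nat where m: "real m > p" using reals_Archimedean2 by blast
  have m0: "m > 0" using m p_gt_1 by auto
  obtain C where C: "C > 0" and hC: "\<And>R x. R > 0 \<Longrightarrow>
    norm (grad (cutpow R m) (x::'a)) \<le> C / R * (indicator (annulus R) x * cutpow R (m - 1) x)"
    using grad_cutpow_bound[OF m0] by blast
  define B where "B = unit_ball_vol (real DIM('a)) * 2 ^ DIM('a)"
  have B0: "B \<ge> 0" by (simp add: B_def)
  define F where "F x = norm (g x) powr p * (u x + \<tau>) powr (- d - 1)" for x
  have cu: "continuous_on UNIV (\<lambda>x. (u x + \<tau>) powr c)" for c
    using v by (intro continuous_intros u_cont) (auto simp: less_imp_neq[symmetric])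
  have "AE x in lborel. F x = 0"
  proof (rule self_improving_vanish[where Rmin = 1 and a = "(p - 1) / p" and K = "C / d * B powr (1 / p)" and m = m])
    show "F \<in> borel_measurable borel" unfolding F_def[abs_def]
      using g_borel borel_measurable_continuous_onI[OF u_cont] by measurable
    show "loc_int F" unfolding loc_int_def set_integrable_def
    proof
      fix R :: real
      have "integrable lborel (\<lambda>x. indicator (cball 0 R) x *\<^sub>R norm (g x) powr p)"
        using g_power by (auto simp: loc_int_def set_integrable_def)
      then show "integrable lborel (\<lambda>x. indicator (cball 0 R) x *\<^sub>R F x)"
      proof (rule Bochner_Integration.integrable_bound)
        show "(\<lambda>x. indicator (cball 0 R) x *\<^sub>R F x) \<in> borel_measurable lborel"
          using \<open>F \<in> borel_measurable borel\<close> by (intro borel_measurable_scaleR borel_measurable_indicator) auto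
        show "AE x in lborel. norm (indicator (cball 0 R) x *\<^sub>R F x) \<le> norm (indicator (cball 0 R) x *\<^sub>R norm (g x) powr p)"
        proof (intro AE_I2)
          fix x
          have "(u x + \<tau>) powr (- d - 1) \<le> 1 powr (- d - 1)" using low[of x] d by (intro powr_mono2') auto
          then have "norm (g x) powr p * (u x + \<tau>) powr (- d - 1) \<le> norm (g x) powr p * 1" by (intro mult_left_mono) auto
          then show "norm (indicator (cball 0 R) x *\<^sub>R F x) \<le> norm (indicator (cball 0 R) x *\<^sub>R norm (g x) powr p)"
            by (auto simp: F_def indicator_def)
        qed
      qed
    qed
    fix R :: real assume R1: "R \<ge> 1" and R: "R > 0"
    have "(LINT x|lborel. F x * cutpow R m x) = weighted_energy \<tau> d R m" by (simp add: F_def weighted_energy_def)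
    also have "\<dots> \<le> C / (d * R) * (annulus_energy \<tau> d R m powr ((p - 1) / p) * annulus_moment (p - 1 - d) \<tau> R m powr (1 / p))"
      by (rule gradient_estimate[OF R m _ low d less_imp_le[OF C] hC[OF R]]) simp
    also have "annulus_moment (p - 1 - d) \<tau> R m \<le> B * R powr DIM('a)"
    proof -
      have "annulus_moment (p - 1 - d) \<tau> R m \<le> (LINT x|lborel. indicator (annulus R) (x::'a))"
        unfolding annulus_moment_def
      proof (rule integral_mono)
        show "integrable lborel (\<lambda>x. indicator (annulus R) x * ((u x + \<tau>) powr (p - 1 - d) * cutpow R 1 x powr (real m - p)))"
          by (rule annulus_moment_integrable[OF m continuous_on_subset[OF cu]]) simp
        show "integrable lborel (indicat_real (annulus R :: 'a set))"
          using borel_integrable_compact[OF compact_annulus, of R "\<lambda>_. 1::real"] by simp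
        fix x :: 'a
        have "cutpow R 1 x powr (real m - p) \<le> 1 powr (real m - p)" using m cutpow_bounds[of R 1 x] by (intro powr_mono2) auto
        then show "indicator (annulus R) x * ((u x + \<tau>) powr (p - 1 - d) * cutpow R 1 x powr (real m - p)) \<le> indicat_real (annulus R) x"
          using v[of x] by (auto simp: d_def indicator_def)
      qed
      also have "\<dots> \<le> B * R powr DIM('a)" unfolding B_def by (rule annulus_measure_le[OF R])
      finally show ?thesis .
    qed
    then have "C / (d * R) * (annulus_energy \<tau> d R m powr ((p - 1) / p) * annulus_moment (p - 1 - d) \<tau> R m powr (1 / p))
       \<le> C / (d * R) * (annulus_energy \<tau> d R m powr ((p - 1) / p) * (B * R powr DIM('a)) powr (1 / p))"
      using C d R p_gt_1 by (intro mult_left_mono powr_mono2 energies_nonneg) auto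
    also have "(B * R powr DIM('a)) powr (1 / p) \<le> B powr (1 / p) * R"
    proof -
      have "(B * R powr DIM('a)) powr (1 / p) = B powr (1 / p) * R powr (DIM('a) / p)"
        using B0 by (simp add: powr_mult powr_powr)
      also have "\<dots> \<le> B powr (1 / p) * R powr 1"
        using R1 dim p_gt_1 by (intro mult_left_mono powr_mono) (auto simp: field_simps)
      finally show ?thesis using R by simp
    qed
    then have "C / (d * R) * (annulus_energy \<tau> d R m powr ((p - 1) / p) * (B * R powr DIM('a)) powr (1 / p))
       \<le> C / (d * R) * (annulus_energy \<tau> d R m powr ((p - 1) / p) * (B powr (1 / p) * R))"
      using C d R by (intro mult_left_mono) auto
    also have "\<dots> = C / d * B powr (1 / p) * annulus_energy \<tau> d R m powr ((p - 1) / p)" using R by (simp add: field_simps)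
    finally show "(LINT x|lborel. F x * cutpow R m x)
      \<le> C / d * B powr (1 / p) * (LINT x|lborel. indicator (annulus R) x * (F x * cutpow R m x)) powr ((p - 1) / p)"
      by (simp add: annulus_energy_def F_def)
  qed (use p_gt_1 C d m0 in \<open>auto simp: F_def field_simps\<close>)
  then show "AE x in lborel. g x = 0"
  proof (rule eventually_mono)
    fix x assume "F x = 0"
    moreover have "(u x + \<tau>) powr (- d - 1) > 0" using v[of x] by simp
    ultimately show "g x = 0" by (simp add: F_def)
  qed
qed

section \<open>Vanishing in the subcritical and critical range\<close>

text \<open>Hoelder's inequality between \<open>u\<^bsup>q\<^esup>\<close> and the indicator of the annulus. The lower bound on \<open>m\<close> ensures \<open>m - p \<ge> m s / q\<close>,
  so that the cutoff factor of the moment is at most the one that the inequality produces.\<close>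

lemma annulus_moment_interpolation:
  assumes u0: "\<And>x. 0 \<le> u x" and R: "R > 0" and m: "real m > p" and s: "0 < s" "s < q" and ms: "real m * (1 - s / q) \<ge> p"
  shows "annulus_moment s 0 R m \<le> (LINT x|lborel. indicator (annulus R) x * (u x powr q * cutpow R m x)) powr (s / q)
    * (LINT x|lborel. indicat_real (annulus R) (x::'a)) powr (1 - s / q)"
proof -
  have m0: "m > 0" using m p_gt_1 by auto
  have q: "q > 0" and a: "0 < s / q" "s / q < 1" using s by auto
  define F where "F x = indicator (annulus R) x * (u x powr q * cutpow R m x)" for x
  have cu: "continuous_on S (\<lambda>x. u x powr c)" if "c > 0" for S c
    using that u0 by (intro continuous_on_powr' continuous_on_subset[OF u_cont] continuous_intros) auto
  have Fi: "integrable lborel F" unfolding F_def[abs_def]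
    using borel_integrable_compact[OF compact_annulus, of R "\<lambda>x. u x powr q * cutpow R m x"]
      cu[OF q] by (simp add: continuous_on_mult cont_cutpow)
  have Hi: "integrable lborel (indicat_real (annulus R :: 'a set))"
    using borel_integrable_compact[OF compact_annulus, of R "\<lambda>_. 1::real"] by simp
  have F0: "F x \<ge> 0" for x by (simp add: F_def cutpow_bounds)
  have "annulus_moment s 0 R m \<le> (LINT x|lborel. F x powr (s / q) * indicat_real (annulus R) x powr (1 - s / q))"
    unfolding annulus_moment_def
  proof (rule integral_mono')
    show "integrable lborel (\<lambda>x. F x powr (s / q) * indicat_real (annulus R) x powr (1 - s / q))"
      by (rule integral_interpolation(1)[OF Fi F0 Hi _ a]) simp
    fix x
    show "indicator (annulus R) x * ((u x + 0) powr s * cutpow R 1 x powr (real m - p))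
       \<le> F x powr (s / q) * indicat_real (annulus R) x powr (1 - s / q)"
    proof (cases "x \<in> annulus R \<and> cutpow R 1 x > 0")
      case True
      define \<psi> where "\<psi> = cutpow R 1 x"
      have psi: "0 < \<psi>" "\<psi> \<le> 1" using True cutpow_bounds by (auto simp: \<psi>_def)
      have "F x powr (s / q) = u x powr s * \<psi> powr (real m * (s / q))"
        using True psi q cutpow_power[of R m x]
        by (simp add: F_def powr_mult powr_powr u0 \<psi>_def flip: powr_realpow)
      moreover have "\<psi> powr (real m - p) \<le> \<psi> powr (real m * (s / q))"
        using psi ms by (intro powr_mono') (auto simp: algebra_simps)
      ultimately show ?thesis using True psi unfolding \<psi>_def[symmetric] by (simp add: mult_left_mono)
    next
      case False
      then have "indicator (annulus R) x * ((u x + 0) powr s * cutpow R 1 x powr (real m - p)) = 0"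
        using cutpow_bounds(1)[of R 1 x] by (auto simp: indicator_def not_less)
      then show ?thesis by (simp only:) simp
    qed
  qed simp
  also have "\<dots> \<le> (LINT x|lborel. F x) powr (s / q) * (LINT x|lborel. indicat_real (annulus R) (x::'a)) powr (1 - s / q)"
    by (rule integral_interpolation(2)[OF Fi F0 Hi _ a]) simp
  finally show ?thesis by (simp add: F_def)
qed

lemma annulus_moment_tendsto:
  assumes u0: "\<And>x. 0 \<le> u x" and m: "real m > p" and s: "0 < s"
  shows "(\<lambda>n. annulus_moment s (1 / real (Suc n)) R m) \<longlonglongrightarrow> annulus_moment s 0 R m"
proof -
  have "compact (u ` annulus R)"
    using compact_annulus by (intro compact_continuous_image continuous_on_subset[OF u_cont]) auto
  then obtain M where M: "\<And>x. x \<in> annulus R \<Longrightarrow> u x \<le> M"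
    using compact_imp_bounded bounded_real by (metis abs_le_D1 imageI)
  define c where "c n x = indicator (annulus R) x * (u x + 1 / real (Suc n)) powr s" for n x
  define k where "k x = indicator (annulus R) x * cutpow R 1 x powr (real m - p)" for x :: 'a
  have ki: "integrable lborel k" unfolding k_def[abs_def]
    using borel_integrable_compact[OF compact_annulus, of R "\<lambda>x::'a. cutpow R 1 x powr (real m - p)"] m
    by (simp add: cont_cutpow_powr)
  have um: "u \<in> borel_measurable borel" using u_cont by (rule borel_measurable_continuous_onI)
  have "(\<lambda>n. LINT x|lborel. c n x * k x) \<longlonglongrightarrow> (LINT x|lborel. (indicator (annulus R) x * (u x + 0) powr s) * k x)"
  proof (rule integral_tendsto_bounded_multiplier(2)[OF ki])
    show "c n \<in> borel_measurable lborel" for n unfolding c_def using um by measurable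
    show "\<bar>c n x\<bar> \<le> (\<bar>M\<bar> + 1) powr s" for n x
    proof (cases "x \<in> annulus R")
      case True
      have "u x + 1 / real (Suc n) \<le> \<bar>M\<bar> + 1" using M[OF True] by (intro add_mono) auto
      then have "(u x + 1 / real (Suc n)) powr s \<le> (\<bar>M\<bar> + 1) powr s" using s u0[of x] by (intro powr_mono2) auto
      then show ?thesis using True by (simp add: c_def)
    qed (simp add: c_def)
    show "(\<lambda>n. c n x) \<longlonglongrightarrow> indicator (annulus R) x * (u x + 0) powr s" for x
    proof -
      have "(\<lambda>n. 1 / real (Suc n)) \<longlonglongrightarrow> 0"
        using LIMSEQ_inverse_real_of_nat by (simp add: inverse_eq_divide)
      then show ?thesis unfolding c_def using s u0
        by (intro tendsto_intros tendsto_powr') (auto intro!: always_eventually add_nonneg_nonneg)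
    qed
  qed
  also have "(\<lambda>n. LINT x|lborel. c n x * k x) = (\<lambda>n. annulus_moment s (1 / real (Suc n)) R m)"
    unfolding annulus_moment_def c_def k_def by (intro ext Bochner_Integration.integral_cong) (auto simp: indicator_def)
  also have "(LINT x|lborel. (indicator (annulus R) x * (u x + 0) powr s) * k x) = annulus_moment s 0 R m"
    unfolding annulus_moment_def k_def by (intro Bochner_Integration.integral_cong) (auto simp: indicator_def)
  finally show ?thesis .
qed

text \<open>The energy inequality with \<open>d = 0\<close> has the flux weighted by \<open>|g|\<^bsup>p-1\<^esup>\<close> alone on its right-hand side;
  \<open>flux_estimate\<close> bounds it through the energy with a positive \<open>d\<close>, and \<open>gradient_estimate_closed\<close>
  bounds that energy by a moment. Finally \<open>\<tau> \<rightarrow> 0\<close>; both moments have positive order, so they converge.\<close>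

lemma mass_estimate:
  assumes u0: "\<And>x. 0 \<le> u x" and R: "R > 0" and m: "real m > p" and d: "0 < d" "d < p - 1" and C: "C \<ge> 0"
    and hC: "\<And>x::'a. norm (grad (cutpow R m) x) \<le> C / R * (indicator (annulus R) x * cutpow R (m - 1) x)"
  shows "(LINT x|lborel. f x * cutpow R m x)
    \<le> C / R * ((C / (d * R)) powr (p - 1) * (annulus_moment (p - 1 - d) 0 R m powr ((p - 1) / p) * annulus_moment ((d + 1) * (p - 1)) 0 R m powr (1 / p)))"
proof -
  have m0: "m > 0" using m p_gt_1 by auto
  have step: "(LINT x|lborel. f x * cutpow R m x)
    \<le> C / R * ((C / (d * R)) powr (p - 1) * (annulus_moment (p - 1 - d) \<tau> R m powr ((p - 1) / p) * annulus_moment ((d + 1) * (p - 1)) \<tau> R m powr (1 / p)))"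
    if t: "\<tau> > 0" for \<tau>
  proof -
    have low: "\<tau> \<le> u x + \<tau>" for x using u0 by simp
    have v: "u x + \<tau> > 0" for x using u0[of x] t by linarith
    have "(LINT x|lborel. f x * cutpow R m x) = (LINT x|lborel. f x * cutpow R m x * (u x + \<tau>) powr - 0) + 0 * weighted_energy \<tau> 0 R m"
      using v by (simp add: less_imp_neq[symmetric])
    also have "\<dots> \<le> (LINT x|lborel. (u x + \<tau>) powr - 0 * norm (g x) powr (p - 1) * norm (grad (cutpow R m) x))"
      by (rule energy_cutpow[OF R m t low]) simp
    also have "\<dots> \<le> C / R * (annulus_energy \<tau> d R m powr ((p - 1) / p) * annulus_moment ((d + 1) * (p - 1) - 0 * p) \<tau> R m powr (1 / p))"
      by (rule flux_estimate[OF R m v C hC])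
    finally have 1: "(LINT x|lborel. f x * cutpow R m x)
      \<le> C / R * (annulus_energy \<tau> d R m powr ((p - 1) / p) * annulus_moment ((d + 1) * (p - 1)) \<tau> R m powr (1 / p))" by simp
    have "annulus_energy \<tau> d R m powr ((p - 1) / p) \<le> ((C / (d * R)) powr p * annulus_moment (p - 1 - d) \<tau> R m) powr ((p - 1) / p)"
      using annulus_energy_le[OF R m0 v, of d] gradient_estimate_closed[OF R m t low d(1) C hC] p_gt_1
      by (intro powr_mono2 energies_nonneg) auto
    also have "\<dots> = (C / (d * R)) powr (p - 1) * annulus_moment (p - 1 - d) \<tau> R m powr ((p - 1) / p)"
      using p_gt_1 energies_nonneg(3) by (subst powr_mult) (simp_all add: powr_powr)
    finally have "C / R * (annulus_energy \<tau> d R m powr ((p - 1) / p) * annulus_moment ((d + 1) * (p - 1)) \<tau> R m powr (1 / p))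
       \<le> C / R * (((C / (d * R)) powr (p - 1) * annulus_moment (p - 1 - d) \<tau> R m powr ((p - 1) / p)) * annulus_moment ((d + 1) * (p - 1)) \<tau> R m powr (1 / p))"
      using C R by (intro mult_left_mono mult_right_mono) auto
    with 1 show ?thesis by (simp only: mult.assoc)
  qed
  have "(\<lambda>n. C / R * ((C / (d * R)) powr (p - 1) * (annulus_moment (p - 1 - d) (1 / real (Suc n)) R m powr ((p - 1) / p)
      * annulus_moment ((d + 1) * (p - 1)) (1 / real (Suc n)) R m powr (1 / p))))
    \<longlonglongrightarrow> C / R * ((C / (d * R)) powr (p - 1) * (annulus_moment (p - 1 - d) 0 R m powr ((p - 1) / p) * annulus_moment ((d + 1) * (p - 1)) 0 R m powr (1 / p)))"
    using d p_gt_1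
    by (intro tendsto_mult tendsto_const tendsto_powr' annulus_moment_tendsto[OF u0 m]) (auto intro!: always_eventually energies_nonneg)
  then show ?thesis
    by (rule LIMSEQ_le_const) (intro exI allI impI step, simp)
qed

text \<open>Once \<open>u\<close> is zero on the annulus, the moment in \<open>gradient_estimate_closed\<close> tends to zero with \<open>\<tau>\<close>. The
  weight \<open>(u + \<tau>)\<^bsup>-d-1\<^esup>\<close> of the energy stays bounded below, as \<open>u\<close> is bounded on balls.\<close>

lemma gradient_vanishes_if_zero_far:
  assumes u0: "\<And>x. 0 \<le> u x" and R1: "R1 > 0" and z: "AE x in lborel. norm x \<ge> R1 \<longrightarrow> u x = 0"
  shows "AE x in lborel. g x = 0"
proof -
  define d where "d = (p - 1) / 2"
  have d: "0 < d" "p - 1 - d > 0" using p_gt_1 by (auto simp: d_def field_simps)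
  obtain m :: nat where m: "real m > p" using reals_Archimedean2 by blast
  have m0: "m > 0" using m p_gt_1 by auto
  obtain C where C: "C > 0" and hC: "\<And>R x. R > 0 \<Longrightarrow>
    norm (grad (cutpow R m) (x::'a)) \<le> C / R * (indicator (annulus R) x * cutpow R (m - 1) x)"
    using grad_cutpow_bound[OF m0] by blast
  have "AE x in lborel. norm x \<le> real n \<longrightarrow> g x = 0" for n
  proof -
    define R where "R = max R1 (real n)"
    have R: "R > 0" "R \<ge> R1" "R \<ge> real n" using R1 by (auto simp: R_def)
    have um: "u \<in> borel_measurable borel" using u_cont by (rule borel_measurable_continuous_onI)
    have W0: "annulus_moment (p - 1 - d) 0 R m = 0"
      unfolding annulus_moment_def using z R(2) by (intro integral_eq_zero_AE) (auto elim!: eventually_mono simp: annulus_def indicator_def)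
    have "compact (u ` cball 0 (2 * R))"
      by (intro compact_continuous_image continuous_on_subset[OF u_cont]) auto
    then obtain M where "\<And>x. x \<in> cball 0 (2 * R) \<Longrightarrow> u x \<le> M"
      using compact_imp_bounded bounded_real by (metis abs_le_D1 imageI)
    then have M: "norm x \<le> 2 * R \<Longrightarrow> u x \<le> \<bar>M\<bar>" for x by force
    define E where "E = (LINT x|lborel. norm (g x) powr p * cutpow R m x)"
    have Ei: "integrable lborel (\<lambda>x. norm (g x) powr p * cutpow R m x)"
    proof -
      have "integrable lborel (\<lambda>x. cutpow R m x * norm (g x) powr p)"
      proof (rule integrable_cont_weight[where R = "2 * R"])
        show "(\<lambda>x. norm (g x) powr p) \<in> borel_measurable borel" using g_borel by measurable
      qed (use g_power cont_cutpow cutpow_eq_0[OF R(1) m0 less_imp_le] in auto)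
      then show ?thesis by (simp add: mult.commute)
    qed
    have est: "(\<bar>M\<bar> + 1) powr (- d - 1) * E \<le> (C / (d * R)) powr p * annulus_moment (p - 1 - d) (1 / real (Suc k)) R m" for k
    proof -
      define \<tau> where "\<tau> = 1 / real (Suc k)"
      have t: "\<tau> > 0" "\<tau> \<le> 1" by (auto simp: \<tau>_def)
      have low: "\<tau> \<le> u x + \<tau>" for x using u0 by simp
      have v: "u x + \<tau> > 0" for x using u0[of x] t by linarith
      have "(\<bar>M\<bar> + 1) powr (- d - 1) * E = (LINT x|lborel. (\<bar>M\<bar> + 1) powr (- d - 1) * (norm (g x) powr p * cutpow R m x))"
        by (simp add: E_def)
      also have "\<dots> \<le> weighted_energy \<tau> d R m"
        unfolding weighted_energy_def
      proof (rule integral_mono)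
        show "integrable lborel (\<lambda>x. (\<bar>M\<bar> + 1) powr (- d - 1) * (norm (g x) powr p * cutpow R m x))" using Ei by simp
        show "integrable lborel (\<lambda>x. norm (g x) powr p * (u x + \<tau>) powr (- d - 1) * cutpow R m x)"
          by (rule weighted_energy_integrable[OF R(1) m0 v])
        fix x
        show "(\<bar>M\<bar> + 1) powr (- d - 1) * (norm (g x) powr p * cutpow R m x) \<le> norm (g x) powr p * (u x + \<tau>) powr (- d - 1) * cutpow R m x"
        proof (cases "norm x \<le> 2 * R")
          case True
          have "(\<bar>M\<bar> + 1) powr (- d - 1) \<le> (u x + \<tau>) powr (- d - 1)"
            using M[OF True] t v[of x] d by (intro powr_mono2') auto
          then have "(\<bar>M\<bar> + 1) powr (- d - 1) * (norm (g x) powr p * cutpow R m x) \<le> (u x + \<tau>) powr (- d - 1) * (norm (g x) powr p * cutpow R m x)"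
            by (intro mult_right_mono) (auto simp: cutpow_bounds)
          then show ?thesis by (simp add: mult_ac)
        next
          case False
          then show ?thesis using cutpow_eq_0[OF R(1) m0, of x] by simp
        qed
      qed
      also have "\<dots> \<le> (C / (d * R)) powr p * annulus_moment (p - 1 - d) \<tau> R m"
        by (rule gradient_estimate_closed[OF R(1) m t(1) low d(1) less_imp_le[OF C] hC[OF R(1)]])
      finally show ?thesis by (simp add: \<tau>_def)
    qed
    have "(\<bar>M\<bar> + 1) powr (- d - 1) * E \<le> (C / (d * R)) powr p * annulus_moment (p - 1 - d) 0 R m"
      by (rule LIMSEQ_le_const[OF tendsto_mult[OF tendsto_const annulus_moment_tendsto[OF u0 m d(2)]]]) (use est in blast)
    then have "E \<le> 0" using W0 by (simp add: mult_le_0_iff) (metis abs_ge_zero add_nonneg_pos less_imp_neq zero_less_one)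
    moreover have "E \<ge> 0" unfolding E_def by (intro integral_nonneg_AE AE_I2 mult_nonneg_nonneg cutpow_bounds) simp
    ultimately have "E = 0" by simp
    then have "AE x in lborel. norm (g x) powr p * cutpow R m x = 0"
      unfolding E_def by (subst (asm) integral_nonneg_eq_0_iff_AE[OF Ei]) (simp_all add: cutpow_bounds)
    then show ?thesis
    proof (rule eventually_mono)
      fix x assume "norm (g x) powr p * cutpow R m x = 0"
      then show "norm x \<le> real n \<longrightarrow> g x = 0"
        using R cutpow_eq_1[OF R(1), of x m] by auto
    qed
  qed
  then have "AE x in lborel. \<forall>n. norm x \<le> real n \<longrightarrow> g x = 0" unfolding AE_all_countable by blast
  then show ?thesis by (rule eventually_mono) (meson real_arch_simple)
qed

text \<open>The exponent \<open>d\<close> is taken so small that the orders \<open>s1 = p - 1 - d\<close> and \<open>s2 = (d + 1) (p - 1)\<close> of the two moments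
  in \<open>mass_estimate\<close> lie strictly between \<open>0\<close> and \<open>q\<close>. Hoelder's inequality bounds the moments by
  \<open>\<integral> u\<^bsup>q\<^esup> \<eta>\<close> over the annulus, which is comparable to \<open>R\<^bsup>-\<gamma>\<^esup> \<integral> f \<eta>\<close> there. The exponents combine to
  \<open>\<alpha> = (p - 1) / q\<close> regardless of \<open>d\<close>, and the total power of \<open>R\<close> is \<open>- p - \<gamma> \<alpha> + N (1 - \<alpha>) \<le> 0\<close>.\<close>

theorem supersolution_vanishes:
  assumes dim: "real DIM('a) > p" and u0: "\<And>x. 0 \<le> u x"
    and feq: "\<And>x. f x = h x * u x powr q" and a: "a > 0"
    and R1: "R1 > 0" and h: "\<And>x. norm x \<ge> R1 \<Longrightarrow> h x = a * norm x powr \<gamma>"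
    and q: "p - 1 < q" "q \<le> (real DIM('a) + \<gamma>) * (p - 1) / (real DIM('a) - p)"
  shows "u x = 0"
proof -
  define N where "N = real DIM('a)"
  define d where "d = min ((p - 1) / 2) ((q - (p - 1)) / (2 * (p - 1)))"
  have q0: "q > 0" using q p_gt_1 by simp
  have d: "0 < d" "d < p - 1" "(d + 1) * (p - 1) < q"
  proof -
    show "0 < d" using p_gt_1 q by (simp add: d_def)
    have "d \<le> (p - 1) / 2" unfolding d_def by (rule min.cobounded1)
    then show "d < p - 1" using p_gt_1 by simp
    have "d * (p - 1) \<le> (q - (p - 1)) / (2 * (p - 1)) * (p - 1)"
      using p_gt_1 by (intro mult_right_mono) (auto simp: d_def)
    also have "\<dots> = (q - (p - 1)) / 2" using p_gt_1 by (simp add: field_simps)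
    finally show "(d + 1) * (p - 1) < q" using q by (simp add: algebra_simps)
  qed
  define s1 where "s1 = p - 1 - d"
  define s2 where "s2 = (d + 1) * (p - 1)"
  have s: "0 < s1" "s1 < q" "0 < s2" "s2 < q" using d q p_gt_1 by (auto simp: s1_def s2_def)
  obtain m :: nat where m': "real m > max p (max (p / (1 - s1 / q)) (p / (1 - s2 / q)))"
    using reals_Archimedean2 by blast
  have m: "real m > p" and ms: "real m * (1 - s1 / q) \<ge> p" "real m * (1 - s2 / q) \<ge> p"
    using m' s q0 by (auto simp: pos_divide_less_eq)
  have m0: "m > 0" using m p_gt_1 by auto
  obtain C where C: "C > 0" and hC: "\<And>R x. R > 0 \<Longrightarrow>
    norm (grad (cutpow R m) (x::'a)) \<le> C / R * (indicator (annulus R) x * cutpow R (m - 1) x)"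
    using grad_cutpow_bound[OF m0] by blast
  define \<alpha> where "\<alpha> = (p - 1) / q"
  have al: "0 < \<alpha>" "\<alpha> < 1" using p_gt_1 q by (auto simp: \<alpha>_def)
  have al_eq: "s1 / q * ((p - 1) / p) + s2 / q * (1 / p) = \<alpha>"
  proof -
    have "s1 * (p - 1) + s2 = p * (p - 1)" by (simp add: s1_def s2_def algebra_simps)
    moreover have "s1 / q * ((p - 1) / p) + s2 / q * (1 / p) = (s1 * (p - 1) + s2) / (q * p)"
      by (simp add: add_divide_distrib)
    ultimately show ?thesis using p_gt_1 by (simp add: \<alpha>_def)
  qed
  define B where "B = unit_ball_vol (real DIM('a)) * 2 ^ DIM('a)"
  have B0: "B \<ge> 0" by (simp add: B_def)
  \<comment> \<open>On the annulus \<open>|x|\<^bsup>\<gamma>\<^esup>\<close> is at least \<open>min 1 2\<^bsup>\<gamma>\<^esup>\<close> times \<open>R\<^bsup>\<gamma>\<^esup>\<close>, for either sign of \<open>\<gamma>\<close>.\<close>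
  define c where "c = a * min 1 (2 powr \<gamma>)"
  have c: "c > 0" using a by (simp add: c_def)
  have expo: "- p - \<gamma> * \<alpha> + N * (1 - \<alpha>) \<le> 0"
  proof -
    have "q * (N - p) \<le> (N + \<gamma>) * (p - 1)" using q(2) dim by (simp add: N_def pos_le_divide_eq)
    then have "N - p \<le> (N + \<gamma>) * \<alpha>" using q0 by (simp add: \<alpha>_def pos_le_divide_eq mult.commute)
    then show ?thesis by (simp add: algebra_simps)
  qed
  define K where "K = C * (C / d) powr (p - 1) * (1 / c) powr \<alpha> * B powr (1 - \<alpha>)"

  have f_zero: "AE x in lborel. f x = 0"
  proof (rule self_improving_vanish[where Rmin = "max 1 R1" and a = \<alpha> and K = K and m = m])
    show "loc_int f" by (rule loc_int_continuous[OF f_cont])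
    show "f \<in> borel_measurable borel" by (rule borel_measurable_continuous_onI[OF f_cont])
    show "K \<ge> 0" using C by (simp add: K_def)
    fix R :: real assume "max 1 R1 \<le> R" and R: "R > 0"
    then have R1': "R \<ge> 1" "R \<ge> R1" by auto
    define T where "T = (LINT x|lborel. indicator (annulus R) x * (u x powr q * cutpow R m x))"
    define V where "V = (LINT x|lborel. indicat_real (annulus R) (x::'a))"
    define S where "S = (LINT x|lborel. indicator (annulus R) x * (f x * cutpow R m x))"
    have T0: "T \<ge> 0" unfolding T_def by (intro integral_nonneg_AE AE_I2 mult_nonneg_nonneg cutpow_bounds) auto
    have V0: "V \<ge> 0" unfolding V_def by (intro integral_nonneg_AE AE_I2) auto
    have S0: "S \<ge> 0" unfolding S_def by (intro integral_nonneg_AE AE_I2 mult_nonneg_nonneg cutpow_bounds f_nonneg) auto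
    have TS: "T \<le> R powr (- \<gamma>) / c * S"
    proof -
      have "T \<le> (LINT x|lborel. R powr (- \<gamma>) / c * (indicator (annulus R) x * (f x * cutpow R m x)))"
        unfolding T_def
      proof (rule integral_mono')
        have "integrable lborel (\<lambda>x. indicator (annulus R) x *\<^sub>R (f x * cutpow R m x))"
          by (rule borel_integrable_compact[OF compact_annulus])
             (intro continuous_on_mult continuous_on_subset[OF f_cont] cont_cutpow subset_UNIV)
        then show "integrable lborel (\<lambda>x. R powr (- \<gamma>) / c * (indicator (annulus R) x * (f x * cutpow R m x)))" by simp
        fix x :: 'a
        show "0 \<le> R powr (- \<gamma>) / c * (indicator (annulus R) x * (f x * cutpow R m x))"
          using c by (simp add: f_nonneg cutpow_bounds)
        show "indicator (annulus R) x * (u x powr q * cutpow R m x) \<le> R powr (- \<gamma>) / c * (indicator (annulus R) x * (f x * cutpow R m x))"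
        proof (cases "x \<in> annulus R")
          case True
          then have nx: "R \<le> norm x" "norm x \<le> 2 * R" by (auto simp: annulus_def)
          have "R powr \<gamma> * min 1 (2 powr \<gamma>) \<le> norm x powr \<gamma>"
          proof (cases "\<gamma> \<ge> 0")
            case True
            have "R powr \<gamma> * min 1 (2 powr \<gamma>) \<le> R powr \<gamma> * 1" by (intro mult_left_mono) auto
            also have "R powr \<gamma> * 1 \<le> norm x powr \<gamma>" using True nx R by (simp add: powr_mono2)
            finally show ?thesis .
          next
            case False
            have "R powr \<gamma> * min 1 (2 powr \<gamma>) \<le> R powr \<gamma> * 2 powr \<gamma>" by (intro mult_left_mono) auto
            also have "\<dots> = (2 * R) powr \<gamma>" using R by (simp add: powr_mult mult.commute)
            also have "\<dots> \<le> norm x powr \<gamma>" using False nx R by (intro powr_mono2') auto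
            finally show ?thesis .
          qed
          then have "c * R powr \<gamma> \<le> h x"
            using h[of x] nx R1' a mult_left_mono[of "R powr \<gamma> * min 1 (2 powr \<gamma>)" "norm x powr \<gamma>" a]
            by (simp add: c_def mult_ac)
          then have "1 \<le> R powr (- \<gamma>) / c * h x"
            using c R by (simp add: powr_minus field_simps)
          then have "1 * (u x powr q * cutpow R m x) \<le> R powr (- \<gamma>) / c * h x * (u x powr q * cutpow R m x)"
            by (intro mult_right_mono) (auto simp: cutpow_bounds)
          then show ?thesis using True by (simp add: feq mult_ac)
        qed simp
      qed
      then show ?thesis by (simp add: S_def)
    qed
    have VB: "V \<le> B * R powr N" unfolding V_def B_def N_def by (rule annulus_measure_le[OF R])
    have W1: "annulus_moment s1 0 R m powr ((p - 1) / p) \<le> (T powr (s1 / q) * V powr (1 - s1 / q)) powr ((p - 1) / p)"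
      using annulus_moment_interpolation[OF u0 R m s(1,2) ms(1)] p_gt_1 energies_nonneg(3) by (intro powr_mono2) (auto simp: T_def V_def)
    have W2: "annulus_moment s2 0 R m powr (1 / p) \<le> (T powr (s2 / q) * V powr (1 - s2 / q)) powr (1 / p)"
      using annulus_moment_interpolation[OF u0 R m s(3,4) ms(2)] p_gt_1 energies_nonneg(3) by (intro powr_mono2) (auto simp: T_def V_def)
    have "annulus_moment s1 0 R m powr ((p - 1) / p) * annulus_moment s2 0 R m powr (1 / p)
       \<le> (T powr (s1 / q) * V powr (1 - s1 / q)) powr ((p - 1) / p) * (T powr (s2 / q) * V powr (1 - s2 / q)) powr (1 / p)"
      by (intro mult_mono W1 W2) auto
    also have "\<dots> = T powr (s1 / q * ((p - 1) / p) + s2 / q * (1 / p)) * V powr ((1 - s1 / q) * ((p - 1) / p) + (1 - s2 / q) * (1 / p))"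
      by (simp only: powr_mult powr_powr powr_add mult_ac)
    also have "(1 - s1 / q) * ((p - 1) / p) + (1 - s2 / q) * (1 / p) = 1 - \<alpha>"
    proof -
      have "(1 - s1 / q) * ((p - 1) / p) + (1 - s2 / q) * (1 / p)
        = ((p - 1) / p + 1 / p) - (s1 / q * ((p - 1) / p) + s2 / q * (1 / p))"
        by (simp only: left_diff_distrib mult_1_left)
      also have "(p - 1) / p + 1 / p = 1" using p_gt_1 by (simp add: add_divide_distrib[symmetric])
      finally show ?thesis by (simp only: al_eq)
    qed
    also have "s1 / q * ((p - 1) / p) + s2 / q * (1 / p) = \<alpha>" by (rule al_eq)
    also have "T powr \<alpha> * V powr (1 - \<alpha>) \<le> (R powr (- \<gamma>) / c * S) powr \<alpha> * (B * R powr N) powr (1 - \<alpha>)"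
      using al TS VB T0 V0 by (intro mult_mono powr_mono2) auto
    also have "\<dots> = (1 / c) powr \<alpha> * B powr (1 - \<alpha>) * S powr \<alpha> * R powr (- \<gamma> * \<alpha> + N * (1 - \<alpha>))"
    proof -
      have "R powr (- \<gamma>) / c * S = R powr (- \<gamma>) * ((1 / c) * S)" by simp
      then show ?thesis by (simp only: powr_mult powr_powr powr_add mult_ac)
    qed
    finally have WW: "annulus_moment s1 0 R m powr ((p - 1) / p) * annulus_moment s2 0 R m powr (1 / p)
       \<le> (1 / c) powr \<alpha> * B powr (1 - \<alpha>) * S powr \<alpha> * R powr (- \<gamma> * \<alpha> + N * (1 - \<alpha>))" .
    have "(LINT x|lborel. f x * cutpow R m x)
      \<le> C / R * ((C / (d * R)) powr (p - 1) * (annulus_moment s1 0 R m powr ((p - 1) / p) * annulus_moment s2 0 R m powr (1 / p)))"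
      unfolding s1_def s2_def by (rule mass_estimate[OF u0 R m d(1,2) less_imp_le[OF C] hC[OF R]])
    also have "\<dots> \<le> C / R * ((C / (d * R)) powr (p - 1) *
        ((1 / c) powr \<alpha> * B powr (1 - \<alpha>) * S powr \<alpha> * R powr (- \<gamma> * \<alpha> + N * (1 - \<alpha>))))"
      using C R by (intro mult_left_mono WW) auto
    also have "C / R = C * R powr (- 1)" using R by (simp add: powr_minus divide_inverse)
    also have "(C / (d * R)) powr (p - 1) = (C / d) powr (p - 1) * R powr (- (p - 1))"
    proof -
      have "C / (d * R) = C / d * R powr (- 1)" using R by (simp add: powr_minus divide_inverse)
      then show ?thesis by (simp only: powr_mult powr_powr mult_minus1)
    qed
    also have "C * R powr (- 1) * ((C / d) powr (p - 1) * R powr (- (p - 1)) *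
        ((1 / c) powr \<alpha> * B powr (1 - \<alpha>) * S powr \<alpha> * R powr (- \<gamma> * \<alpha> + N * (1 - \<alpha>))))
       = K * S powr \<alpha> * (R powr (- 1) * R powr (- (p - 1)) * R powr (- \<gamma> * \<alpha> + N * (1 - \<alpha>)))"
      by (simp only: K_def mult_ac)
    also have "R powr (- 1) * R powr (- (p - 1)) * R powr (- \<gamma> * \<alpha> + N * (1 - \<alpha>)) = R powr (- p - \<gamma> * \<alpha> + N * (1 - \<alpha>))"
    proof -
      have "- 1 + - (p - 1) + (- \<gamma> * \<alpha> + N * (1 - \<alpha>)) = - p - \<gamma> * \<alpha> + N * (1 - \<alpha>)" by simp
      then show ?thesis by (simp only: powr_add[symmetric])
    qed
    also have "K * S powr \<alpha> * R powr (- p - \<gamma> * \<alpha> + N * (1 - \<alpha>)) \<le> K * S powr \<alpha> * R powr 0"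
      using \<open>K \<ge> 0\<close> R1' expo by (intro mult_left_mono powr_mono) auto
    finally show "(LINT x|lborel. f x * cutpow R m x) \<le> K * (LINT x|lborel. indicator (annulus R) x * (f x * cutpow R m x)) powr \<alpha>"
      using R by (simp add: S_def)
  qed (use f_nonneg al m0 in auto)

  have far: "AE x in lborel. norm x \<ge> R1 \<longrightarrow> u x = 0"
    using f_zero
  proof (rule eventually_mono)
    fix x assume "f x = 0"
    then show "norm x \<ge> R1 \<longrightarrow> u x = 0"
      using h[of x] a R1 by (auto simp: feq)
  qed
  have const: "u x = u y" for x y
    by (rule constant_if_gradient_vanishes[OF gradient_vanishes_if_zero_far[OF u0 R1 far]])
  obtain y where "norm y \<ge> R1" "u y = 0"
  proof (rule ccontr)
    assume "\<not> thesis"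
    with that have "norm y \<ge> R1 \<Longrightarrow> u y \<noteq> 0" for y by blast
    with far have "AE x in lborel. x \<notin> {x::'a. norm x > R1}" by (auto elim!: eventually_mono)
    moreover have op: "open {x::'a. norm x > R1}" by (intro open_Collect_less continuous_intros)
    ultimately have "{x::'a. norm x > R1} \<in> null_sets lborel"
      by (intro AE_iff_null_sets[THEN iffD2]) auto
    then have "negligible {x::'a. norm x > R1}"
      unfolding negligible_iff_null_sets by (rule null_sets_completionI)
    then have "{x::'a. norm x > R1} = {}" using open_not_negligible[OF op] by blast
    moreover obtain z :: 'a where "norm z = R1 + 1" using vector_choose_size[of "R1 + 1"] R1 by auto
    moreover from \<open>norm z = R1 + 1\<close> have "z \<in> {x::'a. norm x > R1}" by simp
    ultimately show False by blast
  qed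
  then show ?thesis using const[of x y] by simp
qed

end

theorem theorem1p1:
  fixes p :: real
  assumes "p > 1"
  shows
    "(real CARD('n) > p \<longrightarrow>
       (\<forall>(h :: real ^ 'n \<Rightarrow> real) (a :: real) (\<gamma> :: real) (q :: real) (u :: real ^ 'n \<Rightarrow> real).
          continuous_on UNIV h \<and> (\<forall>x. 0 \<le> h x) \<and> a > 0 \<and> \<gamma> > - p \<and>
          (\<forall>\<^sub>F x in at_infinity. h x = a * norm x powr \<gamma>) \<and>
          p - 1 < q \<and> q \<le> (real CARD('n) + \<gamma>) * (p - 1) / (real CARD('n) - p) \<and>
          continuous_on UNIV u \<and> (\<forall>x. 0 \<le> u x) \<and>
          weak_supersolution p (\<lambda>x. h x * u x powr q) u
          \<longrightarrow> (\<forall>x. u x = 0)))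
     \<and>
     (real CARD('n) \<le> p \<longrightarrow>
       (\<forall>u :: real ^ 'n \<Rightarrow> real.
          continuous_on UNIV u \<and> bdd_below (range u) \<and>
          weak_supersolution p (\<lambda>x. 0) u
          \<longrightarrow> u constant_on UNIV))"
proof (intro conjI impI allI; (elim conjE)?)
  fix h u :: "real ^ 'n \<Rightarrow> real" and a \<gamma> q :: real and x
  assume dim: "p < real CARD('n)"
    and hc: "continuous_on UNIV h" and h0: "\<forall>x. 0 \<le> h x" and a: "0 < a"
    and hev: "\<forall>\<^sub>F x in at_infinity. h x = a * norm x powr \<gamma>"
    and q: "p - 1 < q" "q \<le> (real CARD('n) + \<gamma>) * (p - 1) / (real CARD('n) - p)"
    and uc: "continuous_on UNIV u" and u0: "\<forall>x. 0 \<le> u x"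
    and ws: "weak_supersolution p (\<lambda>x. h x * u x powr q) u"
  have fc: "continuous_on UNIV (\<lambda>x. h x * u x powr q)"
    using u0 q assms by (intro continuous_on_mult hc continuous_on_powr' uc continuous_intros) auto
  obtain g where g: "g \<in> borel_measurable borel" "loc_int g" "loc_int (\<lambda>x. norm (g x) powr p)" "weak_deriv u g"
    "\<forall>\<phi>. test_function \<phi> \<and> (\<forall>x. 0 \<le> \<phi> x) \<longrightarrow>
      (LINT x|lborel. h x * u x powr q * \<phi> x) \<le> (LINT x|lborel. p_flux p (g x) \<bullet> grad \<phi> x)"
    using weak_supersolution_borel[OF uc borel_measurable_continuous_onI[OF fc] ws] by blast
  have nn: "0 \<le> h x * u x powr q" for x using h0 by simp
  interpret p_supersolution p "\<lambda>x. h x * u x powr q" u g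
    by (rule p_supersolution.intro; (fact | use g(5) in blast))
  obtain b where b: "\<And>x. b \<le> norm x \<Longrightarrow> h x = a * norm x powr \<gamma>"
    using hev by (auto simp: eventually_at_infinity)
  show "u x = 0"
    by (rule supersolution_vanishes[where h = h and q = q and a = a and \<gamma> = \<gamma> and ?R1.0 = "max b 1"])
       (use dim u0 a b q in auto)
next
  fix u :: "real ^ 'n \<Rightarrow> real"
  assume dim: "real CARD('n) \<le> p" and uc: "continuous_on UNIV u" and bdd: "bdd_below (range u)"
    and ws: "weak_supersolution p (\<lambda>x. 0) u"
  obtain g where g: "g \<in> borel_measurable borel" "loc_int g" "loc_int (\<lambda>x. norm (g x) powr p)" "weak_deriv u g"
    "\<forall>\<phi>. test_function \<phi> \<and> (\<forall>x. 0 \<le> \<phi> x) \<longrightarrow>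
      (LINT x|lborel. 0 * \<phi> x) \<le> (LINT x|lborel. p_flux p (g x) \<bullet> grad \<phi> x)"
    using weak_supersolution_borel[OF uc borel_measurable_const ws] by blast
  interpret p_supersolution p "\<lambda>x. 0" u g
    by (rule p_supersolution.intro; (fact | use g(5) in blast | simp))
  have "u x = u 0" for x
    by (rule supersolution_constant[OF _ bdd]) (use dim in simp)
  then show "u constant_on UNIV" by (auto simp: constant_on_def)
qed

end
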